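(* Let $I = \langle F_1,\ldots,F_s\rangle \subset K[X]$ be the ideal generated by the homogeneous elements $F_1,\dots,F_s$ described in the context, and suppose that $I$ defines a reduced subscheme $V_X(I)$ of $X$ which consists of $\delta < \infty$ points. Let $d$ and $e > 0$ be integers with $d, d+e \in \mathrm{Reg}(I)$, and let $h \in K[X]_e$ be non-vanishing at all points of $V_X(I)$. Let $N : K[X]_{d+e} \rightarrow K^\delta$ be the linear map given by a matrix $N_X(d+e)$, and for $p \in K[X]_e$ let $N_p : K[X]_d \rightarrow K^\delta$ be the linear map $N_p(g) = N(gp)$. Then there exists a subspace $B \subset K[X]_d$ such that the restriction $(N_h)_{|B} : B \to K^\delta$ is invertible. Moreover, for any $p \in K[X]_e$, the eigenvalues (in $\overline{K}$) of $$(N_h)_{|B}^{-1} \circ (N_p)_{|B} : B \longrightarrow B$$ are $\frac{p}{h}(z)$, for $z \in V_X(I)$.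
   Context: Setting. $K$ is a field with algebraic closure $\overline{K}$; $\phi_0,\ldots,\phi_\ell \in K[t_1,\ldots,t_n]$ are nonzero polynomials; $X \subset \mathbb{P}^\ell_{\overline{K}}$ is the closure of the image of the rational map $\overline{K}^{\,n} \dashrightarrow \mathbb{P}^\ell_{\overline{K}}$, $t \mapsto (\phi_0(t):\cdots:\phi_\ell(t))$. Its coordinate ring over $K$ is $K[X] = K[x_0,\ldots,x_\ell]/I(X)$, where $I(X)$ is the kernel of $K[x_0,\ldots,x_\ell] \to K[t_0,\ldots,t_n]$, $x_i \mapsto t_0\phi_i$; thus $K[X]$ is isomorphic, as a graded ring, to the subalgebra $K[\mathcal{F}] \subset K[t_0,\ldots,t_n]$ generated by $\mathcal{F} = \{t_0\phi_0,\ldots,t_0\phi_\ell\}$ (graded by degree in $t_0$). It is assumed that $\mathcal{F}$ is a Khovanskii basis for $K[\mathcal{F}]$ with respect to some monomial order $\prec$ on $K[t_0,\ldots,t_n]$, meaning that the initial algebra $\mathrm{in}_\prec(K[\mathcal{F}]) = K[\mathrm{in}_\prec(\psi) : \psi \in K[\mathcal{F}]]$ (with $\mathrm{in}_\prec$ the leading term) equals $K[\mathrm{in}_\prec(t_0\phi_0),\ldots,\mathrm{in}_\prec(t_0\phi_\ell)]$. Bases. Let $\alpha_i \in \mathbb{N}^{n+1}$ be the leading exponent of $t_0\phi_i$, let $A = [\alpha_0 \cdots \alpha_\ell]$, and for an integer $d \ge 0$ let $d\cdot A = \{\alpha_{i_1}+\cdots+\alpha_{i_d} : 0\le i_j\le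 \ell\}$ (with $0\cdot A = \{0\}$ and $d\cdot A=\emptyset$ for $d<0$). For each $\beta\in d\cdot A$ fix indices $i_1\le\cdots\le i_d$ with $\alpha_{i_1}+\cdots+\alpha_{i_d}=\beta$ and let $b_{d,\beta} = t_0^d\phi_{i_1}\cdots\phi_{i_d}$, which corresponds to the monomial $x_{i_1}\cdots x_{i_d} \in K[X]_d$. By the Khovanskii basis property, $\{b_{d,\beta}\}_{\beta\in d\cdot A}$ is a $K$-basis of $K[\mathcal{F}]_d \cong K[X]_d$. Equations and matrices. For $i=1,\ldots,s$, $d_i$ is a positive integer, $F_i = \sum_{|\alpha|=d_i} c_{i,\alpha}x^\alpha$ with $c_{i,\alpha}\in K$ (regarded as an element of $K[X]_{d_i}$), and $f_i = F_i(\phi_0,\ldots,\phi_\ell)$. The Khovanskii-Macaulay matrix $M_X(d)$ of $(f_1,\ldots,f_s)$ in degree $d$ has rows indexed by pairs $(i,\gamma)$ with $i\in\{1,\ldots,s\}$, $\gamma\in(d-d_i)\cdot A$, and columns indexed by $\beta\in d\cdot A$, with entries defined by $b_{d-d_i,\gamma}\cdot t_0^{d_i} f_i = \sum_{\beta\in d\cdot A} M_X(d)_{(i,\gamma),\beta}\, b_{d,\beta}$. The matrix $N_X(d)$ is the transpose of a kernel matrix of $M_X(d)$: its rows form a $K$-basis of the right kernel of $M_X(d)$. Its columns are indexed by the basis of $K[X]_d$ above, so it represents a linear map on $K[X]_d$; when $d\in\mathrm{Reg}(I)$ the map is $K[X]_d\to K^\delta$. Regularity. $V_X(I)$ is the subscheme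 of $X$ (over $\overline{K}$) defined by $I$, assumed zero-dimensional of degree $\delta<\infty$. The saturation is $I^{\mathrm{sat}} = \{f\in K[X] : K[X]_d\cdot f\subset I \text{ for some } d\in\mathbb{N}\}$. With $\mathrm{HF}_M(d) = \dim_K M_d$, $\mathrm{Reg}(I) = \{d\in\mathbb{Z} : \mathrm{HF}_{K[X]/I}(d)=\delta \text{ and } I_d = I_d^{\mathrm{sat}}\}$. For homogeneous $p,h\in K[X]_e$ and a point $z$ with $h(z)\ne0$, $\frac{p}{h}(z)$ denotes the well-defined value $p(z)/h(z)\in\overline{K}$. *)

theory Defs
  imports
    "HOL-Library.Poly_Mapping"
    "HOL-Algebra.Algebra"
    "HOL-Algebra.Algebraic_Closure_Type"
    "Jordan_Normal_Form.Char_Poly"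
begin

section \<open>Polynomials in several variables\<close>

text \<open>
  A monomial is a finitely supported exponent vector indexed by variable numbers, and a polynomial
  is a finitely supported family of coefficients; multiplication is convolution.  The same type
  serves for the variables \<open>x\<^sub>0, \<dots>, x\<^sub>l\<close> and for \<open>t\<^sub>0, \<dots>, t\<^sub>n\<close>; the ring \<open>poly_ring_upto m\<close> fixes
  the range of variables.
\<close>

type_synonym expo = "nat \<Rightarrow>\<^sub>0 nat"
type_synonym 'a mpoly = "expo \<Rightarrow>\<^sub>0 'a"

definition mconst :: "'a::comm_ring_1 \<Rightarrow> 'a mpoly" where
  "mconst c = Poly_Mapping.single 0 c"

definition mvar :: "nat \<Rightarrow> 'a::comm_ring_1 mpoly" where
  "mvar i = Poly_Mapping.single (Poly_Mapping.single i 1) 1"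

definition mvars :: "'a::comm_ring_1 mpoly \<Rightarrow> nat set" where
  "mvars p = (\<Union>m\<in>Poly_Mapping.keys p. Poly_Mapping.keys m)"

definition expo_deg :: "expo \<Rightarrow> nat" where
  "expo_deg m = (\<Sum>i\<in>Poly_Mapping.keys m. Poly_Mapping.lookup m i)"

text \<open>The zero polynomial is homogeneous of every degree.\<close>

definition mhomog :: "nat \<Rightarrow> 'a::comm_ring_1 mpoly \<Rightarrow> bool" where
  "mhomog d p \<longleftrightarrow> (\<forall>m\<in>Poly_Mapping.keys p. expo_deg m = d)"

text \<open>
  Substitution of \<open>v i\<close> for the \<open>i\<close>-th variable, with coefficients transported along \<open>emb\<close>
  (in use: \<open>mconst\<close> for substituting polynomials, \<open>to_ac\<close> for evaluating at points over the
  algebraic closure, and \<open>id\<close>).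
\<close>

definition meval :: "('a::comm_ring_1 \<Rightarrow> 'b::comm_ring_1) \<Rightarrow> (nat \<Rightarrow> 'b) \<Rightarrow> 'a mpoly \<Rightarrow> 'b" where
  "meval emb v p = (\<Sum>m\<in>Poly_Mapping.keys p. emb (Poly_Mapping.lookup p m) *
      (\<Prod>i\<in>Poly_Mapping.keys m. v i ^ Poly_Mapping.lookup m i))"

definition poly_ring_upto :: "nat \<Rightarrow> 'a::comm_ring_1 mpoly ring" where
  "poly_ring_upto m = \<lparr>carrier = {p. mvars p \<subseteq> {0..m}}, monoid.mult = (*), one = 1,
      ring.zero = 0, add = (+)\<rparr>"


section \<open>The parametrised variety and its coordinate ring\<close>

definition param_map :: "(nat \<Rightarrow> 'k::field mpoly) \<Rightarrow> 'k mpoly \<Rightarrow> 'k mpoly" where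
  "param_map \<phi> = meval mconst (\<lambda>i. mvar 0 * \<phi> i)"

definition ideal_X :: "nat \<Rightarrow> nat \<Rightarrow> (nat \<Rightarrow> 'k::field mpoly) \<Rightarrow> 'k mpoly set" where
  "ideal_X n l \<phi> = a_kernel (poly_ring_upto l) (poly_ring_upto n) (param_map \<phi>)"

definition coord_ring :: "nat \<Rightarrow> nat \<Rightarrow> (nat \<Rightarrow> 'k::field mpoly) \<Rightarrow> 'k mpoly set ring" where
  "coord_ring n l \<phi> = poly_ring_upto l Quot ideal_X n l \<phi>"

definition cls :: "nat \<Rightarrow> nat \<Rightarrow> (nat \<Rightarrow> 'k::field mpoly) \<Rightarrow> 'k mpoly \<Rightarrow> 'k mpoly set" where
  "cls n l \<phi> P = ideal_X n l \<phi> +>\<^bsub>poly_ring_upto l\<^esub> P"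

definition coord_const :: "nat \<Rightarrow> nat \<Rightarrow> (nat \<Rightarrow> 'k::field mpoly) \<Rightarrow> 'k \<Rightarrow> 'k mpoly set" where
  "coord_const n l \<phi> c = cls n l \<phi> (mconst c)"

definition coord_deg :: "nat \<Rightarrow> nat \<Rightarrow> (nat \<Rightarrow> 'k::field mpoly) \<Rightarrow> int \<Rightarrow> 'k mpoly set set" where
  "coord_deg n l \<phi> d = (if d < 0 then {\<zero>\<^bsub>coord_ring n l \<phi>\<^esub>}
     else {cls n l \<phi> P | P. P \<in> carrier (poly_ring_upto l) \<and> mhomog (nat d) P})"

text \<open>
  A point of projective space over the algebraic closure is the set of all its homogeneous
  coordinate vectors; vectors are functions that vanish beyond index \<open>l\<close>.
\<close>

type_synonym 'k pt = "(nat \<Rightarrow> 'k alg_closure) set"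

definition proj_pt :: "(nat \<Rightarrow> 'k::field alg_closure) \<Rightarrow> 'k pt" where
  "proj_pt z = {(\<lambda>i. c * z i) | c. c \<noteq> 0}"

definition proj_space :: "nat \<Rightarrow> 'k::field pt set" where
  "proj_space l = {proj_pt z | z. (\<exists>i\<le>l. z i \<noteq> 0) \<and> (\<forall>i>l. z i = 0)}"

definition vanishes :: "'k::field alg_closure mpoly \<Rightarrow> 'k pt \<Rightarrow> bool" where
  "vanishes G Z \<longleftrightarrow> (\<forall>z\<in>Z. meval id z G = 0)"

definition zero_locus :: "nat \<Rightarrow> 'k::field alg_closure mpoly set \<Rightarrow> 'k pt set" where
  "zero_locus l S = {Z \<in> proj_space l. \<forall>G\<in>S. vanishes G Z}"

definition homog_polys :: "nat \<Rightarrow> 'k::field alg_closure mpoly set" where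
  "homog_polys l = {G \<in> carrier (poly_ring_upto l). \<exists>d. mhomog d G}"

definition zariski_closed :: "nat \<Rightarrow> 'k::field pt set \<Rightarrow> bool" where
  "zariski_closed l C \<longleftrightarrow> (\<exists>S \<subseteq> homog_polys l. C = zero_locus l S)"

definition param_image :: "nat \<Rightarrow> (nat \<Rightarrow> 'k::field mpoly) \<Rightarrow> 'k pt set" where
  "param_image l \<phi> = {proj_pt (\<lambda>i. if i \<le> l then meval to_ac t (\<phi> i) else 0) | t.
      \<exists>i\<le>l. meval to_ac t (\<phi> i) \<noteq> 0}"

definition variety_X :: "nat \<Rightarrow> (nat \<Rightarrow> 'k::field mpoly) \<Rightarrow> 'k pt set" where
  "variety_X l \<phi> = zariski_closed l hull param_image l \<phi>"

text \<open>
  The homogeneous ideal, over the algebraic closure, of the subscheme of \<open>X\<close> defined by an ideal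
  \<open>I\<close> of the coordinate ring: the vanishing ideal of \<open>X\<close> plus all representatives of elements
  of \<open>I\<close>.
\<close>

definition scheme_ideal ::
  "nat \<Rightarrow> (nat \<Rightarrow> 'k::field mpoly) \<Rightarrow> 'k mpoly set set \<Rightarrow> 'k alg_closure mpoly set" where
  "scheme_ideal l \<phi> I = Idl\<^bsub>poly_ring_upto l\<^esub>
     ({G \<in> homog_polys l. \<forall>Z\<in>variety_X l \<phi>. vanishes G Z} \<union> Poly_Mapping.map to_ac ` \<Union>I)"

definition scheme_points ::
  "nat \<Rightarrow> (nat \<Rightarrow> 'k::field mpoly) \<Rightarrow> 'k mpoly set set \<Rightarrow> 'k pt set" where
  "scheme_points l \<phi> I = zero_locus l (scheme_ideal l \<phi> I)"

text \<open>
  The local ring of \<open>Proj (S/J)\<close> at a closed point \<open>Z\<close> consists of fractions \<open>g/u\<close> with \<open>g, u\<close>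
  homogeneous of the same degree and \<open>u\<close> not vanishing at \<open>Z\<close>.  Such a fraction is zero iff \<open>g\<close>
  is killed modulo \<open>J\<close> by a homogeneous \<open>w\<close> not vanishing at \<open>Z\<close>; this does not depend on \<open>u\<close>.
\<close>

definition frac_zero ::
  "nat \<Rightarrow> 'k::field alg_closure mpoly set \<Rightarrow> 'k pt \<Rightarrow> 'k alg_closure mpoly \<Rightarrow> bool" where
  "frac_zero l J Z g \<longleftrightarrow> (\<exists>w\<in>homog_polys l. \<not> vanishes w Z \<and> w * g \<in> J)"

definition reduced_at :: "nat \<Rightarrow> 'k::field alg_closure mpoly set \<Rightarrow> 'k pt \<Rightarrow> bool" where
  "reduced_at l J Z \<longleftrightarrow> (\<forall>e. \<forall>g\<in>homog_polys l. \<forall>u\<in>homog_polys l.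
      mhomog e g \<longrightarrow> mhomog e u \<longrightarrow> \<not> vanishes u Z \<longrightarrow>
      (\<exists>k. frac_zero l J Z (g ^ k)) \<longrightarrow> frac_zero l J Z g)"

text \<open>
  A scheme is reduced iff all its local rings are; for a scheme of finite type over an
  algebraically closed field the closed points suffice.
\<close>

definition reduced_scheme ::
  "nat \<Rightarrow> (nat \<Rightarrow> 'k::field mpoly) \<Rightarrow> 'k mpoly set set \<Rightarrow> bool" where
  "reduced_scheme l \<phi> I \<longleftrightarrow> (\<forall>Z\<in>scheme_points l \<phi> I. reduced_at l (scheme_ideal l \<phi> I) Z)"

text \<open>
  The value of an element of \<open>K[X]\<close> at a homogeneous coordinate vector of a point of \<open>X\<close>: all
  representatives take the same value there.
\<close>

definition coord_val :: "'k::field mpoly set \<Rightarrow> (nat \<Rightarrow> 'k alg_closure) \<Rightarrow> 'k alg_closure" where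
  "coord_val p z = the_elem (meval to_ac z ` p)"


section \<open>Khovanskii bases\<close>

definition monomial_order :: "nat \<Rightarrow> (expo \<times> expo) set \<Rightarrow> bool" where
  "monomial_order n r \<longleftrightarrow> well_order_on {m. Poly_Mapping.keys m \<subseteq> {0..n}} r \<and>
     (\<forall>a b c. (a, b) \<in> r \<longrightarrow> Poly_Mapping.keys c \<subseteq> {0..n} \<longrightarrow> (a + c, b + c) \<in> r)"

definition lead_expo :: "(expo \<times> expo) set \<Rightarrow> 'k::field mpoly \<Rightarrow> expo" where
  "lead_expo r p = (THE m. m \<in> Poly_Mapping.keys p \<and> (\<forall>m'\<in>Poly_Mapping.keys p. (m', m) \<in> r))"

definition lead_term :: "(expo \<times> expo) set \<Rightarrow> 'k::field mpoly \<Rightarrow> 'k mpoly" where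
  "lead_term r p = Poly_Mapping.single (lead_expo r p) (Poly_Mapping.lookup p (lead_expo r p))"

inductive_set alg_gen :: "'k::field mpoly set \<Rightarrow> 'k mpoly set" for S where
  gen: "p \<in> S \<Longrightarrow> p \<in> alg_gen S"
| const: "mconst c \<in> alg_gen S"
| add: "p \<in> alg_gen S \<Longrightarrow> q \<in> alg_gen S \<Longrightarrow> p + q \<in> alg_gen S"
| mult: "p \<in> alg_gen S \<Longrightarrow> q \<in> alg_gen S \<Longrightarrow> p * q \<in> alg_gen S"

definition khovanskii_basis :: "(expo \<times> expo) set \<Rightarrow> 'k::field mpoly set \<Rightarrow> bool" where
  "khovanskii_basis r \<F> \<longleftrightarrow>
     alg_gen (lead_term r ` (alg_gen \<F> - {0})) = alg_gen (lead_term r ` \<F>)"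

definition gen_family :: "nat \<Rightarrow> (nat \<Rightarrow> 'k::field mpoly) \<Rightarrow> 'k mpoly set" where
  "gen_family l \<phi> = (\<lambda>i. mvar 0 * \<phi> i) ` {0..l}"

definition dA :: "(expo \<times> expo) set \<Rightarrow> nat \<Rightarrow> (nat \<Rightarrow> 'k::field mpoly) \<Rightarrow> int \<Rightarrow> expo set" where
  "dA r l \<phi> d = (if d < 0 then {}
     else {(\<Sum>i\<leftarrow>js. lead_expo r (mvar 0 * \<phi> i)) | js. length js = nat d \<and> set js \<subseteq> {0..l}})"

text \<open>
  \<open>idx d \<beta>\<close> is the fixed list of indices \<open>i\<^sub>1 \<le> \<dots> \<le> i\<^sub>d\<close> with
  \<open>\<alpha>\<^bsub>i\<^sub>1\<^esub> + \<dots> + \<alpha>\<^bsub>i\<^sub>d\<^esub> = \<beta>\<close>.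
\<close>

definition index_choice :: "(expo \<times> expo) set \<Rightarrow> nat \<Rightarrow> (nat \<Rightarrow> 'k::field mpoly) \<Rightarrow>
    (int \<Rightarrow> expo \<Rightarrow> nat list) \<Rightarrow> bool" where
  "index_choice r l \<phi> idx \<longleftrightarrow> (\<forall>d. \<forall>\<beta>\<in>dA r l \<phi> d.
     sorted (idx d \<beta>) \<and> length (idx d \<beta>) = nat d \<and> set (idx d \<beta>) \<subseteq> {0..l} \<and>
     (\<Sum>i\<leftarrow>idx d \<beta>. lead_expo r (mvar 0 * \<phi> i)) = \<beta>)"

definition basis_poly :: "(nat \<Rightarrow> 'k::field mpoly) \<Rightarrow> (int \<Rightarrow> expo \<Rightarrow> nat list) \<Rightarrow>
    int \<Rightarrow> expo \<Rightarrow> 'k mpoly" where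
  "basis_poly \<phi> idx d \<beta> = mvar 0 ^ nat d * (\<Prod>i\<leftarrow>idx d \<beta>. \<phi> i)"

text \<open>The monomial \<open>x\<^bsub>i\<^sub>1\<^esub> \<dots> x\<^bsub>i\<^sub>d\<^esub>\<close> whose class corresponds to \<open>basis_poly\<close>.\<close>

definition basis_mono :: "(int \<Rightarrow> expo \<Rightarrow> nat list) \<Rightarrow> int \<Rightarrow> expo \<Rightarrow> 'k::field mpoly" where
  "basis_mono idx d \<beta> = (\<Prod>i\<leftarrow>idx d \<beta>. mvar i)"

definition coords :: "nat \<Rightarrow> nat \<Rightarrow> (nat \<Rightarrow> 'k::field mpoly) \<Rightarrow> (expo \<times> expo) set \<Rightarrow>
    (int \<Rightarrow> expo \<Rightarrow> nat list) \<Rightarrow> int \<Rightarrow> 'k mpoly set \<Rightarrow> expo \<Rightarrow> 'k" where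
  "coords n l \<phi> r idx d g = (THE c. (\<forall>\<beta>. \<beta> \<notin> dA r l \<phi> d \<longrightarrow> c \<beta> = 0) \<and>
     g = cls n l \<phi> (\<Sum>\<beta>\<in>dA r l \<phi> d. mconst (c \<beta>) * basis_mono idx d \<beta>))"


section \<open>Khovanskii-Macaulay matrices\<close>

text \<open>Matrices are functions of a row index and a column index.\<close>

definition macaulay_rows :: "(expo \<times> expo) set \<Rightarrow> nat \<Rightarrow> (nat \<Rightarrow> 'k::field mpoly) \<Rightarrow>
    nat \<Rightarrow> (nat \<Rightarrow> nat) \<Rightarrow> int \<Rightarrow> (nat \<times> expo) set" where
  "macaulay_rows r l \<phi> s ds d = (SIGMA i:{1..s}. dA r l \<phi> (d - int (ds i)))"

definition macaulay_matrix :: "nat \<Rightarrow> (nat \<Rightarrow> 'k::field mpoly) \<Rightarrow> (expo \<times> expo) set \<Rightarrow>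
    (int \<Rightarrow> expo \<Rightarrow> nat list) \<Rightarrow> nat \<Rightarrow> (nat \<Rightarrow> nat) \<Rightarrow> (nat \<Rightarrow> 'k mpoly) \<Rightarrow> int \<Rightarrow>
    (nat \<times> expo \<Rightarrow> expo \<Rightarrow> 'k) \<Rightarrow> bool" where
  "macaulay_matrix l \<phi> r idx s ds F d M \<longleftrightarrow> (\<forall>(i, \<gamma>)\<in>macaulay_rows r l \<phi> s ds d.
     basis_poly \<phi> idx (d - int (ds i)) \<gamma> * (mvar 0 ^ ds i * meval mconst \<phi> (F i)) =
     (\<Sum>\<beta>\<in>dA r l \<phi> d. mconst (M (i, \<gamma>) \<beta>) * basis_poly \<phi> idx d \<beta>))"

text \<open>Vectors in the right kernel are extended by zero outside the column index set.\<close>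

definition right_kernel ::
  "'r set \<Rightarrow> 'c set \<Rightarrow> ('r \<Rightarrow> 'c \<Rightarrow> 'k::field) \<Rightarrow> ('c \<Rightarrow> 'k) set" where
  "right_kernel Rs Cs M =
     {v. (\<forall>\<beta>. \<beta> \<notin> Cs \<longrightarrow> v \<beta> = 0) \<and> (\<forall>\<rho>\<in>Rs. (\<Sum>\<beta>\<in>Cs. M \<rho> \<beta> * v \<beta>) = 0)}"

text \<open>The rows \<open>N 0, \<dots>, N (\<delta> - 1)\<close> are linearly independent and span \<open>W\<close>.\<close>

definition rows_basis :: "nat \<Rightarrow> (nat \<Rightarrow> 'c \<Rightarrow> 'k::field) \<Rightarrow> ('c \<Rightarrow> 'k) set \<Rightarrow> bool" where
  "rows_basis \<delta> N W \<longleftrightarrow>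
     (\<forall>a. (\<forall>\<beta>. (\<Sum>j<\<delta>. a j * N j \<beta>) = 0) \<longrightarrow> (\<forall>j<\<delta>. a j = 0)) \<and>
     {(\<lambda>\<beta>. \<Sum>j<\<delta>. a j * N j \<beta>) | a. True} = W"

definition kernel_map :: "nat \<Rightarrow> nat \<Rightarrow> (nat \<Rightarrow> 'k::field mpoly) \<Rightarrow> (expo \<times> expo) set \<Rightarrow>
    (int \<Rightarrow> expo \<Rightarrow> nat list) \<Rightarrow> nat \<Rightarrow> int \<Rightarrow> (nat \<Rightarrow> expo \<Rightarrow> 'k) \<Rightarrow> 'k mpoly set \<Rightarrow> 'k vec" where
  "kernel_map n l \<phi> r idx \<delta> d N g =
     vec \<delta> (\<lambda>j. \<Sum>\<beta>\<in>dA r l \<phi> d. N j \<beta> * coords n l \<phi> r idx d g \<beta>)"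


section \<open>Regularity\<close>

definition saturation ::
  "nat \<Rightarrow> nat \<Rightarrow> (nat \<Rightarrow> 'k::field mpoly) \<Rightarrow> 'k mpoly set set \<Rightarrow> 'k mpoly set set" where
  "saturation n l \<phi> I = {f \<in> carrier (coord_ring n l \<phi>).
     \<exists>d::nat. \<forall>g\<in>coord_deg n l \<phi> (int d). g \<otimes>\<^bsub>coord_ring n l \<phi>\<^esub> f \<in> I}"

text \<open>\<open>quot_HF_eq n l \<phi> I d k\<close>: the Hilbert function of \<open>K[X]/I\<close> takes the value \<open>k\<close> at \<open>d\<close>.\<close>

definition quot_HF_eq :: "nat \<Rightarrow> nat \<Rightarrow> (nat \<Rightarrow> 'k::field mpoly) \<Rightarrow> 'k mpoly set set \<Rightarrow>
    int \<Rightarrow> nat \<Rightarrow> bool" where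
  "quot_HF_eq n l \<phi> I d k \<longleftrightarrow> ring.dimension (coord_ring n l \<phi> Quot I) k
     ((\<lambda>c. I +>\<^bsub>coord_ring n l \<phi>\<^esub> coord_const n l \<phi> c) ` UNIV)
     ((\<lambda>g. I +>\<^bsub>coord_ring n l \<phi>\<^esub> g) ` coord_deg n l \<phi> d)"

definition Reg :: "nat \<Rightarrow> nat \<Rightarrow> (nat \<Rightarrow> 'k::field mpoly) \<Rightarrow> nat \<Rightarrow> 'k mpoly set set \<Rightarrow> int set" where
  "Reg n l \<phi> \<delta> I = {d. quot_HF_eq n l \<phi> I d \<delta> \<and>
     I \<inter> coord_deg n l \<phi> d = saturation n l \<phi> I \<inter> coord_deg n l \<phi> d}"


section \<open>Eigenvalues over the algebraic closure\<close>

text \<open>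
  \<open>T\<close> is an endomorphism of the finite-dimensional subspace \<open>B\<close> of a ring \<open>R\<close>, with scalars
  embedded by \<open>\<iota>\<close>; \<open>A\<close> is the matrix of \<open>T\<close> in the basis \<open>Us\<close> of \<open>B\<close>.  The notion does not
  depend on the basis.
\<close>

definition ac_eigenvalue :: "('a, 'm) ring_scheme \<Rightarrow> ('k::field \<Rightarrow> 'a) \<Rightarrow> 'a set \<Rightarrow> ('a \<Rightarrow> 'a) \<Rightarrow>
    'k alg_closure \<Rightarrow> bool" where
  "ac_eigenvalue R \<iota> B T \<mu> \<longleftrightarrow> (\<exists>Us A.
     ring.independent R (\<iota> ` UNIV) Us \<and> ring.Span R (\<iota> ` UNIV) Us = B \<and>
     A \<in> carrier_mat (length Us) (length Us) \<and>
     (\<forall>j<length Us. T (Us ! j) = ring.combine R (map \<iota> (list_of_vec (col A j))) Us) \<and>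
     eigenvalue (map_mat to_ac A) \<mu>)"

text \<open>
  \<open>B\<close> is a \<open>K\<close>-subspace of \<open>K[X]\<^sub>d\<close> on which \<open>L\<close> restricts to a bijection onto \<open>K\<^sup>\<delta>\<close>.
  The library locale \<open>subalgebra\<close> says: additive subgroup closed under the given scalars.
\<close>

definition invertible_on :: "nat \<Rightarrow> nat \<Rightarrow> (nat \<Rightarrow> 'k::field mpoly) \<Rightarrow> nat \<Rightarrow> int \<Rightarrow>
    ('k mpoly set \<Rightarrow> 'k vec) \<Rightarrow> 'k mpoly set set \<Rightarrow> bool" where
  "invertible_on n l \<phi> \<delta> d L B \<longleftrightarrow>
     subalgebra (coord_const n l \<phi> ` UNIV) B (coord_ring n l \<phi>) \<and>
     B \<subseteq> coord_deg n l \<phi> d \<and> bij_betw L B (carrier_vec \<delta>)"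

end

theory Submission
  imports Defs
begin

text \<open>
  The kernel of \<open>N\<close> on \<open>K[X]\<^sub>d\<^sub>+\<^sub>e\<close> is contained in \<open>I\<close>, since a vector annihilated by the right kernel of
  a matrix is in its row space.  Hence \<open>N (g h) = 0\<close> forces \<open>g\<close> to vanish on \<open>V\<^sub>X(I)\<close>.  As the scheme is
  reduced, the projective Nullstellensatz shows that \<open>g\<close> is in the saturation of \<open>I\<close>, thus in \<open>I\<^sub>d\<close>.  So
  \<open>N\<^sub>h\<close> is injective on any complement \<open>B\<close> of \<open>I\<^sub>d\<close>, and bijective because \<open>dim K[X]\<^sub>d / I\<^sub>d = \<delta>\<close>.

  The map \<open>T = N\<^sub>h\<^sup>-\<^sup>1 N\<^sub>p\<close> satisfies \<open>h T(g) - p g \<in> I\<close>, so evaluation at a point \<open>z\<close> is a left eigenvector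
  of \<open>T\<close> with eigenvalue \<open>p(z) / h(z)\<close>.  The same vanishing argument over the algebraic closure makes the
  \<open>\<delta>\<close> evaluations on \<open>B\<close> linearly independent, so there are no other eigenvalues.
\<close>

text \<open>The equations live over \<open>K\<close>, the points and the reducedness over the
  closure, and \<open>scheme_ideal\<close> contains all forms over the closure that vanish on
  \<open>X\<close>, which is not by definition the extension of the ideal of \<open>X\<close> over
  \<open>K\<close>. Applying \<open>K\<close>-linear functionals to coefficients bridges the gap:
  this commutes with multiplication by polynomials over \<open>K\<close>.

  The form \<open>h\<close>, of positive degree and nonzero at every point, supplies the finiteness.
  The scheme ideal together with \<open>h\<close> has no projective zero, so modulo that ideal
  multiplication by \<open>h\<close> is eventually onto and the Hilbert function is bounded. A
  bounded Hilbert function gives algebraic relations; the Nullstellensatz gets its own from the same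
  mechanism, with a variable in place of \<open>h\<close>.

  The statement on eigenvalues concerns every \<open>B\<close> on which \<open>N_h\<close> is
  bijective, not only the complement built for existence. Such a \<open>B\<close> meets
  \<open>I\<close> trivially because \<open>N_h\<close> kills \<open>I_d\<close>. Finally,
  \<open>B\<close> has dimension \<delta> and there are \<delta> points: if one evaluation were zero
  on \<open>B\<close>, the remaining \<delta> - 1 could not separate the elements of
  \<open>B\<close>.\<close>

abbreviation keys where "keys \<equiv> Poly_Mapping.keys"
abbreviation lookup where "lookup \<equiv> Poly_Mapping.lookup"
abbreviation single where "single \<equiv> Poly_Mapping.single"
abbreviation cmap where "cmap \<equiv> Poly_Mapping.map"

section \<open>Polynomials and their evaluation\<close>

lemma lookup_map_zero: "f 0 = 0 \<Longrightarrow> lookup (cmap f p) k = f (lookup p k)"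
  by (transfer) (auto simp: when_def)

lemma poly_mapping_sum_single: "p = (\<Sum>m\<in>keys p. single m (lookup p m))"
  by (rule poly_mapping_eqI)
    (auto simp: lookup_sum lookup_single when_def sum.delta not_in_keys_iff_lookup_eq_zero)

text \<open>The \<open>single\<close> case is confined to the terms of the given \<open>p\<close>,
  so that assumptions on its support (variables, degree) stay usable in the induction.\<close>

lemma poly_mapping_sum_induct [case_names zero single add]:
  assumes "P 0" "\<And>m. m \<in> keys p \<Longrightarrow> P (single m (lookup p m))" "\<And>p q. P p \<Longrightarrow> P q \<Longrightarrow> P (p + q)"
  shows "P (p :: 'a \<Rightarrow>\<^sub>0 'b::comm_monoid_add)"
proof -
  have "P (\<Sum>m\<in>A. single m (lookup p m))" if "A \<subseteq> keys p" for A
  proof -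
    have "finite A" using that by (rule finite_subset) simp
    then show ?thesis using that
      by (induction A rule: finite_induct) (auto intro!: assms)
  qed
  from this[of "keys p"] show ?thesis using poly_mapping_sum_single[of p] by simp
qed

definition mon :: "(nat \<Rightarrow> 'b::comm_ring_1) \<Rightarrow> expo \<Rightarrow> 'b" where
  "mon v m = (\<Prod>i\<in>keys m. v i ^ lookup m i)"

lemma mon_superset: "finite A \<Longrightarrow> keys m \<subseteq> A \<Longrightarrow> mon v m = (\<Prod>i\<in>A. v i ^ lookup m i)"
  unfolding mon_def by (rule prod.mono_neutral_left) (auto simp: not_in_keys_iff_lookup_eq_zero)

lemma mon_0 [simp]: "mon v 0 = 1"
  by (simp add: mon_def)

lemma mon_add: "mon v (a + b) = mon v a * mon v b"
proof -
  let ?A = "keys a \<union> keys b"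
  have "keys (a + b) \<subseteq> ?A" by (rule keys_add)
  then show ?thesis
    by (simp add: mon_superset[of ?A] lookup_add power_add prod.distrib)
qed

lemma mon_single: "mon v (single i k) = v i ^ k"
  by (simp add: mon_superset[of "{i}"])

lemma mon_cong: "(\<And>i. i \<in> keys m \<Longrightarrow> v i = w i) \<Longrightarrow> mon v m = mon w m"
  unfolding mon_def by (rule prod.cong) auto

lemma mon_mult: "mon (\<lambda>i. v i * w i) m = mon v m * mon w m"
  by (simp add: mon_def power_mult_distrib prod.distrib)

lemma meval_superset:
  assumes "finite A" "keys p \<subseteq> A" "emb 0 = 0"
  shows "meval emb v p = (\<Sum>m\<in>A. emb (lookup p m) * mon v m)"
  unfolding meval_def mon_def[symmetric] using assms
  by (intro sum.mono_neutral_left) (auto simp: not_in_keys_iff_lookup_eq_zero)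

lemma meval_cong: "(\<And>i. i \<in> mvars p \<Longrightarrow> v i = w i) \<Longrightarrow> meval emb v p = meval emb w p"
  unfolding meval_def mon_def[symmetric]
  by (intro sum.cong refl arg_cong2[where f = "(*)"] mon_cong) (auto simp: mvars_def)

lemma expo_deg_superset: "finite A \<Longrightarrow> keys m \<subseteq> A \<Longrightarrow> expo_deg m = (\<Sum>i\<in>A. lookup m i)"
  unfolding expo_deg_def by (rule sum.mono_neutral_left) (auto simp: not_in_keys_iff_lookup_eq_zero)

lemma expo_deg_add: "expo_deg (a + b) = expo_deg a + expo_deg b"
proof -
  let ?A = "keys a \<union> keys b"
  have "keys (a + b) \<subseteq> ?A" by (rule keys_add)
  then show ?thesis
    by (simp add: expo_deg_superset[of ?A] lookup_add sum.distrib)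
qed

lemma expo_deg_0 [simp]: "expo_deg 0 = 0"
  by (simp add: expo_deg_def)

lemma expo_deg_single [simp]: "expo_deg (single i k) = k"
  by (simp add: expo_deg_superset[of "{i}"])

lemma expo_deg_eq_0: "expo_deg m = 0 \<longleftrightarrow> m = 0"
proof
  assume "expo_deg m = 0"
  then show "m = 0" by (intro poly_mapping_eqI) (auto simp: expo_deg_def in_keys_iff)
qed simp

lemma mon_const: "mon (\<lambda>_. c) m = c ^ expo_deg m"
  by (simp add: mon_def expo_deg_def power_sum)

lemma mconst_0 [simp]: "mconst 0 = 0" and mconst_1 [simp]: "mconst 1 = 1"
  and mconst_add: "mconst (a + b) = mconst a + mconst b"
  and mconst_mult: "mconst (a * b) = mconst a * mconst b"
  and mconst_minus: "mconst (- a) = - mconst a"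
  by (simp_all add: mconst_def single_add mult_single single_uminus)

lemma mconst_diff: "mconst (a - b) = mconst a - mconst b"
  by (simp add: mconst_def single_diff)

lemma lookup_mconst_mult: "lookup (mconst c * p) m = c * lookup p m"
  unfolding mconst_def mult_map_scale_conv_mult[symmetric] by (simp add: lookup_map_zero)

section \<open>Coefficient homomorphisms and substitution\<close>

interpretation mconst: comm_ring_hom mconst
  by unfold_locales (auto simp: mconst_add mconst_mult)

interpretation to_ac: comm_ring_hom to_ac
  by unfold_locales auto

interpretation id: comm_ring_hom id
  by unfold_locales auto

context comm_ring_hom
begin

lemma meval_single: "meval hom v (single m c) = hom c * mon v m"
  by (simp add: meval_superset[of "{m}"])

lemma meval_0 [simp]: "meval hom v 0 = 0"
  by (simp add: meval_def)

lemma meval_add: "meval hom v (p + q) = meval hom v p + meval hom v q"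
proof -
  let ?A = "keys p \<union> keys q"
  have "keys (p + q) \<subseteq> ?A" by (rule keys_add)
  then show ?thesis
    by (simp add: meval_superset[of ?A] lookup_add hom_add algebra_simps sum.distrib)
qed

lemma meval_mult: "meval hom v (p * q) = meval hom v p * meval hom v q"
proof (induction p rule: poly_mapping_sum_induct)
  case (single m)
  show ?case
  proof (induction q rule: poly_mapping_sum_induct)
    case single
    show ?case by (simp add: mult_single meval_single mon_add hom_mult algebra_simps)
  qed (simp_all add: meval_add algebra_simps)
qed (simp_all add: meval_add algebra_simps)

lemma meval_sum: "meval hom v (\<Sum>x\<in>A. f x) = (\<Sum>x\<in>A. meval hom v (f x))"
  by (induction A rule: infinite_finite_induct) (simp_all add: meval_add)

lemma meval_1 [simp]: "meval hom v 1 = 1"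
  using meval_single[of v 0 1] by simp

lemma meval_hom: "comm_ring_hom (meval hom v)"
  by unfold_locales (simp_all add: meval_add meval_mult)

lemma meval_mconst [simp]: "meval hom v (mconst c) = hom c"
  by (simp add: mconst_def meval_single)

lemma meval_mvar [simp]: "meval hom v (mvar i) = v i"
  by (simp add: mvar_def meval_single mon_single)

lemma meval_prod_list: "meval hom v (\<Prod>i\<leftarrow>is. f i) = (\<Prod>i\<leftarrow>is. meval hom v (f i))"
  by (induction "is") (simp_all add: meval_mult)

lemma meval_power: "meval hom v (p ^ k) = meval hom v p ^ k"
  by (induction k) (simp_all add: meval_mult)

lemma meval_scale:
  assumes "mhomog a p"
  shows "meval hom (\<lambda>i. c * v i) p = c ^ a * meval hom v p"
proof -
  have "meval hom (\<lambda>i. c * v i) p = (\<Sum>m\<in>keys p. hom (lookup p m) * (c ^ expo_deg m * mon v m))"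
    unfolding meval_def mon_def[symmetric] by (simp add: mon_mult mon_const)
  also have "\<dots> = c ^ a * (\<Sum>m\<in>keys p. hom (lookup p m) * mon v m)"
    using assms unfolding mhomog_def sum_distrib_left
    by (intro sum.cong) (auto simp: algebra_simps)
  finally show ?thesis by (simp add: meval_def mon_def)
qed

end

lemma (in comm_ring_hom) hom_meval: "hom (meval emb v p) = meval (\<lambda>c. hom (emb c)) (\<lambda>i. hom (v i)) p"
  by (simp add: meval_def hom_distribs)

subsection \<open>Variables and degrees\<close>

lemma mvars_subset_iff: "mvars p \<subseteq> V \<longleftrightarrow> (\<forall>m\<in>keys p. keys m \<subseteq> V)"
  by (auto simp: mvars_def)

lemma mvars_0 [simp]: "mvars 0 = {}" and mvars_1 [simp]: "mvars 1 = {}"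
  and mvars_mconst [simp]: "mvars (mconst c) = {}"
  by (auto simp: mvars_def mconst_def)

lemma mvars_mvar [simp]: "mvars (mvar i :: 'a::comm_ring_1 mpoly) = {i}"
  by (simp add: mvars_def mvar_def)

lemma mvars_uminus [simp]: "mvars (- p) = mvars (p :: 'a::comm_ring_1 mpoly)"
proof -
  have "keys (- p) = keys p" by (auto simp: in_keys_iff)
  then show ?thesis by (simp add: mvars_def)
qed

lemma mvars_add: "mvars p \<subseteq> V \<Longrightarrow> mvars q \<subseteq> V \<Longrightarrow> mvars (p + q) \<subseteq> V"
  using keys_add[of p q] by (auto simp: mvars_subset_iff)

lemma mvars_diff: "mvars p \<subseteq> V \<Longrightarrow> mvars q \<subseteq> V \<Longrightarrow> mvars (p - q) \<subseteq> V"
  using mvars_add[of p V "- q"] by simp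

lemma mvars_mult: "mvars p \<subseteq> V \<Longrightarrow> mvars q \<subseteq> V \<Longrightarrow> mvars (p * q) \<subseteq> V"
  unfolding mvars_subset_iff
proof
  fix m
  assume *: "\<forall>m\<in>keys p. keys m \<subseteq> V" "\<forall>m\<in>keys q. keys m \<subseteq> V" "m \<in> keys (p * q)"
  then obtain a b where "m = a + b" "a \<in> keys p" "b \<in> keys q" using keys_mult[of p q] by blast
  with * keys_add[of a b] show "keys m \<subseteq> V" by blast
qed

lemma mvars_sum: "(\<And>x. x \<in> A \<Longrightarrow> mvars (f x) \<subseteq> V) \<Longrightarrow> mvars (sum f A) \<subseteq> V"
  by (induction A rule: infinite_finite_induct) (simp_all add: mvars_add)

lemma mvars_prod_list: "(\<And>x. x \<in> set xs \<Longrightarrow> mvars (f x) \<subseteq> V) \<Longrightarrow> mvars (\<Prod>x\<leftarrow>xs. f x) \<subseteq> V"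
  by (induction xs) (simp_all add: mvars_mult)

lemma mvars_power: "mvars p \<subseteq> V \<Longrightarrow> mvars (p ^ k) \<subseteq> V"
  by (induction k) (simp_all add: mvars_mult)

lemma mhomog_0 [simp]: "mhomog a 0" and mhomog_1 [simp]: "mhomog 0 1"
  and mhomog_mconst [simp]: "mhomog 0 (mconst c)"
  by (auto simp: mhomog_def mconst_def)

lemma mhomog_mvar [simp]: "mhomog (Suc 0) (mvar i)"
  by (auto simp: mhomog_def mvar_def)

lemma mhomog_add: "mhomog a p \<Longrightarrow> mhomog a q \<Longrightarrow> mhomog a (p + q)"
  using keys_add[of p q] by (auto simp: mhomog_def)

lemma mhomog_uminus: "mhomog a p \<Longrightarrow> mhomog a (- p :: 'a::comm_ring_1 mpoly)"
  by (auto simp: mhomog_def in_keys_iff)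

lemma mhomog_diff: "mhomog a p \<Longrightarrow> mhomog a q \<Longrightarrow> mhomog a (p - q :: 'a::comm_ring_1 mpoly)"
  using mhomog_add[of a p "- q"] mhomog_uminus[of a q] by simp

lemma mhomog_mult: "mhomog a p \<Longrightarrow> mhomog b q \<Longrightarrow> mhomog (a + b) (p * q)"
  unfolding mhomog_def
proof
  fix m
  assume *: "\<forall>m\<in>keys p. expo_deg m = a" "\<forall>m\<in>keys q. expo_deg m = b" "m \<in> keys (p * q)"
  then obtain x y where "m = x + y" "x \<in> keys p" "y \<in> keys q" using keys_mult[of p q] by blast
  with * show "expo_deg m = a + b" by (simp add: expo_deg_add)
qed

lemma mhomog_sum: "(\<And>x. x \<in> A \<Longrightarrow> mhomog a (f x)) \<Longrightarrow> mhomog a (sum f A)"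
  by (induction A rule: infinite_finite_induct) (simp_all add: mhomog_add)

lemma mhomog_power: "mhomog a p \<Longrightarrow> mhomog (k * a) (p ^ k)"
  by (induction k) (simp_all add: mhomog_mult)

lemma mhomog_prod_list: "(\<And>x. x \<in> set xs \<Longrightarrow> mhomog 1 (f x)) \<Longrightarrow> mhomog (length xs) (\<Prod>x\<leftarrow>xs. f x)"
  by (induction xs) (simp_all add: mhomog_mult[of "Suc 0", simplified])

section \<open>Forms of a fixed degree\<close>

definition hpolys :: "nat \<Rightarrow> nat \<Rightarrow> 'a::comm_ring_1 mpoly set" where
  "hpolys l a = {p. mvars p \<subseteq> {0..l} \<and> mhomog a p}"

lemma hpolys_0 [simp]: "0 \<in> hpolys l a"
  by (simp add: hpolys_def)

lemma hpolys_add: "p \<in> hpolys l a \<Longrightarrow> q \<in> hpolys l a \<Longrightarrow> p + q \<in> hpolys l a"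
  by (simp add: hpolys_def mvars_add mhomog_add)

lemma hpolys_diff: "p \<in> hpolys l a \<Longrightarrow> q \<in> hpolys l a \<Longrightarrow> p - q \<in> hpolys l a"
  by (simp add: hpolys_def mvars_diff mhomog_diff)

lemma hpolys_mult: "p \<in> hpolys l a \<Longrightarrow> q \<in> hpolys l b \<Longrightarrow> p * q \<in> hpolys l (a + b)"
  by (simp add: hpolys_def mvars_mult mhomog_mult)

lemma hpolys_mconst [simp]: "mconst c \<in> hpolys l 0"
  by (simp add: hpolys_def)

lemma hpolys_1 [simp]: "1 \<in> hpolys l 0"
  by (simp add: hpolys_def)

lemma hpolys_mvar [simp]: "mvar i \<in> hpolys l (Suc 0) \<longleftrightarrow> i \<le> l"
  by (simp add: hpolys_def)

lemma hpolys_mconst_mult: "p \<in> hpolys l a \<Longrightarrow> mconst c * p \<in> hpolys l a"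
  using hpolys_mult[of "mconst c" l 0 p a] by simp

lemma hpolys_sum: "(\<And>x. x \<in> A \<Longrightarrow> f x \<in> hpolys l a) \<Longrightarrow> sum f A \<in> hpolys l a"
  by (simp add: hpolys_def mvars_sum mhomog_sum)

lemma hpolys_power: "p \<in> hpolys l a \<Longrightarrow> p ^ k \<in> hpolys l (k * a)"
  by (simp add: hpolys_def mvars_power mhomog_power)

lemma hpolys_single: "keys m \<subseteq> {0..l} \<Longrightarrow> expo_deg m = a \<Longrightarrow> single m c \<in> hpolys l a"
  by (auto simp: hpolys_def mvars_def mhomog_def)

lemma hpolys_homog: "p \<in> hpolys l a \<Longrightarrow> p \<in> homog_polys l"
  by (auto simp: hpolys_def homog_polys_def poly_ring_upto_def)

lemma homog_polysE:
  assumes "p \<in> homog_polys l"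
  obtains a where "p \<in> hpolys l a"
  using assms by (auto simp: hpolys_def homog_polys_def poly_ring_upto_def)

lemma hpolys_scale:
  "p \<in> hpolys l a \<Longrightarrow> comm_ring_hom emb \<Longrightarrow> meval emb (\<lambda>i. c * v i) p = c ^ a * meval emb v p"
  by (simp add: comm_ring_hom.meval_scale hpolys_def)

abbreviation expos :: "nat \<Rightarrow> nat \<Rightarrow> expo set" where
  "expos l a \<equiv> {m. keys m \<subseteq> {0..l} \<and> expo_deg m = a}"

text \<open>An exponent vector is determined by its entries with index at most \<open>l\<close>, and
  each of them is bounded by the total degree.\<close>

lemma finite_expos: "finite (expos l a)"
proof -
  let ?f = "\<lambda>m i. if i \<in> {0..l} then lookup m i else 0"
  have "inj_on ?f (expos l a)"
  proof (rule inj_onI, rule poly_mapping_eqI)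
    fix m m' :: expo and i
    assume *: "m \<in> expos l a" "m' \<in> expos l a"
      "?f m = ?f m'"
    show "lookup m i = lookup m' i"
    proof (cases "i \<in> {0..l}")
      case True
      then show ?thesis using fun_cong[OF *(3), of i] by simp
    next
      case False
      then have "i \<notin> keys m" "i \<notin> keys m'" using *(1,2) by blast+
      then show ?thesis by (simp add: in_keys_iff)
    qed
  qed
  moreover have "?f ` (expos l a) \<subseteq>
      {f. \<forall>i. (i \<in> {0..l} \<longrightarrow> f i \<in> {0..a}) \<and> (i \<notin> {0..l} \<longrightarrow> f i = 0)}"
  proof (rule image_subsetI, clarsimp)
    fix m :: expo and i
    assume "keys m \<subseteq> {0..l}" and i: "i \<le> l"
    then have "expo_deg m = (\<Sum>i\<in>{0..l}. lookup m i)" by (simp add: expo_deg_superset)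
    with i show "lookup m i \<le> expo_deg m" by (auto intro: member_le_sum)
  qed
  moreover have "finite {f. \<forall>i. (i \<in> {0..l} \<longrightarrow> f i \<in> {0..a}) \<and> (i \<notin> {0..l} \<longrightarrow> f i = 0)}"
    by (rule finite_set_of_finite_funs) auto
  ultimately show ?thesis by (rule inj_on_finite)
qed

section \<open>Linear algebra\<close>

text \<open>Serves two counting arguments: more forms than the dimension of a quotient are
  dependent, and fewer points than coefficients leave a nonzero combination that vanishes at all of
  them.\<close>

lemma exists_kernel_vector:
  fixes A :: "nat \<Rightarrow> nat \<Rightarrow> 'a::field"
  shows "\<exists>c. (\<exists>j\<le>D. c j \<noteq> 0) \<and> (\<forall>i<D. (\<Sum>j\<le>D. A i j * c j) = 0)"
proof -
  \<comment> \<open>A zero row makes the system of \<open>D\<close> equations in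
    \<open>D + 1\<close> unknowns square, with determinant zero.\<close>
  define M where "M = mat\<^sub>r (Suc D) (Suc D) (\<lambda>i. if i = D then 0\<^sub>v (Suc D) else vec (Suc D) (A i))"
  have M: "M \<in> carrier_mat (Suc D) (Suc D)" by (simp add: M_def)
  have "det M = 0" unfolding M_def by (rule det_row_0) auto
  then obtain v where v: "v \<in> carrier_vec (Suc D)" "v \<noteq> 0\<^sub>v (Suc D)" "M *\<^sub>v v = 0\<^sub>v (Suc D)"
    using det_0_iff_vec_prod_zero_field[OF M] by blast
  have "\<exists>j\<le>D. v $ j \<noteq> 0"
  proof (rule ccontr)
    assume "\<not> ?thesis"
    then have "v = 0\<^sub>v (Suc D)" using v(1) by (intro eq_vecI) auto
    with v(2) show False by simp
  qed
  moreover have "(\<Sum>j\<le>D. A i j * v $ j) = 0" if "i < D" for i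
  proof -
    have "0 = (M *\<^sub>v v) $ i" using v(3) that by simp
    also have "\<dots> = (\<Sum>j\<in>{0..<Suc D}. A i j * v $ j)"
      using that v(1) by (simp add: M_def scalar_prod_def)
    finally show ?thesis by (simp add: atLeast0LessThan lessThan_Suc_atMost)
  qed
  ultimately show ?thesis by blast
qed

text \<open>Stated without finiteness, since one application is to the algebraic closure as a vector
  space over \<open>K\<close>; the other is to the row space of a matrix.\<close>

lemma (in vector_space) separating_functional:
  assumes "c \<notin> span S"
  obtains f where "Vector_Spaces.linear scale (*) f" "\<And>x. x \<in> S \<Longrightarrow> f x = 0" "f c = 1"
proof -
  interpret dual: vector_space "(*) :: 'a \<Rightarrow> 'a \<Rightarrow> 'a"
    by unfold_locales (auto simp: algebra_simps)
  interpret vector_space_pair scale "(*) :: 'a \<Rightarrow> 'a \<Rightarrow> 'a" ..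
  obtain B where B: "B \<subseteq> S" "independent B" "S \<subseteq> span B"
    by (rule maximal_independent_subset)
  have "c \<notin> span B" using B(1) assms span_mono by blast
  with B(2) have "independent (insert c B)" by (simp add: independent_insert)
  from linear_independent_extend[OF this, of "\<lambda>x. if x = c then 1 else 0"]
  obtain f where f: "Vector_Spaces.linear scale (*) f" "\<forall>x\<in>insert c B. f x = (if x = c then 1 else 0)"
    by blast
  interpret f: Vector_Spaces.linear scale "(*)" f by (rule f(1))
  have "f x = 0" if "x \<in> B" for x using f(2) that \<open>c \<notin> span B\<close> span_base[of x B] by auto
  then have "f x = 0" if "x \<in> S" for x
    using f.eq_0_on_span[of B x] B(3) that by blast
  with f show ?thesis by (intro that[of f]) auto
qed

section \<open>Graded ideals and the projective Nullstellensatz\<close>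

text \<open>A homogeneous ideal encoded by its graded pieces, so that the arguments below deal with
  forms only and need no decomposition into components.\<close>

definition gideal :: "nat \<Rightarrow> (nat \<Rightarrow> 'a::comm_ring_1 mpoly set) \<Rightarrow> bool" where
  "gideal l P \<longleftrightarrow> (\<forall>a. P a \<subseteq> hpolys l a) \<and> (\<forall>a. 0 \<in> P a) \<and>
     (\<forall>a. \<forall>p\<in>P a. \<forall>q\<in>P a. p + q \<in> P a) \<and>
     (\<forall>a b. \<forall>w\<in>hpolys l b. \<forall>p\<in>P a. w * p \<in> P (b + a))"

text \<open>For \<open>a < e\<close> the truncated difference \<open>a - e\<close> would admit constant cofactors, so \<open>w = 0\<close> is forced.\<close>

definition gplus :: "nat \<Rightarrow> (nat \<Rightarrow> 'a::comm_ring_1 mpoly set) \<Rightarrow> nat \<Rightarrow> 'a mpoly \<Rightarrow> nat \<Rightarrow> 'a mpoly set" where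
  "gplus l P e f a = {q + w * f | q w. q \<in> P a \<and> w \<in> hpolys l (a - e) \<and> (a < e \<longrightarrow> w = 0)}"

text \<open>Its negation says that the ideal contains some power of the irrelevant ideal generated
  by the variables.\<close>

definition relevant :: "nat \<Rightarrow> (nat \<Rightarrow> 'a::comm_ring_1 mpoly set) \<Rightarrow> bool" where
  "relevant l P \<longleftrightarrow> (\<forall>m. \<not> hpolys l m \<subseteq> P m)"

lemma
  assumes "gideal l P"
  shows gideal_hpolys: "p \<in> P a \<Longrightarrow> p \<in> hpolys l a"
    and gideal_0: "0 \<in> P a"
    and gideal_add: "p \<in> P a \<Longrightarrow> q \<in> P a \<Longrightarrow> p + q \<in> P a"
    and gideal_mult: "w \<in> hpolys l b \<Longrightarrow> p \<in> P a \<Longrightarrow> w * p \<in> P (b + a)"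
  using assms by (auto simp: gideal_def)

lemma gideal_mconst: "gideal l P \<Longrightarrow> p \<in> P a \<Longrightarrow> mconst c * p \<in> P a"
  using gideal_mult[of l P "mconst c" 0 p a] by simp

lemma gideal_diff:
  assumes "gideal l P" "p \<in> P a" "q \<in> P a"
  shows "p - q \<in> P a"
proof -
  have "p + mconst (- 1) * q \<in> P a" using assms by (intro gideal_add gideal_mconst)
  then show ?thesis by (simp add: mconst_minus)
qed

lemma gideal_sum: "gideal l P \<Longrightarrow> (\<And>x. x \<in> A \<Longrightarrow> f x \<in> P a) \<Longrightarrow> sum f A \<in> P a"
  by (induction A rule: infinite_finite_induct) (auto intro: gideal_0 gideal_add)

lemma gideal_gplus:
  assumes P: "gideal l P" and f: "f \<in> hpolys l e"
  shows "gideal l (gplus l P e f)"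
  unfolding gideal_def
proof (intro conjI allI ballI)
  show "gplus l P e f a \<subseteq> hpolys l a" for a
  proof
    fix p assume "p \<in> gplus l P e f a"
    then obtain q w where p: "p = q + w * f" "q \<in> P a" "w \<in> hpolys l (a - e)" "a < e \<longrightarrow> w = 0"
      by (auto simp: gplus_def)
    have "w * f \<in> hpolys l a"
      using p(4) hpolys_mult[OF p(3) f] by (cases "a < e") auto
    then show "p \<in> hpolys l a" using p gideal_hpolys[OF P p(2)] by (simp add: hpolys_add)
  qed
  show "0 \<in> gplus l P e f a" for a
    unfolding gplus_def using gideal_0[OF P, of a] by (auto intro!: exI[of _ 0])
  show "p + q \<in> gplus l P e f a" if "p \<in> gplus l P e f a" "q \<in> gplus l P e f a" for a p q
  proof -
    from that obtain p1 w1 q1 w2 where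
      "p = p1 + w1 * f" "p1 \<in> P a" "w1 \<in> hpolys l (a - e)" "a < e \<longrightarrow> w1 = 0"
      "q = q1 + w2 * f" "q1 \<in> P a" "w2 \<in> hpolys l (a - e)" "a < e \<longrightarrow> w2 = 0"
      by (auto simp: gplus_def)
    then show ?thesis unfolding gplus_def
      by (intro CollectI exI[of _ "p1 + q1"] exI[of _ "w1 + w2"])
        (auto simp: algebra_simps intro: gideal_add[OF P] hpolys_add)
  qed
  show "v * p \<in> gplus l P e f (b + a)" if v: "v \<in> hpolys l b" and "p \<in> gplus l P e f a" for a b v p
  proof -
    from that obtain q w where p: "p = q + w * f" "q \<in> P a" "w \<in> hpolys l (a - e)" "a < e \<longrightarrow> w = 0"
      by (auto simp: gplus_def)
    have "v * w \<in> hpolys l (b + a - e) \<and> (b + a < e \<longrightarrow> v * w = 0)"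
      using hpolys_mult[OF v p(3)] p(4) by (cases "a < e") auto
    then show ?thesis unfolding gplus_def using p gideal_mult[OF P v p(2)]
      by (intro CollectI exI[of _ "v * q"] exI[of _ "v * w"]) (auto simp: algebra_simps)
  qed
qed

lemma gplus_mono: "p \<in> P a \<Longrightarrow> p \<in> gplus l P e f a"
  unfolding gplus_def by (intro CollectI exI[of _ p] exI[of _ 0]) auto

lemma gplus_gen: "gideal l P \<Longrightarrow> f \<in> gplus l P e f e"
  unfolding gplus_def using gideal_0[of l P e] by (intro CollectI exI[of _ 0] exI[of _ 1]) auto

section \<open>Factoring monomials, and graded pieces that contain all monomials\<close>

lemma expo_split_single:
  fixes m :: expo
  assumes "keys m \<subseteq> V" "expo_deg m = Suc a"
  obtains i m' where "i \<in> V" "m = single i 1 + m'" "keys m' \<subseteq> V" "expo_deg m' = a"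
proof -
  have "m \<noteq> 0" using assms(2) by auto
  then obtain i where i: "i \<in> keys m" by fastforce
  define m' where "m' = m - single i 1"
  have m: "m = single i 1 + m'"
    using i by (intro poly_mapping_eqI) (auto simp: m'_def lookup_add lookup_minus lookup_single when_def in_keys_iff)
  have "keys m' \<subseteq> keys m" by (auto simp: m'_def in_keys_iff lookup_minus)
  moreover have "expo_deg m' = a" using assms(2) m by (simp add: expo_deg_add)
  ultimately show ?thesis using that[of i m'] i assms(1) m by blast
qed

lemma expo_split:
  fixes m :: expo
  assumes "keys m \<subseteq> V" "expo_deg m = a + b"
  obtains m1 m2 where "m = m1 + m2" "keys m1 \<subseteq> V" "expo_deg m1 = a" "keys m2 \<subseteq> V" "expo_deg m2 = b"
proof -
  have "\<exists>m1 m2. m = m1 + m2 \<and> keys m1 \<subseteq> V \<and> expo_deg m1 = a \<and> keys m2 \<subseteq> V \<and> expo_deg m2 = b"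
    using assms
  proof (induction a arbitrary: m)
    case 0
    then show ?case by (intro exI[of _ 0] exI[of _ m]) auto
  next
    case (Suc a)
    from Suc.prems obtain i m' where m': "i \<in> V" "m = single i 1 + m'" "keys m' \<subseteq> V" "expo_deg m' = a + b"
      by (auto elim: expo_split_single)
    from Suc.IH[OF m'(3,4)] obtain m1 m2 where
      "m' = m1 + m2" "keys m1 \<subseteq> V" "expo_deg m1 = a" "keys m2 \<subseteq> V" "expo_deg m2 = b" by blast
    then show ?case using m' keys_add[of "single i 1" m1]
      by (intro exI[of _ "single i 1 + m1"] exI[of _ m2]) (auto simp: expo_deg_add add.assoc split: if_splits)
  qed
  then show ?thesis using that by blast
qed

lemma single_eq_mconst: "single m c = mconst c * single m (1 :: 'a::comm_ring_1)"
  by (simp add: mconst_def mult_single)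

lemma hpolys_sum_monomials:
  assumes "p \<in> hpolys l a"
  shows "p = (\<Sum>m\<in>expos l a. mconst (lookup p m) * single m 1)"
proof -
  have "p = (\<Sum>m\<in>keys p. single m (lookup p m))" by (rule poly_mapping_sum_single)
  also have "\<dots> = (\<Sum>m\<in>expos l a. single m (lookup p m))"
    using assms by (intro sum.mono_neutral_left finite_expos)
      (auto simp: hpolys_def mvars_subset_iff mhomog_def in_keys_iff)
  finally show ?thesis by (simp add: single_eq_mconst[symmetric])
qed

lemma hpolys_subset_if_monomials:
  fixes P :: "nat \<Rightarrow> 'a::comm_ring_1 mpoly set"
  assumes "gideal l P" "\<And>m. keys m \<subseteq> {0..l} \<Longrightarrow> expo_deg m = a \<Longrightarrow> single m 1 \<in> P a"
  shows "hpolys l a \<subseteq> P a"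
proof
  fix p :: "'a mpoly" assume "p \<in> hpolys l a"
  then have p: "p = (\<Sum>m\<in>expos l a. mconst (lookup p m) * single m 1)"
    by (rule hpolys_sum_monomials)
  have "(\<Sum>m\<in>expos l a. mconst (lookup p m) * single m 1) \<in> P a"
    using assms(2) by (intro gideal_sum[OF assms(1)] gideal_mconst[OF assms(1)]) auto
  also note p[symmetric]
  finally show "p \<in> P a" .
qed

text \<open>Every monomial of the next degree is a variable times a monomial of the present
  degree.\<close>

lemma gideal_full_mono:
  fixes P :: "nat \<Rightarrow> 'a::comm_ring_1 mpoly set"
  assumes P: "gideal l P" and "hpolys l m \<subseteq> P m" "m \<le> a"
  shows "hpolys l a \<subseteq> P a"
  using assms(3,2)
proof (induction rule: dec_induct)
  case (step a)
  show ?case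
  proof (rule hpolys_subset_if_monomials[OF P])
    fix n :: expo assume "keys n \<subseteq> {0..l}" "expo_deg n = Suc a"
    then obtain i n' where n: "i \<in> {0..l}" "n = single i 1 + n'" "keys n' \<subseteq> {0..l}" "expo_deg n' = a"
      by (rule expo_split_single)
    have "single n' 1 \<in> P a" using step hpolys_single[OF n(3,4)] by blast
    moreover have "mvar i \<in> hpolys l (Suc 0)" using n(1) by simp
    ultimately have "mvar i * single n' 1 \<in> P (Suc a)"
      using gideal_mult[OF P, of "mvar i" "Suc 0"] by simp
    then show "single n 1 \<in> P (Suc a)" by (simp add: n(2) mvar_def mult_single)
  qed
qed

section \<open>Bounded Hilbert functions\<close>

abbreviation spanned :: "nat \<Rightarrow> (nat \<Rightarrow> 'a::comm_ring_1 mpoly set) \<Rightarrow> nat \<Rightarrow> nat \<Rightarrow> bool" where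
  "spanned l P D a \<equiv> \<exists>g. \<forall>p\<in>hpolys l a. \<exists>c. p - (\<Sum>i<D. mconst (c i) * g i) \<in> P a"

text \<open>\<open>spanned\<close> bounds the Hilbert function of the quotient by \<open>P\<close>
  in one degree. Once \<open>P + (f)\<close> contains all forms, multiplication by \<open>f\<close>
  maps the forms of degree \<open>a - e\<close> onto those of degree \<open>a\<close> modulo
  \<open>P\<close>, so the Hilbert function can only be repeated or drop from there on;
  \<open>D\<close> is the maximum over the initial degrees.\<close>

lemma gideal_bounded:
  fixes P :: "nat \<Rightarrow> 'a::field mpoly set"
  assumes P: "gideal l P" and f: "f \<in> hpolys l e" and e: "e > 0"
    and full: "hpolys l m \<subseteq> gplus l P e f m"
  obtains D :: nat where "\<forall>a. spanned l P D a"
proof -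
  define E where "E a = expos l a" for a
  define D where "D = Max ((\<lambda>a. card (E a)) ` {..m + e})"
  have main: "spanned l P D a" for a
  proof (induction a rule: less_induct)
    case (less a)
    show ?case
    proof (cases "a \<le> m + e")
      case True
      then have card: "card (E a) \<le> D" unfolding D_def by (intro Max_ge) auto
      have fin: "finite (E a)" unfolding E_def by (rule finite_expos)
      obtain b where b: "bij_betw b {..<card (E a)} (E a)"
        using ex_bij_betw_nat_finite[OF fin] by (auto simp: atLeast0LessThan)
      \<comment> \<open>The monomials of degree \<open>a\<close>, padded with zeros to the common
        number \<open>D\<close>.\<close>
      define g :: "nat \<Rightarrow> 'a mpoly" where "g i = (if i < card (E a) then single (b i) 1 else 0)" for i
      have "\<exists>c. p - (\<Sum>i<D. mconst (c i) * g i) \<in> P a" if "p \<in> hpolys l a" for p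
      proof
        have "(\<Sum>i<D. mconst (lookup p (b i)) * g i) =
            (\<Sum>i<card (E a). mconst (lookup p (b i)) * single (b i) 1)"
          using card by (intro sum.mono_neutral_cong_right) (auto simp: g_def)
        also have "\<dots> = (\<Sum>m\<in>E a. mconst (lookup p m) * single m 1)"
          by (rule sum.reindex_bij_betw[OF b])
        also have "\<dots> = p" using hpolys_sum_monomials[OF that] by (simp add: E_def)
        finally show "p - (\<Sum>i<D. mconst (lookup p (b i)) * g i) \<in> P a"
          using gideal_0[OF P] by simp
      qed
      then show ?thesis by blast
    next
      case False
      then have a: "m \<le> a" "e \<le> a" "a - e < a" using e by auto
      obtain g where g: "\<forall>p\<in>hpolys l (a - e). \<exists>c. p - (\<Sum>i<D. mconst (c i) * g i) \<in> P (a - e)"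
        using less a(3) by blast
      have "\<exists>c. p - (\<Sum>i<D. mconst (c i) * (g i * f)) \<in> P a" if "p \<in> hpolys l a" for p
      proof -
        have "p \<in> gplus l P e f a"
          using gideal_full_mono[OF gideal_gplus[OF P f] full a(1)] that by blast
        then obtain q w where p: "p = q + w * f" "q \<in> P a" "w \<in> hpolys l (a - e)"
          by (auto simp: gplus_def)
        then obtain c where c: "w - (\<Sum>i<D. mconst (c i) * g i) \<in> P (a - e)" using g by blast
        \<comment> \<open>The multiples \<open>g i * f\<close> span in degree \<open>a\<close>,
          because the cofactor \<open>w\<close> is spanned by the \<open>g i\<close> in degree
          \<open>a - e\<close>.\<close>
        have "q + f * (w - (\<Sum>i<D. mconst (c i) * g i)) \<in> P a"
          using gideal_add[OF P p(2)] gideal_mult[OF P f c] a(2) by simp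
        then show ?thesis
          by (intro exI[of _ c]) (simp add: p(1) algebra_simps sum_distrib_left)
      qed
      then show ?thesis by (intro exI[of _ "\<lambda>i. g i * f"]) blast
    qed
  qed
  show ?thesis using main by (intro that) blast
qed

lemma gideal_dependence:
  fixes P :: "nat \<Rightarrow> 'a::field mpoly set" and D :: nat
  assumes P: "gideal l P" and g: "\<forall>p\<in>hpolys l a. \<exists>c. p - (\<Sum>i<D. mconst (c i) * g i) \<in> P a"
    and u: "\<And>j. j \<le> D \<Longrightarrow> u j \<in> hpolys l a"
  obtains c where "\<exists>j\<le>D. c j \<noteq> 0" "(\<Sum>j\<le>D. mconst (c j) * u j) \<in> P a"
proof -
  have "\<forall>j. \<exists>c. j \<le> D \<longrightarrow> u j - (\<Sum>i<D. mconst (c i) * g i) \<in> P a" using g u by blast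
  then obtain A where A: "\<forall>j. j \<le> D \<longrightarrow> u j - (\<Sum>i<D. mconst (A j i) * g i) \<in> P a"
    using choice[of "\<lambda>j (c :: nat \<Rightarrow> 'a). j \<le> D \<longrightarrow> u j - (\<Sum>i<D. mconst (c i) * g i) \<in> P a"] by blast
  obtain c where c: "\<exists>j\<le>D. c j \<noteq> 0" "\<forall>i<D. (\<Sum>j\<le>D. A j i * c j) = 0"
    using exists_kernel_vector[of D "\<lambda>i j. A j i"] by auto
  have "(\<Sum>j\<le>D. mconst (c j) * (\<Sum>i<D. mconst (A j i) * g i)) =
      (\<Sum>i<D. mconst (\<Sum>j\<le>D. A j i * c j) * g i)"
    unfolding sum_distrib_left mconst.hom_sum sum_distrib_right
    by (subst sum.swap) (simp add: mconst_mult algebra_simps)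
  also have "\<dots> = 0" using c(2) by simp
  finally have "(\<Sum>j\<le>D. mconst (c j) * u j) =
      (\<Sum>j\<le>D. mconst (c j) * (u j - (\<Sum>i<D. mconst (A j i) * g i)))"
    by (simp add: right_diff_distrib sum_subtractf)
  also have "\<dots> \<in> P a" using A by (intro gideal_sum[OF P] gideal_mconst[OF P]) simp
  finally show ?thesis using that c(1) by blast
qed

section \<open>Maximal relevant ideals and their primeness\<close>

lemma exists_maximal_relevant:
  fixes P :: "nat \<Rightarrow> 'a::comm_ring_1 mpoly set"
  assumes "gideal l P" "relevant l P"
  obtains Q where "gideal l Q" "relevant l Q" "\<And>a. P a \<subseteq> Q a"
    "\<And>Q'. gideal l Q' \<Longrightarrow> relevant l Q' \<Longrightarrow> (\<And>a. Q a \<subseteq> Q' a) \<Longrightarrow> Q' = Q"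
proof -
  \<comment> \<open>Families are coded as sets of pairs of a degree and a form, which turns the
    pointwise order into inclusion, as Zorn's lemma wants it.\<close>
  define fam where "fam T a = {p. (a, p) \<in> T}" for T :: "(nat \<times> 'a mpoly) set" and a
  define \<A> where "\<A> = {T. gideal l (fam T) \<and> relevant l (fam T) \<and> (\<forall>a. P a \<subseteq> fam T a)}"
  have fam_Sigma: "fam (Sigma UNIV Q) = Q" for Q by (auto simp: fam_def)
  have "Sigma UNIV P \<in> \<A>" using assms by (simp add: \<A>_def fam_Sigma)
  moreover have "\<Union>\<C> \<in> \<A>" if ne: "\<C> \<noteq> {}" and ch: "subset.chain \<A> \<C>" for \<C>
  proof -
    have sub: "\<C> \<subseteq> \<A>" using ch by (auto simp: subset_chain_def)
    then have gid: "gideal l (fam T)" if "T \<in> \<C>" for T using that by (auto simp: \<A>_def)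
    have gideal: "gideal l (fam (\<Union>\<C>))"
      unfolding gideal_def
    proof (intro conjI allI ballI)
      show "fam (\<Union>\<C>) a \<subseteq> hpolys l a" for a using gideal_hpolys[OF gid] by (auto simp: fam_def)
      show "0 \<in> fam (\<Union>\<C>) a" for a using gideal_0[OF gid] ne by (auto simp: fam_def)
      show "p + q \<in> fam (\<Union>\<C>) a" if "p \<in> fam (\<Union>\<C>) a" "q \<in> fam (\<Union>\<C>) a" for a p q
      proof -
        have "finite {(a, p), (a, q)}" "{(a, p), (a, q)} \<subseteq> \<Union>\<C>" using that by (auto simp: fam_def)
        then obtain T where T: "T \<in> \<C>" "{(a, p), (a, q)} \<subseteq> T"
          by (rule finite_subset_Union_chain[OF _ _ ne ch])
        then have "p + q \<in> fam T a" by (intro gideal_add[OF gid]) (auto simp: fam_def)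
        with T(1) show ?thesis by (auto simp: fam_def)
      qed
      show "w * p \<in> fam (\<Union>\<C>) (b + a)" if "w \<in> hpolys l b" "p \<in> fam (\<Union>\<C>) a" for a b w p
        using that gideal_mult[OF gid] by (auto simp: fam_def) blast
    qed
    have "\<not> hpolys l m \<subseteq> fam (\<Union>\<C>) m" for m
    proof
      assume full: "hpolys l m \<subseteq> fam (\<Union>\<C>) m"
      \<comment> \<open>Relevance survives the union because a degree has finitely many monomials:
        if the union contained all of them, one member of the chain would already.\<close>
      let ?E = "(\<lambda>n. (m, single n (1 :: 'a))) ` {n. keys n \<subseteq> {0..l} \<and> expo_deg n = m}"
      have "?E \<subseteq> \<Union>\<C>"
      proof (rule image_subsetI)
        fix n :: expo assume "n \<in> {n. keys n \<subseteq> {0..l} \<and> expo_deg n = m}"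
        then have "single n (1 :: 'a) \<in> hpolys l m" by (intro hpolys_single) auto
        with full show "(m, single n (1 :: 'a)) \<in> \<Union>\<C>" unfolding fam_def by blast
      qed
      then obtain T where T: "T \<in> \<C>" "?E \<subseteq> T"
        by (rule finite_subset_Union_chain[OF finite_imageI[OF finite_expos] _ ne ch])
      have "hpolys l m \<subseteq> fam T m"
        by (rule hpolys_subset_if_monomials[OF gid[OF T(1)]]) (use T(2) in \<open>unfold fam_def, blast\<close>)
      with T(1) sub show False by (auto simp: \<A>_def relevant_def)
    qed
    moreover have "P a \<subseteq> fam (\<Union>\<C>) a" for a using ne sub by (force simp: \<A>_def fam_def)
    ultimately show ?thesis using gideal by (simp add: \<A>_def relevant_def)
  qed
  ultimately obtain T where T: "T \<in> \<A>" "\<And>Y. Y \<in> \<A> \<Longrightarrow> T \<subseteq> Y \<Longrightarrow> Y = T"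
    using subset_Zorn_nonempty[of \<A>] by (metis empty_iff)
  show ?thesis
  proof (rule that[of "fam T"])
    fix Q' assume Q': "gideal l Q'" "relevant l Q'" "\<And>a. fam T a \<subseteq> Q' a"
    have "P a \<subseteq> Q' a" for a using T(1) Q'(3)[of a] by (auto simp: \<A>_def)
    with Q' have "Sigma UNIV Q' \<in> \<A>" by (simp add: \<A>_def fam_Sigma)
    moreover have "T \<subseteq> Sigma UNIV Q'" using Q'(3) by (auto simp: fam_def)
    ultimately have "Sigma UNIV Q' = T" by (rule T(2))
    then show "Q' = fam T" by (metis fam_Sigma)
  qed (use T(1) in \<open>auto simp: \<A>_def\<close>)
qed

locale maximal_relevant =
  fixes l :: nat and P :: "nat \<Rightarrow> 'a::field mpoly set"
  assumes P: "gideal l P" and rel: "relevant l P"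
    and max: "\<And>Q. gideal l Q \<Longrightarrow> relevant l Q \<Longrightarrow> (\<And>a. P a \<subseteq> Q a) \<Longrightarrow> Q = P"
begin

lemma gplus_irrelevant:
  assumes f: "f \<in> hpolys l e" "f \<notin> P e"
  obtains m where "hpolys l m \<subseteq> gplus l P e f m"
proof -
  have "gplus l P e f \<noteq> P" using gplus_gen[OF P, of f e] f(2) by auto
  then have "\<not> relevant l (gplus l P e f)"
    using max[OF gideal_gplus[OF P f(1)]] gplus_mono[of _ P] by blast
  then show ?thesis using that by (auto simp: relevant_def)
qed

text \<open>By maximality, adjoining \<open>f\<close> or \<open>g\<close> to \<open>P\<close> makes
  it contain all forms of degree \<open>m\<close> or \<open>m'\<close>. The product of the two
  enlarged ideals lies in \<open>P + (f * g)\<close>, that is in \<open>P\<close>, which would then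
  contain all forms of degree \<open>m + m'\<close>.\<close>

lemma prime:
  assumes f: "f \<in> hpolys l a" and g: "g \<in> hpolys l b" and fg: "f * g \<in> P (a + b)"
  shows "f \<in> P a \<or> g \<in> P b"
proof (rule ccontr)
  assume "\<not> ?thesis"
  then obtain m m' where m: "hpolys l m \<subseteq> gplus l P a f m" and m': "hpolys l m' \<subseteq> gplus l P b g m'"
    using gplus_irrelevant f g by metis
  have "hpolys l (m + m') \<subseteq> P (m + m')"
  proof (rule hpolys_subset_if_monomials[OF P])
    fix n :: expo assume "keys n \<subseteq> {0..l}" "expo_deg n = m + m'"
    then obtain n1 n2 where n: "n = n1 + n2" "keys n1 \<subseteq> {0..l}" "expo_deg n1 = m"
      "keys n2 \<subseteq> {0..l}" "expo_deg n2 = m'" by (rule expo_split)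
    define u v where "u = single n1 (1::'a)" and "v = single n2 (1::'a)"
    have u: "u \<in> hpolys l m" and v: "v \<in> hpolys l m'" unfolding u_def v_def using n by (auto intro: hpolys_single)
    obtain q w where q: "u = q + w * f" "q \<in> P m" "w \<in> hpolys l (m - a)" "m < a \<longrightarrow> w = 0"
      using subsetD[OF m u] by (auto simp: gplus_def)
    obtain q' w' where q': "v = q' + w' * g" "q' \<in> P m'" "w' \<in> hpolys l (m' - b)" "m' < b \<longrightarrow> w' = 0"
      using subsetD[OF m' v] by (auto simp: gplus_def)
    \<comment> \<open>Read as \<open>u - q\<close>, the product is a form of degree \<open>m\<close>
      without a case distinction between \<open>m < a\<close> and its opposite.\<close>
    have "w * f = u - q" using q by simp
    then have wf: "w * f \<in> hpolys l m" using u gideal_hpolys[OF P q(2)] hpolys_diff by metis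
    have "(w * w') * (f * g) \<in> P (m + m')"
    proof (cases "m < a \<or> m' < b")
      case True
      then show ?thesis using q(4) q'(4) gideal_0[OF P] by auto
    next
      case False
      then have "(m - a) + (m' - b) + (a + b) = m + m'" by auto
      then show ?thesis using gideal_mult[OF P hpolys_mult[OF q(3) q'(3)] fg] by simp
    qed
    moreover have "v * q \<in> P (m + m')" using gideal_mult[OF P v q(2)] by (simp add: add.commute)
    moreover have "(w * f) * q' \<in> P (m + m')" by (rule gideal_mult[OF P wf q'(2)])
    ultimately have "v * q + (w * f) * q' + (w * w') * (f * g) \<in> P (m + m')" by (intro gideal_add[OF P])
    moreover have "single n 1 = u * v" using n(1) by (simp add: u_def v_def mult_single)
    moreover have "u * v = v * q + (w * f) * q' + (w * w') * (f * g)"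
    proof -
      have "u * v = q * v + w * f * (q' + w' * g)" using q(1) q'(1) by (simp add: algebra_simps)
      then show ?thesis by (simp add: algebra_simps)
    qed
    ultimately show "single n 1 \<in> P (m + m')" by simp
  qed
  with rel show False by (simp add: relevant_def)
qed

text \<open>The sum is the homogenisation of \<open>q\<close> in degree \<open>D\<close>. If
  \<open>q\<close> has smaller degree, the factor \<open>V\<close>, which is not in
  \<open>P\<close>, splits off; otherwise a root \<open>r\<close> of \<open>q\<close> splits off
  \<open>U - r V\<close>. By primeness either that linear factor is in \<open>P\<close> or the
  induction continues with a form of degree one less. In degree 0 a nonzero constant would lie in
  \<open>P\<close>, against relevance.\<close>

lemma binary_form_linear_factor:
  assumes U: "U \<in> hpolys l 1" and V: "V \<in> hpolys l 1" "V \<notin> P 1"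
    and "q \<noteq> 0" "Polynomial.degree q \<le> D"
    and "(\<Sum>j\<le>D. mconst (Polynomial.coeff q j) * U ^ j * V ^ (D - j)) \<in> P D"
    and ac: "\<And>q :: 'a poly. Polynomial.degree q > 0 \<Longrightarrow> \<exists>x. poly q x = 0"
  shows "\<exists>r. U - mconst r * V \<in> P 1"
  using assms(4-6)
proof (induction D arbitrary: q)
  case 0
  then have c: "Polynomial.coeff q 0 \<noteq> 0" "mconst (Polynomial.coeff q 0) \<in> P 0"
    by (auto simp: leading_coeff_0_iff[symmetric] simp del: leading_coeff_0_iff)
  from gideal_mconst[OF P c(2), of "inverse (Polynomial.coeff q 0)"] c(1)
  have "1 \<in> P 0" by (simp add: mconst_mult[symmetric])
  then have "p \<in> P 0" if "p \<in> hpolys l 0" for p using gideal_mult[OF P that, of 1 0] by simp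
  with rel show ?case by (auto simp: relevant_def)
next
  case (Suc D)
  define H where "H D q = (\<Sum>j\<le>D. mconst (Polynomial.coeff q j) * U ^ j * V ^ (D - j))" for D q
  have H_hpolys: "H D q \<in> hpolys l D" for D q
    unfolding H_def
  proof (rule hpolys_sum)
    fix j assume "j \<in> {..D}"
    then have "j * 1 + (D - j) * 1 = D" by simp
    with hpolys_mult[OF hpolys_power[OF U, of j] hpolys_power[OF V(1), of "D - j"]]
    have "U ^ j * V ^ (D - j) \<in> hpolys l D" by metis
    then show "mconst (Polynomial.coeff q j) * U ^ j * V ^ (D - j) \<in> hpolys l D"
      by (simp add: mult.assoc hpolys_mconst_mult)
  qed
  have H_Suc: "H (Suc D) q = V * H D q" if "Polynomial.degree q \<le> D" for q
  proof -
    have "Polynomial.coeff q (Suc D) = 0" using that by (intro coeff_eq_0) auto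
    then have "H (Suc D) q = (\<Sum>j\<le>D. mconst (Polynomial.coeff q j) * U ^ j * V ^ (Suc D - j))"
      by (simp add: H_def)
    also have "\<dots> = V * H D q" unfolding H_def sum_distrib_left
      by (rule sum.cong) (auto simp: Suc_diff_le algebra_simps)
    finally show ?thesis .
  qed
  show ?case
  proof (cases "Polynomial.degree q \<le> D")
    case True
    have "V * H D q \<in> P (1 + D)" using Suc.prems(3) H_Suc[OF True] by (simp add: H_def)
    from prime[OF V(1) H_hpolys this] V(2) have "H D q \<in> P D" by blast
    with Suc.IH[of q] Suc.prems(1) True show ?thesis by (simp add: H_def)
  next
    case False
    with Suc.prems(2) have deg: "Polynomial.degree q = Suc D" by simp
    with ac obtain r where "poly q r = 0" by (metis zero_less_Suc)
    then obtain q' where q': "q = [:- r, 1:] * q'" by (auto simp: poly_eq_0_iff_dvd)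
    have "q' \<noteq> 0" using Suc.prems(1) q' by auto
    then have deg': "Polynomial.degree q' = D" using deg unfolding q' by (subst (asm) degree_mult_eq) auto
    \<comment> \<open>Write \<open>q\<close> as \<open>X q' - r q'\<close>: the first summand
      homogenises to \<open>U\<close> times \<open>H D q'\<close>, the second, of degree at most
      \<open>D\<close>, picks up the factor \<open>V\<close>.\<close>
    have "H (Suc D) q = U * H D q' - mconst r * (V * H D q')"
    proof -
      have "H (Suc D) q = H (Suc D) (pCons 0 q') + H (Suc D) (Polynomial.smult (- r) q')"
        unfolding q' H_def sum.distrib[symmetric]
        by (rule sum.cong) (auto simp: mconst_add mconst_diff mconst_minus mconst_mult algebra_simps)
      moreover have "H (Suc D) (pCons 0 q') = U * H D q'"
        unfolding H_def sum_distrib_left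
        by (subst sum.atMost_Suc_shift) (simp add: algebra_simps)
      moreover have "H (Suc D) (Polynomial.smult (- r) q') = - (mconst r * H (Suc D) q')"
        unfolding H_def sum_distrib_left sum_negf[symmetric]
        by (rule sum.cong) (auto simp: mconst_minus mconst_mult algebra_simps)
      ultimately show ?thesis using H_Suc[of q'] deg' by simp
    qed
    then have "H (Suc D) q = (U - mconst r * V) * H D q'" by (simp add: algebra_simps)
    moreover have "H (Suc D) q \<in> P (1 + D)" using Suc.prems(3) by (simp add: H_def)
    ultimately have *: "(U - mconst r * V) * H D q' \<in> P (1 + D)" by metis
    have "U - mconst r * V \<in> hpolys l 1" using U V by (intro hpolys_diff hpolys_mconst_mult)
    from prime[OF this H_hpolys *] Suc.IH[of q'] \<open>q' \<noteq> 0\<close> deg' show ?thesis by (auto simp: H_def)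
  qed
qed

end

text \<open>In the quotient by a maximal relevant ideal some \<open>x\<^sub>k\<close> is nonzero and generates an irrelevant ideal, so
  the Hilbert function is bounded and the monomials \<open>x\<^sub>i\<^sup>j x\<^sub>k\<^sup>D\<^sup>-\<^sup>j\<close> are dependent.  A binary form splits into
  linear factors and the ideal is prime, hence it contains some \<open>x\<^sub>i - z\<^sub>i x\<^sub>k\<close> for every \<open>i\<close>.\<close>

theorem projective_nullstellensatz:
  fixes P :: "nat \<Rightarrow> 'a::alg_closed_field mpoly set"
  assumes "gideal l P" "relevant l P"
  obtains z where "\<exists>i\<le>l. z i \<noteq> 0" "\<And>i. i > l \<Longrightarrow> z i = 0" "\<And>a p. p \<in> P a \<Longrightarrow> meval id z p = 0"
proof -
  obtain Q where Q: "gideal l Q" "relevant l Q" "\<And>a. P a \<subseteq> Q a"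
    "\<And>Q'. gideal l Q' \<Longrightarrow> relevant l Q' \<Longrightarrow> (\<And>a. Q a \<subseteq> Q' a) \<Longrightarrow> Q' = Q"
    using exists_maximal_relevant[OF assms] by metis
  interpret maximal_relevant l Q by (rule maximal_relevant.intro[OF Q(1,2,4)])
  have "\<exists>k\<le>l. mvar k \<notin> Q 1"
  proof (rule ccontr)
    assume *: "\<not> ?thesis"
    have "hpolys l 1 \<subseteq> Q 1"
    proof (rule hpolys_subset_if_monomials[OF P])
      fix m :: expo assume "keys m \<subseteq> {0..l}" "expo_deg m = 1"
      then obtain i m' where "i \<in> {0..l}" "m = single i 1 + m'" "expo_deg m' = 0"
        using expo_split_single[of m "{0..l}" 0] by (metis One_nat_def)
      with * show "single m 1 \<in> Q 1" by (auto simp: expo_deg_eq_0 mvar_def)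
    qed
    with rel show False by (auto simp: relevant_def)
  qed
  then obtain k where k: "k \<le> l" "mvar k \<notin> Q 1" by blast
  have V: "mvar k \<in> hpolys l 1" using k by simp
  obtain m where m: "hpolys l m \<subseteq> gplus l Q 1 (mvar k) m" using gplus_irrelevant[OF V k(2)] .
  obtain D :: nat where D: "\<forall>a. spanned l Q D a"
    by (rule gideal_bounded[OF P V _ m]) simp_all
  have lin: "\<exists>r. mvar i - mconst r * mvar k \<in> Q 1" if "i \<le> l" for i
  proof -
    have U: "mvar i \<in> hpolys l 1" using that by simp
    obtain g where g: "\<forall>p\<in>hpolys l D. \<exists>c. p - (\<Sum>i<D. mconst (c i) * g i) \<in> Q D" using D by blast
    have u: "mvar i ^ j * mvar k ^ (D - j) \<in> hpolys l D" if "j \<le> D" for j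
      using hpolys_mult[OF hpolys_power[OF U, of j] hpolys_power[OF V, of "D - j"]] that by simp
    obtain c where c: "\<exists>j\<le>D. c j \<noteq> 0" "(\<Sum>j\<le>D. mconst (c j) * (mvar i ^ j * mvar k ^ (D - j))) \<in> Q D"
      by (rule gideal_dependence[OF P g, where u = "\<lambda>j. mvar i ^ j * mvar k ^ (D - j)"]) (rule u)
    \<comment> \<open>The relation is the value of a binary form at two variables; \<open>q\<close>
      is its dehomogenisation.\<close>
    define q where "q = (\<Sum>j\<le>D. Polynomial.monom (c j) j)"
    have coeff: "Polynomial.coeff q j = (if j \<le> D then c j else 0)" for j
      by (simp add: q_def Polynomial.coeff_sum)
    then have "q \<noteq> 0" "Polynomial.degree q \<le> D" using c(1)
      by (auto intro: Polynomial.degree_le) (metis coeff_0)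
    moreover have "(\<Sum>j\<le>D. mconst (Polynomial.coeff q j) * mvar i ^ j * mvar k ^ (D - j)) \<in> Q D"
      using c(2) by (simp add: coeff mult.assoc)
    ultimately show ?thesis
      using binary_form_linear_factor[OF U V k(2)] alg_closed_imp_poly_has_root by blast
  qed
  then obtain r where r: "mvar i - mconst (r i) * mvar k \<in> Q 1" if "i \<le> l" for i by metis
  \<comment> \<open>The point is normalised to have \<open>k\<close>-th coordinate 1. Setting this
    directly spares a proof that \<open>r k = 1\<close>.\<close>
  define z where "z i = (if i \<le> l then if i = k then 1 else r i else 0)" for i
  have z: "mvar i - mconst (z i) * mvar k \<in> Q 1" if "i \<le> l" for i
    using r[OF that] gideal_0[OF P] that by (auto simp: z_def)
  have Yk: "mvar k ^ a \<in> hpolys l a" for a using hpolys_power[OF V, of a] by simp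
  have mono: "single m 1 - mconst (mon z m) * mvar k ^ a \<in> Q a" if "keys m \<subseteq> {0..l}" "expo_deg m = a" for m a
    using that
  proof (induction a arbitrary: m)
    case 0
    then show ?case using gideal_0[OF P] by (simp add: expo_deg_eq_0)
  next
    case (Suc a)
    from expo_split_single[OF Suc.prems] obtain i m' where
      m': "i \<in> {0..l}" "m = single i 1 + m'" "keys m' \<subseteq> {0..l}" "expo_deg m' = a" by metis
    define M' where "M' = single m' (1 :: 'a)"
    have M': "M' \<in> hpolys l a" unfolding M'_def using m' by (auto intro: hpolys_single)
    have "M' * (mvar i - mconst (z i) * mvar k) + (mconst (z i) * mvar k) * (M' - mconst (mon z m') * mvar k ^ a) \<in> Q (Suc a)"
      using gideal_mult[OF P M' z[of i]] gideal_mult[OF P hpolys_mconst_mult[OF V] Suc.IH[OF m'(3,4)]] m'(1)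
      by (intro gideal_add[OF P]) (auto simp: M'_def)
    moreover have "single m 1 = mvar i * M'" by (simp add: m'(2) M'_def mvar_def mult_single)
    moreover have "mon z m = z i * mon z m'" using m'(1,2) by (simp add: mon_add mon_single[of z i 1, simplified])
    ultimately show ?case by (simp add: algebra_simps mconst_mult)
  qed
  \<comment> \<open>Modulo \<open>Q\<close> a form of degree \<open>a\<close> is its value at
    \<open>z\<close> times the \<open>a\<close>-th power of the variable \<open>k\<close>. An
    element of \<open>P\<close> with nonzero value would put that power, and with it every form of
    degree \<open>a\<close>, into \<open>Q\<close>.\<close>
  have ev: "p - mconst (meval id z p) * mvar k ^ a \<in> Q a" if p: "p \<in> hpolys l a" for p a
  proof -
    let ?E = "expos l a"
    have keys: "keys p \<subseteq> ?E" using p by (auto simp: hpolys_def mvars_def mhomog_def)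
    have "(\<Sum>m\<in>?E. mconst (lookup p m) * (single m 1 - mconst (mon z m) * mvar k ^ a)) \<in> Q a"
      by (intro gideal_sum[OF P] gideal_mconst[OF P]) (auto intro: mono)
    also have "(\<Sum>m\<in>?E. mconst (lookup p m) * (single m 1 - mconst (mon z m) * mvar k ^ a)) =
        p - mconst (meval id z p) * mvar k ^ a"
      using hpolys_sum_monomials[OF p] meval_superset[OF finite_expos keys, of id z]
      by (simp add: right_diff_distrib sum_subtractf mconst.hom_sum sum_distrib_right mconst_mult mult.assoc)
    finally show ?thesis .
  qed
  show ?thesis
  proof (rule that[of z])
    show "\<exists>i\<le>l. z i \<noteq> 0" using k by (intro exI[of _ k]) (auto simp: z_def)
    show "z i = 0" if "i > l" for i using that by (simp add: z_def)
    show "meval id z p = 0" if "p \<in> P a" for p a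
    proof (rule ccontr)
      assume nz: "meval id z p \<noteq> 0"
      have p: "p \<in> Q a" using that Q(3) by blast
      from gideal_diff[OF P p ev[OF gideal_hpolys[OF P p]]]
      have "mconst (inverse (meval id z p)) * (mconst (meval id z p) * mvar k ^ a) \<in> Q a"
        by (intro gideal_mconst[OF P, of _ _ "inverse (meval id z p)"]) simp
      then have Ya: "mvar k ^ a \<in> Q a" using nz by (simp add: mult.assoc[symmetric] mconst_mult[symmetric])
      have "q \<in> Q a" if "q \<in> hpolys l a" for q
        using gideal_add[OF P ev[OF that] gideal_mconst[OF P Ya, of "meval id z q"]] by simp
      with rel show False by (auto simp: relevant_def)
    qed
  qed
qed

section \<open>Vanishing polynomials and extension of scalars\<close>

text \<open>For \<open>m > n\<close> a root of \<open>X^m - X^n - 1\<close> distinguishes the two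
  powers, in every characteristic.\<close>

lemma exists_power_neq:
  assumes "m \<noteq> n"
  shows "\<exists>a :: 'a::alg_closed_field. a ^ m \<noteq> a ^ n"
proof -
  have *: "\<exists>a :: 'a. a ^ m \<noteq> a ^ n" if "m > n" for m n
  proof -
    define q :: "'a poly" where "q = Polynomial.monom 1 m - Polynomial.monom 1 n - 1"
    have "Polynomial.coeff q m = 1" using that by (simp add: q_def)
    then have "Polynomial.degree q > 0" using that le_degree[of q m] by simp
    then obtain a where "poly q a = 0" using alg_closed_imp_poly_has_root by blast
    then have "a ^ m - a ^ n = 1" by (simp add: q_def poly_monom)
    then show ?thesis by (intro exI[of _ a]) auto
  qed
  show ?thesis using *[of m n] *[of n m] assms by (metis linorder_neqE_nat)
qed

text \<open>Distinct monomials are distinct characters, so Dedekind's argument applies.\<close>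

lemma mpoly_eq_0_if_vanishing:
  fixes p :: "'a::alg_closed_field mpoly"
  assumes "\<And>t. meval id t p = 0"
  shows "p = 0"
  using assms
proof (induction "card (keys p)" arbitrary: p rule: less_induct)
  case less
  show ?case
  proof (rule ccontr)
    assume "p \<noteq> 0"
    then obtain m1 where m1: "m1 \<in> keys p" by (metis keys_eq_empty equals0I)
    show False
    proof (cases "keys p = {m1}")
      case True
      then have "meval id (\<lambda>_. 1) p = lookup p m1" by (simp add: meval_def)
      with less.prems m1 show False by (simp add: in_keys_iff)
    next
      case False
      with m1 obtain m2 where m2: "m2 \<in> keys p" "m2 \<noteq> m1" by blast
      then obtain i where "lookup m2 i \<noteq> lookup m1 i" by (metis poly_mapping_eqI)
      then obtain a :: 'a where a: "a ^ lookup m2 i \<noteq> a ^ lookup m1 i" using exists_power_neq by blast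
      \<comment> \<open>Scaling the coordinate in which \<open>m1\<close> and \<open>m2\<close>
        differ multiplies the two monomials by different factors.\<close>
      define s where "s j = (if j = i then a else 1)" for j
      have mon_s: "mon s m = a ^ lookup m i" for m
      proof -
        have "mon s m = (\<Prod>j\<in>insert i (keys m). s j ^ lookup m j)" by (rule mon_superset) auto
        also have "\<dots> = (\<Prod>j\<in>insert i (keys m). if j = i then a ^ lookup m i else 1)"
          by (rule prod.cong) (auto simp: s_def)
        finally show ?thesis by (simp add: prod.delta)
      qed
      \<comment> \<open>As a function, \<open>q\<close> is \<open>p(s t)\<close> minus the value of
        \<open>m1\<close> at \<open>s\<close> times \<open>p(t)\<close>. It vanishes everywhere too,
        has lost the term \<open>m1\<close> and has kept \<open>m2\<close>.\<close>
      define q where "q = (\<Sum>m\<in>keys p. single m (lookup p m * (mon s m - mon s m1)))"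
      have q: "lookup q m = lookup p m * (mon s m - mon s m1)" for m
        by (auto simp: q_def lookup_sum lookup_single when_def sum.delta in_keys_iff)
      have keys: "keys q \<subseteq> keys p" by (auto simp: in_keys_iff q)
      have "m1 \<notin> keys q" by (simp add: in_keys_iff q)
      with keys m1 have "card (keys q) < card (keys p)" by (intro psubset_card_mono) auto
      moreover have "meval id t q = 0" for t
      proof -
        have "meval id t q = (\<Sum>m\<in>keys p. lookup p m * mon (\<lambda>j. s j * t j) m) -
            mon s m1 * (\<Sum>m\<in>keys p. lookup p m * mon t m)"
          unfolding meval_superset[of "keys p" q id t, OF finite_keys keys, simplified]
          by (simp add: q mon_mult algebra_simps sum_subtractf sum_distrib_left)
        then show ?thesis
          using less.prems[of t] less.prems[of "\<lambda>j. s j * t j"] by (simp add: meval_def mon_def[symmetric])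
      qed
      ultimately have "q = 0" by (rule less.hyps)
      with q[of m2] have "lookup p m2 * (mon s m2 - mon s m1) = 0" by simp
      with m2(1) a show False by (simp add: mon_s in_keys_iff)
    qed
  qed
qed

section \<open>Extension of scalars and functionals on coefficients\<close>

lemma map_single_zero: "f 0 = 0 \<Longrightarrow> cmap f (single m c) = single m (f c)"
  by (rule poly_mapping_eqI) (simp add: lookup_map_zero lookup_single when_def)

lemma map_zero: "f 0 = 0 \<Longrightarrow> cmap f 0 = 0"
  by (rule poly_mapping_eqI) (simp add: lookup_map_zero)

lemma map_add_zero:
  "f 0 = 0 \<Longrightarrow> (\<And>a b. f (a + b) = f a + f b) \<Longrightarrow>
    cmap f (p + q) = cmap f p + cmap f q"
  by (rule poly_mapping_eqI) (simp add: lookup_map_zero lookup_add)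

lemma keys_map_subset: "f 0 = 0 \<Longrightarrow> keys (cmap f p) \<subseteq> keys p"
  by (auto simp: in_keys_iff lookup_map_zero)

lemma mvars_map: "f 0 = 0 \<Longrightarrow> mvars p \<subseteq> V \<Longrightarrow> mvars (cmap f p) \<subseteq> V"
  using keys_map_subset[of f p] by (auto simp: mvars_subset_iff)

lemma mhomog_map: "f 0 = 0 \<Longrightarrow> mhomog a p \<Longrightarrow> mhomog a (cmap f p)"
  using keys_map_subset[of f p] by (auto simp: mhomog_def)

lemma hpolys_map: "f 0 = 0 \<Longrightarrow> p \<in> hpolys l a \<Longrightarrow> cmap f p \<in> hpolys l a"
  by (simp add: hpolys_def mvars_map mhomog_map)

abbreviation acmap :: "'k::field mpoly \<Rightarrow> 'k alg_closure mpoly" where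
  "acmap \<equiv> cmap to_ac"

lemma acmap_single [simp]: "acmap (single m c) = single m (to_ac c)"
  by (simp add: map_single_zero)

lemma acmap_0 [simp]: "acmap 0 = 0"
  by (simp add: map_zero)

lemma acmap_add: "acmap (p + q) = acmap p + acmap q"
  by (simp add: map_add_zero)

lemma acmap_mult: "acmap (p * q) = acmap p * acmap q"
proof (induction p rule: poly_mapping_sum_induct)
  case (single m)
  show ?case
    by (induction q rule: poly_mapping_sum_induct) (simp_all add: mult_single acmap_add algebra_simps)
qed (simp_all add: acmap_add algebra_simps)

interpretation acmap: comm_ring_hom acmap
  using acmap_single[of "0 :: expo" 1] by unfold_locales (simp_all add: acmap_add acmap_mult)

lemma acmap_mvar [simp]: "acmap (mvar i) = mvar i"
  by (simp add: mvar_def)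

lemma meval_acmap: "meval id z (acmap p) = meval to_ac z p"
  using meval_superset[of "keys p" "acmap p" id z] keys_map_subset[of to_ac p]
  by (simp add: lookup_map_zero meval_def mon_def)

lemma mon_acmap: "acmap (mon v m) = mon (\<lambda>i. acmap (v i)) m"
  by (simp add: mon_def acmap.hom_prod acmap.hom_power)

definition klinear :: "('k::field alg_closure \<Rightarrow> 'k) \<Rightarrow> bool" where
  "klinear f \<longleftrightarrow> (\<forall>a b. f (a + b) = f a + f b) \<and> (\<forall>c a. f (to_ac c * a) = c * f a)"

lemma klinear_add: "klinear f \<Longrightarrow> f (a + b) = f a + f b"
  and klinear_scale: "klinear f \<Longrightarrow> f (to_ac c * a) = c * f a"
  by (simp_all add: klinear_def)

lemma klinear_0: "klinear f \<Longrightarrow> f 0 = 0"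
  using klinear_scale[of f 0 0] by simp

lemma klinear_mult: "klinear f \<Longrightarrow> klinear (\<lambda>a. f (c * a))"
  by (simp add: klinear_def distrib_left mult.left_commute[of c "to_ac _"])

lemma klinear_separating:
  fixes c :: "'k::field alg_closure"
  assumes "c \<noteq> 0"
  obtains f where "klinear f" "f c \<noteq> 0"
proof -
  interpret vector_space "\<lambda>a x. to_ac (a :: 'k) * x"
    by unfold_locales (auto simp: algebra_simps)
  have "c \<notin> span {}" using assms by simp
  then obtain f where f: "Vector_Spaces.linear (\<lambda>a x. to_ac (a :: 'k) * x) (*) f" "f c = 1"
    by (rule separating_functional)
  interpret f: Vector_Spaces.linear "\<lambda>a x. to_ac (a :: 'k) * x" "(*)" f by (rule f(1))
  have "klinear f" unfolding klinear_def using f.add f.scale by simp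
  with f(2) show ?thesis by (intro that[of f]) auto
qed

lemma kmap_single: "klinear f \<Longrightarrow> cmap f (single m c) = single m (f c)"
  and kmap_0: "klinear f \<Longrightarrow> cmap f 0 = 0"
  and kmap_add: "klinear f \<Longrightarrow> cmap f (p + q) = cmap f p + cmap f q"
  by (simp_all add: map_single_zero map_zero map_add_zero klinear_0 klinear_add)

text \<open>A functional is not multiplicative, but it is linear over \<open>K\<close>, and so its
  coefficientwise application is linear over polynomials with coefficients in \<open>K\<close>. This
  is what lets ideal membership descend.\<close>

lemma kmap_mult:
  assumes f: "klinear f"
  shows "cmap f (acmap p * g) = p * cmap f g"
proof (induction p rule: poly_mapping_sum_induct)
  case (single m)
  show ?case
  proof (induction g rule: poly_mapping_sum_induct)
    case (single m')
    then show ?case by (simp add: mult_single kmap_single[OF f] klinear_scale[OF f])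
  qed (simp_all add: kmap_add[OF f] algebra_simps kmap_0[OF f])
qed (simp_all add: kmap_add[OF f] kmap_0[OF f] acmap_add algebra_simps)

lemma kmap_scale:
  assumes f: "klinear f"
  shows "cmap f (mconst c * g) = cmap (\<lambda>a. f (c * a)) g"
  by (rule poly_mapping_eqI)
    (simp add: lookup_map_zero lookup_mconst_mult klinear_0[OF f] klinear_0[OF klinear_mult[OF f]])

lemma kmap_acmap:
  assumes f: "klinear f"
  shows "cmap f (acmap p) = mconst (f 1) * p"
  using kmap_mult[OF f, of p 1] kmap_single[OF f, of "0 :: expo" 1] by (simp add: mconst_def mult.commute)

text \<open>The substituted polynomials have coefficients in \<open>K\<close>, so only the outer
  coefficients meet the functional. Hence a relation among the parametrising polynomials over the
  closure gives one over \<open>K\<close>.\<close>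

lemma kmap_meval:
  assumes f: "klinear f"
  shows "meval mconst v (cmap f g) = cmap f (meval mconst (\<lambda>i. acmap (v i)) g)"
proof (induction g rule: poly_mapping_sum_induct)
  case (single m)
  have "cmap f (acmap (mon v m) * mconst (lookup g m)) = mon v m * mconst (f (lookup g m))"
    by (simp only: kmap_mult[OF f]) (simp add: mconst_def kmap_single[OF f])
  then show ?case
    by (simp add: kmap_single[OF f] mconst.meval_single mon_acmap mult.commute)
qed (simp_all add: kmap_add[OF f] kmap_0[OF f] mconst.meval_add)

section \<open>The coordinate ring\<close>

lemma poly_ring_upto_simps [simp]:
  "p \<in> carrier (poly_ring_upto m) \<longleftrightarrow> mvars p \<subseteq> {0..m}"
  "p \<otimes>\<^bsub>poly_ring_upto m\<^esub> q = p * q" "p \<oplus>\<^bsub>poly_ring_upto m\<^esub> q = p + q"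
  "\<one>\<^bsub>poly_ring_upto m\<^esub> = 1" "\<zero>\<^bsub>poly_ring_upto m\<^esub> = 0"
  by (simp_all add: poly_ring_upto_def)

lemma cring_poly_ring_upto: "cring (poly_ring_upto m :: 'a::comm_ring_1 mpoly ring)"
proof (intro cringI abelian_groupI comm_monoidI)
  fix x :: "'a mpoly" assume "x \<in> carrier (poly_ring_upto m)"
  then show "\<exists>y\<in>carrier (poly_ring_upto m). y \<oplus>\<^bsub>poly_ring_upto m\<^esub> x = \<zero>\<^bsub>poly_ring_upto m\<^esub>"
    by (intro bexI[of _ "- x"]) auto
qed (simp_all add: mvars_add mvars_mult algebra_simps)

lemma poly_ring_upto_a_minus:
  assumes "mvars p \<subseteq> {0..m}" "mvars q \<subseteq> {0..m}"
  shows "p \<ominus>\<^bsub>poly_ring_upto m\<^esub> q = (p - q :: 'a::comm_ring_1 mpoly)"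
proof -
  interpret cring "poly_ring_upto m :: 'a mpoly ring" by (rule cring_poly_ring_upto)
  have "\<ominus>\<^bsub>poly_ring_upto m\<^esub> q = - q" using assms by (intro minus_equality) auto
  then show ?thesis by (simp add: a_minus_def)
qed

lemma ideal_if_closed:
  assumes "cring A" "J \<subseteq> carrier A" "\<zero>\<^bsub>A\<^esub> \<in> J" "\<And>x y. x \<in> J \<Longrightarrow> y \<in> J \<Longrightarrow> x \<oplus>\<^bsub>A\<^esub> y \<in> J"
    "\<And>x w. x \<in> J \<Longrightarrow> w \<in> carrier A \<Longrightarrow> w \<otimes>\<^bsub>A\<^esub> x \<in> J"
  shows "ideal J A"
proof -
  interpret cring A by fact
  show ?thesis
  proof (rule idealI)
    show "ring A" ..
    show "subgroup J (add_monoid A)"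
    proof (rule add.subgroupI)
      show "\<ominus>\<^bsub>A\<^esub> x \<in> J" if "x \<in> J" for x
        using assms(5)[OF that, of "\<ominus>\<^bsub>A\<^esub> \<one>\<^bsub>A\<^esub>"] subsetD[OF assms(2) that] by (simp add: l_minus)
    qed (use assms in auto)
    show "x \<otimes>\<^bsub>A\<^esub> w \<in> J" if "x \<in> J" "w \<in> carrier A" for x w
      using assms(5)[OF that] m_comm[of x w] subsetD[OF assms(2) that(1)] that(2) by simp
  qed (use assms in auto)
qed

lemma poly_ring_idealI:
  fixes J :: "'a::comm_ring_1 mpoly set"
  assumes "\<And>p. p \<in> J \<Longrightarrow> mvars p \<subseteq> {0..m}" "0 \<in> J" "\<And>p q. p \<in> J \<Longrightarrow> q \<in> J \<Longrightarrow> p + q \<in> J"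
    "\<And>p w. p \<in> J \<Longrightarrow> mvars w \<subseteq> {0..m} \<Longrightarrow> w * p \<in> J"
  shows "ideal J (poly_ring_upto m)"
  by (rule ideal_if_closed[OF cring_poly_ring_upto]) (use assms in \<open>auto simp del: mult_eq_0_iff\<close>)

lemma
  assumes "ideal J (poly_ring_upto m)"
  shows poly_ideal_mvars: "p \<in> J \<Longrightarrow> mvars p \<subseteq> {0..m}"
    and poly_ideal_0: "0 \<in> J"
    and poly_ideal_add: "p \<in> J \<Longrightarrow> q \<in> J \<Longrightarrow> p + q \<in> J"
    and poly_ideal_mult: "p \<in> J \<Longrightarrow> mvars w \<subseteq> {0..m} \<Longrightarrow> w * p \<in> J"
proof -
  interpret ideal J "poly_ring_upto m" by fact
  show "p \<in> J \<Longrightarrow> mvars p \<subseteq> {0..m}" using Icarr by auto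
  show "0 \<in> J" using additive_subgroup.zero_closed[OF ideal.axioms(1)[OF assms]] by simp
  show "p \<in> J \<Longrightarrow> q \<in> J \<Longrightarrow> p + q \<in> J" using additive_subgroup.a_closed[OF ideal.axioms(1)[OF assms], of p q] by simp
  show "p \<in> J \<Longrightarrow> mvars w \<subseteq> {0..m} \<Longrightarrow> w * p \<in> J" using I_l_closed[of p w] by simp
qed

text \<open>Cutting down to forms gives a graded ideal whatever \<open>J\<close> is; the components
  of an element of \<open>J\<close> are not claimed to lie in \<open>J\<close>.\<close>

lemma gideal_ideal:
  assumes "ideal J (poly_ring_upto l)"
  shows "gideal l (\<lambda>a. J \<inter> hpolys l a)"
  unfolding gideal_def using poly_ideal_0[OF assms] poly_ideal_add[OF assms] poly_ideal_mult[OF assms]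
  by (auto intro!: hpolys_add hpolys_mult) (auto simp: hpolys_def)

locale parametrisation =
  fixes n l :: nat and \<phi> :: "nat \<Rightarrow> 'k::field mpoly"
  assumes phi: "\<forall>i\<le>l. \<phi> i \<noteq> 0 \<and> mvars (\<phi> i) \<subseteq> {1..n}"
begin

abbreviation "S \<equiv> poly_ring_upto l :: 'k mpoly ring"
abbreviation "R \<equiv> coord_ring n l \<phi>"
abbreviation "IX \<equiv> ideal_X n l \<phi>"
abbreviation "cl \<equiv> cls n l \<phi>"
abbreviation "pmap \<equiv> param_map \<phi>"
abbreviation inS :: "'a::comm_ring_1 mpoly \<Rightarrow> bool" where "inS p \<equiv> mvars p \<subseteq> {0..l}"
abbreviation "Rdeg \<equiv> coord_deg n l \<phi>"

lemma IX_iff: "p \<in> IX \<longleftrightarrow> inS p \<and> pmap p = 0"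
  by (simp add: ideal_X_def a_kernel_def')

lemma param_map_add: "pmap (p + q) = pmap p + pmap q"
  and param_map_mult: "pmap (p * q) = pmap p * pmap q"
  and param_map_0 [simp]: "pmap 0 = 0"
  and param_map_1 [simp]: "pmap 1 = 1"
  and param_map_mconst [simp]: "pmap (mconst c) = mconst c"
  by (simp_all add: param_map_def mconst.meval_add mconst.meval_mult)

lemma param_map_diff: "pmap (p - q) = pmap p - pmap q"
  using param_map_add[of "p - q" q] by simp

lemma param_map_sum: "pmap (\<Sum>x\<in>A. f x) = (\<Sum>x\<in>A. pmap (f x))"
  by (induction A rule: infinite_finite_induct) (simp_all add: param_map_add)

lemma ideal_IX: "ideal IX S"
  by (rule poly_ring_idealI) (auto simp: IX_iff param_map_add param_map_mult mvars_add mvars_mult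
      intro!: mvars_add[THEN subsetD] mvars_mult[THEN subsetD])

lemma cring_S: "cring S"
  by (rule cring_poly_ring_upto)

lemma cring_R: "cring R"
  unfolding coord_ring_def using ideal.quotient_is_cring[OF ideal_IX cring_S] .

lemma cl_hom: "cl \<in> Ring.ring_hom S R"
  unfolding coord_ring_def cls_def by (rule ideal.rcos_ring_hom[OF ideal_IX])

lemma cl_add: "inS p \<Longrightarrow> inS q \<Longrightarrow> cl (p + q) = cl p \<oplus>\<^bsub>R\<^esub> cl q"
  using ring_hom_add[OF cl_hom, of p q] by simp

lemma cl_mult: "inS p \<Longrightarrow> inS q \<Longrightarrow> cl (p * q) = cl p \<otimes>\<^bsub>R\<^esub> cl q"
  using ring_hom_mult[OF cl_hom, of p q] by simp

lemma cl_1: "cl 1 = \<one>\<^bsub>R\<^esub>"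
  using ring_hom_one[OF cl_hom] by simp

lemma cl_0: "cl 0 = \<zero>\<^bsub>R\<^esub>"
proof -
  interpret S: cring S by (rule cring_S)
  show ?thesis
    unfolding cls_def coord_ring_def FactRing_def
    using S.a_rcos_zero[OF ideal_IX poly_ideal_0[OF ideal_IX]] by simp
qed

lemma cl_carrier: "inS p \<Longrightarrow> cl p \<in> carrier R"
  using ring_hom_closed[OF cl_hom, of p] by simp

lemma carrier_R_E:
  assumes "x \<in> carrier R"
  obtains p where "inS p" "x = cl p"
  using assms by (auto simp: coord_ring_def FactRing_def A_RCOSETS_def' cls_def)

lemma cl_eq_iff: "inS p \<Longrightarrow> inS q \<Longrightarrow> cl p = cl q \<longleftrightarrow> p - q \<in> IX"
proof -
  assume pq: "inS p" "inS q"
  interpret S: cring S by (rule cring_S)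
  show ?thesis
    using S.quotient_eq_iff_same_a_r_cos[OF ideal_IX, of p q] pq
    by (simp add: cls_def poly_ring_upto_a_minus)
qed

lemma mem_cl_iff:
  assumes p: "inS p"
  shows "q \<in> cl p \<longleftrightarrow> inS q \<and> cl q = cl p"
proof
  assume "q \<in> cl p"
  then obtain h where "h \<in> IX" "q = h + p" by (auto simp: cls_def a_r_coset_def')
  with p show "inS q \<and> cl q = cl p"
    using poly_ideal_mvars[OF ideal_IX] cl_eq_iff[of q p] by (auto simp: mvars_add intro!: mvars_add[THEN subsetD])
next
  assume q: "inS q \<and> cl q = cl p"
  then have "q - p \<in> IX" using cl_eq_iff p by blast
  then show "q \<in> cl p" unfolding cls_def a_r_coset_def' by (auto intro!: bexI[of _ "q - p"])
qed

text \<open>The union of the cosets in \<open>I\<close> is the preimage of \<open>I\<close> in the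
  polynomial ring, and ideal arguments are carried out there on representatives.\<close>

lemma Union_ideal_iff:
  assumes "ideal I R"
  shows "p \<in> \<Union>I \<longleftrightarrow> inS p \<and> cl p \<in> I"
proof
  assume "p \<in> \<Union>I"
  then obtain x where x: "x \<in> I" "p \<in> x" by blast
  then obtain q where q: "inS q" "x = cl q"
    using ideal.Icarr[OF assms] carrier_R_E by metis
  then have "inS p \<and> cl p = cl q" using x(2) mem_cl_iff[OF q(1)] by simp
  with x q show "inS p \<and> cl p \<in> I" by simp
next
  assume p: "inS p \<and> cl p \<in> I"
  then have "p \<in> cl p" by (simp add: mem_cl_iff)
  with p show "p \<in> \<Union>I" by blast
qed

lemma ideal_Union:
  assumes I: "ideal I R"
  shows "ideal (\<Union>I) S"
proof (rule poly_ring_idealI)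
  interpret I: ideal I R by fact
  show "inS p" if "p \<in> \<Union>I" for p using that by (simp add: Union_ideal_iff[OF I] del: Union_iff)
  show "0 \<in> \<Union>I" using I.zero_closed by (simp add: Union_ideal_iff[OF I] cl_0 del: Union_iff)
  show "p + q \<in> \<Union>I" if "p \<in> \<Union>I" "q \<in> \<Union>I" for p q
    using that I.a_closed by (simp add: Union_ideal_iff[OF I] cl_add mvars_add del: Union_iff)
  show "w * p \<in> \<Union>I" if "p \<in> \<Union>I" "inS w" for p w
    using that I.I_l_closed cl_carrier by (simp add: Union_ideal_iff[OF I] cl_mult mvars_mult del: Union_iff)
qed

lemma cl_IX: "p \<in> IX \<Longrightarrow> cl p = \<zero>\<^bsub>R\<^esub>"
  using cl_eq_iff[of p 0] poly_ideal_mvars[OF ideal_IX, of p] by (simp add: cl_0)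

lemma IX_subset_Union: "ideal I R \<Longrightarrow> p \<in> IX \<Longrightarrow> p \<in> \<Union>I"
  unfolding Union_ideal_iff
  using poly_ideal_mvars[OF ideal_IX, of p] additive_subgroup.zero_closed[OF ideal.axioms(1)]
  by (metis cl_IX)

subsection \<open>The vanishing ideal of the variety\<close>

definition param_ac :: "'k alg_closure mpoly \<Rightarrow> 'k alg_closure mpoly" where
  "param_ac = meval mconst (\<lambda>i. acmap (mvar 0 * \<phi> i))"

lemma kmap_param: "klinear f \<Longrightarrow> pmap (cmap f G) = cmap f (param_ac G)"
  by (simp add: param_map_def param_ac_def kmap_meval)

lemma meval_param_ac:
  assumes "inS G"
  shows "meval id t (param_ac G) = meval id (\<lambda>i. t 0 * meval to_ac t (\<phi> i)) G"
proof -
  interpret ev: comm_ring_hom "meval id t :: 'k alg_closure mpoly \<Rightarrow> _" by (rule id.meval_hom)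
  have "meval id t (param_ac G) = meval (\<lambda>c. c) (\<lambda>i. meval id t (acmap (mvar 0 * \<phi> i))) G"
    unfolding param_ac_def by (subst ev.hom_meval) simp
  also have "(\<lambda>i. meval id t (acmap (mvar 0 * \<phi> i))) = (\<lambda>i. t 0 * meval to_ac t (\<phi> i))"
    by (simp add: acmap_mult id.meval_mult meval_acmap)
  finally show ?thesis by (simp add: id_def)
qed

lemma vanishes_proj_pt:
  assumes "G \<in> hpolys l a"
  shows "vanishes G (proj_pt z) \<longleftrightarrow> meval id z G = 0"
proof -
  have "meval id (\<lambda>i. c * z i) G = c ^ a * meval id z G" for c
    by (rule hpolys_scale[OF assms id.comm_ring_hom_axioms])
  then show ?thesis unfolding vanishes_def proj_pt_def by (auto dest: spec[of _ 1])
qed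

text \<open>A form that vanishes on \<open>X\<close> vanishes on the image of the parametrisation,
  so its pullback is zero as a function of the parameters, hence as a polynomial over the infinite
  closure.\<close>

lemma param_ac_eq_0_if_vanishes:
  assumes G: "G \<in> hpolys l a" and van: "\<forall>Z\<in>variety_X l \<phi>. vanishes G Z"
  shows "param_ac G = 0"
proof (rule mpoly_eq_0_if_vanishing)
  fix t :: "nat \<Rightarrow> 'k alg_closure"
  have mv: "inS G" using G by (simp add: hpolys_def)
  have image: "meval id (\<lambda>i. meval to_ac t (\<phi> i)) G = 0" if "i \<le> l" "meval to_ac t (\<phi> i) \<noteq> 0" for t i
  proof -
    let ?z = "\<lambda>i. if i \<le> l then meval to_ac t (\<phi> i) else 0"
    have "proj_pt ?z \<in> param_image l \<phi>" using that by (auto simp: param_image_def)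
    then have "proj_pt ?z \<in> variety_X l \<phi>"
      unfolding variety_X_def using hull_subset[of "param_image l \<phi>"] by blast
    with van have "vanishes G (proj_pt ?z)" by blast
    then have "meval id ?z G = 0" by (simp only: vanishes_proj_pt[OF G])
    moreover have "meval id ?z G = meval id (\<lambda>i. meval to_ac t (\<phi> i)) G"
      using mv by (intro meval_cong) auto
    ultimately show ?thesis by simp
  qed
  have "meval id (\<lambda>i. meval to_ac t (\<phi> i)) G = 0"
  proof (cases "\<exists>i\<le>l. meval to_ac t (\<phi> i) \<noteq> 0")
    case True
    then show ?thesis using image by blast
  next
    \<comment> \<open>A base point of the map has no image point. A form of positive degree is zero
      at the origin anyway; a constant is compared with its value at a parameter where \<phi> 0 does
      not vanish.\<close>
    case zero: False
    show ?thesis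
    proof (cases "a = 0")
      case True
      then have "keys G \<subseteq> {0}" using G by (auto simp: hpolys_def mhomog_def expo_deg_eq_0)
      then have const: "meval id v G = lookup G 0" for v
        by (simp add: meval_superset[of "{0}"])
      have "acmap (\<phi> 0) \<noteq> 0"
        using phi by (auto simp: poly_mapping_eq_iff fun_eq_iff lookup_map_zero)
      then obtain t' where "meval id t' (acmap (\<phi> 0)) \<noteq> 0" using mpoly_eq_0_if_vanishing by blast
      then have "meval id (\<lambda>i. meval to_ac t' (\<phi> i)) G = 0"
        by (intro image[of 0]) (auto simp: meval_acmap)
      then show ?thesis by (simp add: const)
    next
      case False
      have "meval id (\<lambda>i. meval to_ac t (\<phi> i)) G = meval id (\<lambda>i. 0 * meval to_ac t (\<phi> i)) G"
        using mv zero by (intro meval_cong) auto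
      also have "\<dots> = 0" using False by (subst hpolys_scale[OF G id.comm_ring_hom_axioms]) simp
      finally show ?thesis .
    qed
  qed
  then show "meval id t (param_ac G) = 0"
    unfolding meval_param_ac[OF mv] by (subst hpolys_scale[OF G id.comm_ring_hom_axioms]) simp
qed

text \<open>Descent from the algebraic closure to \<open>K\<close>: applying \<open>K\<close>-linear functionals to coefficients replaces
  the choice of a \<open>K\<close>-basis of the algebraic closure.\<close>

lemma kmap_scheme_ideal:
  assumes I: "ideal I R" and f: "klinear f" and G: "G \<in> scheme_ideal l \<phi> I"
  shows "cmap f G \<in> \<Union>I"
proof -
  interpret T: cring "poly_ring_upto l :: 'k alg_closure mpoly ring" by (rule cring_poly_ring_upto)
  have U: "ideal (\<Union>I) S" by (rule ideal_Union[OF I])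
  \<comment> \<open>\<open>W\<close> is shown to be an ideal containing the generators. Quantifying
    over all functionals makes it closed under multiplication: a coefficient of the multiplier is
    absorbed into the functional.\<close>
  define W where "W = {G :: 'k alg_closure mpoly. inS G \<and> (\<forall>f. klinear f \<longrightarrow> cmap f G \<in> \<Union>I)}"
  have "ideal W (poly_ring_upto l)"
  proof (rule poly_ring_idealI)
    show "inS p" if "p \<in> W" for p using that by (simp add: W_def)
    show W0: "0 \<in> W" using poly_ideal_0[OF U] by (simp add: W_def kmap_0 del: Union_iff)
    show W_add: "p + q \<in> W" if "p \<in> W" "q \<in> W" for p q
      using that poly_ideal_add[OF U] by (simp add: W_def mvars_add kmap_add)
    show "w * p \<in> W" if p: "p \<in> W" and w: "inS w" for p w
    proof (induction w rule: poly_mapping_sum_induct)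
      case zero
      then show ?case using W0 by simp
    next
      case (single m)
      have m: "inS (single m c)" for c
        using w single by (auto simp: mvars_def split: if_splits)
      have "inS (single m (lookup w m) * p)"
        using p m by (intro mvars_mult) (auto simp: W_def)
      moreover have "cmap f (single m (lookup w m) * p) \<in> \<Union>I" if f: "klinear f" for f
      proof -
        have "single m (lookup w m) * p = acmap (single m 1) * (mconst (lookup w m) * p)"
          by (simp add: single_eq_mconst[of m "lookup w m"] mult_ac)
        then have "cmap f (single m (lookup w m) * p) =
            single m 1 * cmap (\<lambda>a. f (lookup w m * a)) p"
          by (simp only: kmap_mult[OF f] kmap_scale[OF f])
        also have "\<dots> \<in> \<Union>I"
          using p klinear_mult[OF f] m by (intro poly_ideal_mult[OF U]) (auto simp: W_def)
        finally show ?thesis .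
      qed
      ultimately show ?case by (simp add: W_def)
    next
      case (add w1 w2)
      then show ?case using W_add by (simp add: algebra_simps)
    qed
  qed
  moreover have "G \<in> W" if G: "G \<in> homog_polys l" "\<forall>Z\<in>variety_X l \<phi>. vanishes G Z" for G
  proof -
    from G(1) obtain a where a: "G \<in> hpolys l a" by (rule homog_polysE)
    have "cmap f G \<in> \<Union>I" if f: "klinear f" for f
    proof -
      have "cmap f G \<in> hpolys l a" using a klinear_0[OF f] by (simp add: hpolys_map)
      moreover have "pmap (cmap f G) = 0"
        using param_ac_eq_0_if_vanishes[OF a G(2)]
        by (intro poly_mapping_eqI) (simp add: kmap_param[OF f] lookup_map_zero klinear_0[OF f])
      ultimately show ?thesis by (intro IX_subset_Union[OF I]) (simp add: IX_iff hpolys_def)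
    qed
    with a show ?thesis by (simp add: W_def hpolys_def)
  qed
  moreover have "acmap p \<in> W" if p: "p \<in> \<Union>I" for p
    using p poly_ideal_mvars[OF U p] poly_ideal_mult[OF U p]
    by (simp add: W_def mvars_map kmap_acmap)
  ultimately have "scheme_ideal l \<phi> I \<subseteq> W"
    unfolding scheme_ideal_def by (intro T.genideal_minimal) auto
  with G f show ?thesis by (auto simp: W_def)
qed

section \<open>Homogeneous components and the grading of the parametrisation\<close>

definition hcomp :: "nat \<Rightarrow> 'k mpoly \<Rightarrow> 'k mpoly" where
  "hcomp a p = (\<Sum>m\<in>{m \<in> keys p. expo_deg m = a}. single m (lookup p m))"

lemma lookup_hcomp: "lookup (hcomp a p) m = (if expo_deg m = a then lookup p m else 0)"
  by (auto simp: hcomp_def lookup_sum lookup_single when_def sum.delta in_keys_iff)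

lemma hcomp_hpolys: "inS p \<Longrightarrow> hcomp a p \<in> hpolys l a"
  unfolding hpolys_def hcomp_def
  by (intro CollectI conjI mvars_sum mhomog_sum) (auto simp: mvars_def mhomog_def split: if_splits)

lemma sum_hcomp: "p = (\<Sum>a\<in>expo_deg ` keys p. hcomp a p)"
proof (rule poly_mapping_eqI)
  fix m
  have "lookup (\<Sum>a\<in>expo_deg ` keys p. hcomp a p) m = (if expo_deg m \<in> expo_deg ` keys p then lookup p m else 0)"
    by (simp add: lookup_sum lookup_hcomp)
  moreover have "lookup p m = 0" if "expo_deg m \<notin> expo_deg ` keys p" using that by (auto simp: in_keys_iff)
  ultimately show "lookup p m = lookup (\<Sum>a\<in>expo_deg ` keys p. hcomp a p) m" by auto
qed

text \<open>Homogeneity in the variable \<open>0\<close> alone. For this grading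
  \<open>param_map\<close> is graded, since the \<phi> i involve only the other variables.\<close>

definition tdeg :: "nat \<Rightarrow> 'k mpoly \<Rightarrow> bool" where
  "tdeg d f \<longleftrightarrow> (\<forall>m\<in>keys f. lookup m 0 = d)"

lemma tdeg_add: "tdeg d f \<Longrightarrow> tdeg d g \<Longrightarrow> tdeg d (f + g)"
  unfolding tdeg_def using keys_add[of f g] by blast

lemma tdeg_mult:
  assumes "tdeg d f" "tdeg e g"
  shows "tdeg (d + e) (f * g)"
  unfolding tdeg_def
proof
  fix m assume "m \<in> keys (f * g)"
  then obtain a b where "m = a + b" "a \<in> keys f" "b \<in> keys g" using keys_mult[of f g] by blast
  with assms show "lookup m 0 = d + e" by (simp add: tdeg_def lookup_add)
qed

lemma tdeg_mconst: "tdeg 0 (mconst c)"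
  by (simp add: tdeg_def mconst_def)

lemma tdeg_gen: "i \<le> l \<Longrightarrow> tdeg 1 (mvar 0 * \<phi> i)"
proof -
  assume i: "i \<le> l"
  have "tdeg 1 (mvar 0)" by (simp add: tdeg_def mvar_def)
  moreover have "tdeg 0 (\<phi> i)"
    using phi i by (fastforce simp: tdeg_def mvars_def in_keys_iff)
  ultimately show ?thesis using tdeg_mult by fastforce
qed

lemma tdeg_mon: "keys m \<subseteq> {0..l} \<Longrightarrow> tdeg (expo_deg m) (mon (\<lambda>i. mvar 0 * \<phi> i) m)"
proof (induction "expo_deg m" arbitrary: m)
  case 0
  then show ?case using tdeg_mconst[of 1] by (simp add: expo_deg_eq_0)
next
  case (Suc a)
  from expo_split_single[OF Suc.prems Suc.hyps(2)[symmetric]] obtain i m' where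
    m': "i \<in> {0..l}" "m = single i 1 + m'" "keys m' \<subseteq> {0..l}" "expo_deg m' = a" by metis
  have "tdeg (1 + a) ((mvar 0 * \<phi> i) * mon (\<lambda>i. mvar 0 * \<phi> i) m')"
    using m' Suc.hyps(1)[of m'] by (intro tdeg_mult tdeg_gen) auto
  with Suc.hyps(2) m'(2) show ?case by (simp add: mon_add mon_single[of _ i 1, simplified])
qed

lemma tdeg_param_map:
  assumes "p \<in> hpolys l a"
  shows "tdeg a (pmap p)"
proof (induction p rule: poly_mapping_sum_induct)
  case (single m)
  have "keys m \<subseteq> {0..l}" "expo_deg m = a"
    using single assms by (auto simp: hpolys_def mvars_def mhomog_def)
  then have "tdeg (0 + a) (mconst (lookup p m) * mon (\<lambda>i. mvar 0 * \<phi> i) m)"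
    using tdeg_mon by (intro tdeg_mult tdeg_mconst) blast
  then show ?case by (simp add: param_map_def mconst.meval_single)
qed (auto simp: param_map_add tdeg_add, simp add: tdeg_def)

text \<open>The images of components of different degrees have different degrees in the variable
  \<open>0\<close>, so they cannot cancel one another.\<close>

lemma hcomp_IX:
  assumes p: "p \<in> IX"
  shows "hcomp a p \<in> IX"
proof -
  have mv: "inS p" using p by (simp add: IX_iff)
  have td: "tdeg b (pmap (hcomp b p))" for b by (rule tdeg_param_map[OF hcomp_hpolys[OF mv]])
  have "lookup (pmap (hcomp a p)) m = 0" for m
  proof (cases "lookup m 0 = a \<and> a \<in> expo_deg ` keys p")
    case True
    have "0 = pmap (\<Sum>b\<in>expo_deg ` keys p. hcomp b p)"
      using p sum_hcomp[of p] by (simp add: IX_iff)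
    then have "0 = (\<Sum>b\<in>expo_deg ` keys p. lookup (pmap (hcomp b p)) m)"
      by (metis param_map_sum lookup_sum lookup_zero)
    also have "\<dots> = (\<Sum>b\<in>expo_deg ` keys p. if b = a then lookup (pmap (hcomp a p)) m else 0)"
    proof (rule sum.cong)
      fix b assume "b \<in> expo_deg ` keys p"
      have "lookup (pmap (hcomp b p)) m = 0" if "b \<noteq> a"
      proof -
        have "m \<notin> keys (pmap (hcomp b p))" using td[of b] True that by (auto simp: tdeg_def)
        then show ?thesis by (simp add: in_keys_iff)
      qed
      then show "lookup (pmap (hcomp b p)) m = (if b = a then lookup (pmap (hcomp a p)) m else 0)"
        by simp
    qed simp
    also have "\<dots> = lookup (pmap (hcomp a p)) m" using True by (simp add: sum.delta)
    finally show ?thesis by simp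
  next
    case False
    show ?thesis
    proof (cases "a \<in> expo_deg ` keys p")
      case True
      with False td[of a] show ?thesis by (auto simp: tdeg_def in_keys_iff)
    next
      case False
      then have "hcomp a p = 0" by (intro poly_mapping_eqI) (auto simp: lookup_hcomp in_keys_iff image_iff)
      then show ?thesis by simp
    qed
  qed
  then have "pmap (hcomp a p) = 0" by (intro poly_mapping_eqI) simp
  then show ?thesis using hcomp_hpolys[OF mv, of a] by (simp add: IX_iff hpolys_def)
qed

end

section \<open>Functions vanishing on a reduced zero-dimensional scheme\<close>

lemma mem_proj_pt_iff: "z' \<in> proj_pt z \<longleftrightarrow> (\<exists>c. c \<noteq> 0 \<and> z' = (\<lambda>i. c * z i))"
  by (auto simp: proj_pt_def)

lemma proj_pt_self: "z \<in> proj_pt z"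
  unfolding mem_proj_pt_iff by (intro exI[of _ 1]) simp

lemma proj_pt_eqI:
  assumes "z' \<in> proj_pt z"
  shows "proj_pt z' = proj_pt z"
proof -
  obtain c where c: "c \<noteq> 0" "z' = (\<lambda>i. c * z i)" using assms by (auto simp: mem_proj_pt_iff)
  have "x \<in> proj_pt z' \<longleftrightarrow> x \<in> proj_pt z" for x
  proof
    assume "x \<in> proj_pt z'"
    then obtain b where "b \<noteq> 0" "x = (\<lambda>i. b * z' i)" by (auto simp: mem_proj_pt_iff)
    then show "x \<in> proj_pt z" unfolding mem_proj_pt_iff using c
      by (intro exI[of _ "b * c"]) (auto simp: mult.assoc)
  next
    assume "x \<in> proj_pt z"
    then obtain b where "b \<noteq> 0" "x = (\<lambda>i. b * z i)" by (auto simp: mem_proj_pt_iff)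
    then show "x \<in> proj_pt z'" unfolding mem_proj_pt_iff using c
      by (intro exI[of _ "b / c"]) auto
  qed
  then show ?thesis by blast
qed

locale equations = parametrisation n l \<phi> for n l and \<phi> :: "nat \<Rightarrow> 'k::field mpoly" +
  fixes s :: nat and ds :: "nat \<Rightarrow> nat" and F :: "nat \<Rightarrow> 'k mpoly" and I :: "'k mpoly set set"
  assumes F: "\<forall>i\<in>{1..s}. F i \<in> hpolys l (ds i)"
    and I: "I = Idl\<^bsub>R\<^esub> ((\<lambda>i. cl (F i)) ` {1..s})"
begin

abbreviation "J \<equiv> scheme_ideal l \<phi> I"
abbreviation "pts \<equiv> scheme_points l \<phi> I"

lemma F_mvars: "i \<in> {1..s} \<Longrightarrow> inS (F i)"
  using F by (auto simp: hpolys_def)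

lemma gens_carrier: "(\<lambda>i. cl (F i)) ` {1..s} \<subseteq> carrier R"
  using F_mvars cl_carrier by blast

lemma ideal_I: "ideal I R"
  unfolding I using ring.genideal_ideal[OF cring.axioms(1)[OF cring_R] gens_carrier] .

lemmas ideal_UI = ideal_Union[OF ideal_I]
lemmas UI_iff = Union_ideal_iff[OF ideal_I]
lemmas UI_mvars = poly_ideal_mvars[OF ideal_UI]
lemmas UI_0 = poly_ideal_0[OF ideal_UI]
lemmas UI_add = poly_ideal_add[OF ideal_UI]
lemmas UI_mult = poly_ideal_mult[OF ideal_UI]

lemma cl_F: "i \<in> {1..s} \<Longrightarrow> cl (F i) \<in> I"
  unfolding I using ring.genideal_self[OF cring.axioms(1)[OF cring_R] gens_carrier] by blast

lemma I_minimal: "ideal K R \<Longrightarrow> (\<And>i. i \<in> {1..s} \<Longrightarrow> cl (F i) \<in> K) \<Longrightarrow> I \<subseteq> K"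
  unfolding I by (rule ring.genideal_minimal[OF cring.axioms(1)[OF cring_R]]) auto

lemma scheme_gens_carrier:
  "{G \<in> homog_polys l. \<forall>Z\<in>variety_X l \<phi>. vanishes G Z} \<union> acmap ` \<Union>I \<subseteq> carrier (poly_ring_upto l)"
proof (intro Un_least image_subsetI)
  show "acmap p \<in> carrier (poly_ring_upto l)" if "p \<in> \<Union>I" for p
    using UI_mvars[OF that] by (simp add: mvars_map)
qed (auto simp: homog_polys_def)

lemma ideal_J: "ideal J (poly_ring_upto l)"
  unfolding scheme_ideal_def
  using ring.genideal_ideal[OF cring.axioms(1)[OF cring_poly_ring_upto] scheme_gens_carrier] .

lemma scheme_gens_subset: "{G \<in> homog_polys l. \<forall>Z\<in>variety_X l \<phi>. vanishes G Z} \<union> acmap ` \<Union>I \<subseteq> J"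
  unfolding scheme_ideal_def
  using ring.genideal_self[OF cring.axioms(1)[OF cring_poly_ring_upto] scheme_gens_carrier] .

lemma acmap_J: "p \<in> \<Union>I \<Longrightarrow> acmap p \<in> J"
  using scheme_gens_subset by blast

lemma J_minimal:
  assumes "ideal K (poly_ring_upto l)" "\<And>G. G \<in> homog_polys l \<Longrightarrow> G \<in> J \<Longrightarrow> G \<in> K"
    "\<And>p. p \<in> \<Union>I \<Longrightarrow> acmap p \<in> K"
  shows "J \<subseteq> K"
proof -
  have "{G \<in> homog_polys l. \<forall>Z\<in>variety_X l \<phi>. vanishes G Z} \<union> acmap ` \<Union>I \<subseteq> K"
    using assms(2,3) scheme_gens_subset by auto
  then show ?thesis
    using ring.genideal_minimal[OF cring.axioms(1)[OF cring_poly_ring_upto] assms(1)]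
    unfolding scheme_ideal_def by blast
qed

text \<open>A point of the scheme has to annihilate all of \<open>J\<close> at all its coordinate
  vectors, while the Nullstellensatz controls forms only. As the generators of \<open>J\<close> come
  from forms, it suffices that the polynomials vanishing at a given vector make up an ideal
  containing those generators.\<close>

lemma scheme_pointsI:
  fixes z :: "nat \<Rightarrow> 'k alg_closure"
  assumes z: "\<exists>i\<le>l. z i \<noteq> 0" "\<And>i. i > l \<Longrightarrow> z i = 0"
    and van: "\<And>a G. G \<in> J \<Longrightarrow> G \<in> hpolys l a \<Longrightarrow> meval id z G = 0"
  shows "proj_pt z \<in> pts"
proof -
  have "meval id (\<lambda>i. c * z i) G = 0" if c: "c \<noteq> 0" and G: "G \<in> J" for c G
  proof -
    let ?z = "\<lambda>i. c * z i"
    have van': "meval id ?z G = 0" if "G \<in> J" "G \<in> hpolys l a" for G a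
      using hpolys_scale[OF that(2) id.comm_ring_hom_axioms, of c z] van[OF that] by simp
    have van_cl: "meval to_ac ?z p = 0" if "p \<in> \<Union>I" "p \<in> hpolys l a" for p a
      using van'[OF acmap_J hpolys_map, OF that(1) _ that(2)] by (simp add: meval_acmap)
    \<comment> \<open>An element of \<open>IX\<close> is the sum of its components, which lie in
      \<open>IX\<close> again and vanish as forms. So vanishing at the vector depends only on the
      class in the coordinate ring.\<close>
    have IX0: "meval to_ac ?z q = 0" if q: "q \<in> IX" for q
    proof -
      have "meval to_ac ?z q = meval to_ac ?z (\<Sum>a\<in>expo_deg ` keys q. hcomp a q)"
        using sum_hcomp[of q] by simp
      also have "\<dots> = (\<Sum>a\<in>expo_deg ` keys q. meval to_ac ?z (hcomp a q))"
        by (rule comm_ring_hom.meval_sum[OF to_ac.comm_ring_hom_axioms])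
      also have "\<dots> = 0"
      proof (rule sum.neutral, intro ballI)
        fix a
        have "hcomp a q \<in> \<Union>I" by (rule IX_subset_Union[OF ideal_I hcomp_IX[OF q]])
        then show "meval to_ac ?z (hcomp a q) = 0"
          by (rule van_cl) (rule hcomp_hpolys[OF poly_ideal_mvars[OF ideal_IX q]])
      qed
      finally show ?thesis .
    qed
    \<comment> \<open>The classes vanishing at the vector. Since they form an ideal of the
      coordinate ring, testing the generators \<open>F i\<close> covers all of
      \<open>I\<close>.\<close>
    define W where "W = cl ` {p. inS p \<and> meval to_ac ?z p = 0}"
    have W_iff: "cl p \<in> W \<longleftrightarrow> meval to_ac ?z p = 0" if p: "inS p" for p
    proof
      assume "cl p \<in> W"
      then obtain q where q: "inS q" "meval to_ac ?z q = 0" "cl p = cl q" by (auto simp: W_def)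
      then have "p - q \<in> IX" using cl_eq_iff[OF p q(1)] by simp
      from IX0[OF this] q(2) show "meval to_ac ?z p = 0"
        using to_ac.meval_add[of ?z "p - q" q] by simp
    qed (use p in \<open>auto simp: W_def\<close>)
    have W: "ideal W R"
    proof (rule ideal_if_closed[OF cring_R])
      show "W \<subseteq> carrier R" using cl_carrier by (auto simp: W_def)
      show "\<zero>\<^bsub>R\<^esub> \<in> W" unfolding cl_0[symmetric] by (subst W_iff) auto
      show "x \<oplus>\<^bsub>R\<^esub> y \<in> W" if xy: "x \<in> W" "y \<in> W" for x y
      proof -
        from xy obtain p q where pq: "inS p" "inS q" "x = cl p" "y = cl q"
          "meval to_ac ?z p = 0" "meval to_ac ?z q = 0" by (auto simp: W_def)
        then show ?thesis
          using W_iff[OF mvars_add[OF pq(1,2)]] by (simp add: cl_add[symmetric] to_ac.meval_add)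
      qed
      show "w \<otimes>\<^bsub>R\<^esub> x \<in> W" if xw: "x \<in> W" "w \<in> carrier R" for x w
      proof -
        from xw(1) obtain p where p: "inS p" "x = cl p" "meval to_ac ?z p = 0" by (auto simp: W_def)
        from xw(2) obtain v where v: "inS v" "w = cl v" by (rule carrier_R_E)
        from p v show ?thesis
          using W_iff[OF mvars_mult[OF v(1) p(1)]] by (simp add: cl_mult[symmetric] to_ac.meval_mult)
      qed
    qed
    have "I \<subseteq> W"
    proof (rule I_minimal[OF W])
      fix i assume i: "i \<in> {1..s}"
      have "F i \<in> \<Union>I" using F_mvars[OF i] cl_F[OF i] UI_iff by blast
      then have "meval to_ac ?z (F i) = 0" using F i by (intro van_cl) auto
      then show "cl (F i) \<in> W" using W_iff[OF F_mvars[OF i]] by simp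
    qed
    then have UI: "meval to_ac ?z p = 0" if "p \<in> \<Union>I" for p
      using that W_iff UI_iff by blast
    define V where "V = {G. inS G \<and> meval id ?z G = 0}"
    have "ideal V (poly_ring_upto l)"
      by (rule poly_ring_idealI)
        (simp_all add: V_def mvars_add mvars_mult id.meval_add id.meval_mult)
    moreover have "G \<in> V" if "G \<in> homog_polys l" "G \<in> J" for G
    proof -
      from that(1) obtain a where a: "G \<in> hpolys l a" by (rule homog_polysE)
      from van'[OF that(2) a] a show ?thesis by (simp add: V_def hpolys_def)
    qed
    moreover have "acmap p \<in> V" if "p \<in> \<Union>I" for p
      using UI[OF that] UI_mvars[OF that]
      by (simp add: V_def meval_acmap mvars_map)
    ultimately have "J \<subseteq> V" by (rule J_minimal)
    with G show ?thesis by (auto simp: V_def)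
  qed
  moreover have "proj_pt z \<in> proj_space l" using z by (auto simp: proj_space_def)
  ultimately show ?thesis
    by (auto simp: scheme_points_def zero_locus_def vanishes_def mem_proj_pt_iff)
qed

lemma scheme_pointsD:
  assumes "Z \<in> pts" "z \<in> Z"
  shows "Z = proj_pt z" "\<exists>i\<le>l. z i \<noteq> 0" "G \<in> J \<Longrightarrow> meval id z G = 0"
proof -
  from assms(1) have Z: "Z \<in> proj_space l" "\<forall>G\<in>J. vanishes G Z"
    by (auto simp: scheme_points_def zero_locus_def)
  then obtain z0 where z0: "Z = proj_pt z0" "\<exists>i\<le>l. z0 i \<noteq> 0" by (auto simp: proj_space_def)
  show "Z = proj_pt z" using proj_pt_eqI assms(2) z0(1) by blast
  obtain c where "c \<noteq> 0" "z = (\<lambda>i. c * z0 i)" using assms(2) z0(1) by (auto simp: mem_proj_pt_iff)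
  with z0(2) show "\<exists>i\<le>l. z i \<noteq> 0" by auto
  show "G \<in> J \<Longrightarrow> meval id z G = 0" using Z(2) assms(2) by (auto simp: vanishes_def)
qed

lemma scheme_points_nonempty: "Z \<in> pts \<Longrightarrow> \<exists>z. z \<in> Z"
  using proj_pt_self by (auto simp: scheme_points_def zero_locus_def proj_space_def)

lemma coord_val_cl:
  assumes p: "inS p" and Z: "Z \<in> pts" "z \<in> Z"
  shows "coord_val (cl p) z = meval to_ac z p"
proof -
  have "meval to_ac z q = meval to_ac z p" if "q \<in> cl p" for q
  proof -
    have "q - p \<in> IX" using that mem_cl_iff[OF p] cl_eq_iff[OF _ p] by blast
    then have "acmap (q - p) \<in> J" by (intro acmap_J IX_subset_Union[OF ideal_I])
    then have "meval to_ac z (q - p) = 0" using scheme_pointsD(3)[OF Z] meval_acmap by metis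
    then show ?thesis using to_ac.meval_add[of z "q - p" p] by simp
  qed
  moreover have "p \<in> cl p" using p by (simp add: mem_cl_iff)
  ultimately have "meval to_ac z ` cl p = {meval to_ac z p}" by blast
  then show ?thesis by (simp add: coord_val_def)
qed

text \<open>The forms \<open>G ^ (e * j) * H ^ (a * (D - j))\<close>, \<open>j \<le> D\<close>, are dependent modulo \<open>J\<close> for large \<open>D\<close>,
  because \<open>J + (H)\<close> is irrelevant.  Factoring the lowest power of \<open>G\<close> out of a relation leaves a
  cofactor that vanishes at no point of the scheme, so \<open>G\<close> is nilpotent in all local rings.\<close>

lemma vanishing_imp_saturated:
  fixes G H :: "'k alg_closure mpoly"
  assumes reduced: "reduced_scheme l \<phi> I"
    and H: "H \<in> hpolys l e" "e > 0" "\<And>Z z. Z \<in> pts \<Longrightarrow> z \<in> Z \<Longrightarrow> meval id z H \<noteq> 0"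
    and G: "G \<in> hpolys l a" "\<And>Z z. Z \<in> pts \<Longrightarrow> z \<in> Z \<Longrightarrow> meval id z G = 0"
  obtains m where "\<And>w. w \<in> hpolys l m \<Longrightarrow> w * G \<in> J"
proof -
  define P where "P a = J \<inter> hpolys l a" for a
  have P: "gideal l P" unfolding P_def by (rule gideal_ideal[OF ideal_J])
  \<comment> \<open>A projective zero of \<open>J + (H)\<close> would be a point of the scheme at
    which \<open>H\<close> vanishes.\<close>
  have "\<not> relevant l (gplus l P e H)"
  proof
    assume "relevant l (gplus l P e H)"
    then obtain z where z: "\<exists>i\<le>l. z i \<noteq> 0" "\<And>i. i > l \<Longrightarrow> z i = 0"
      "\<And>a p. p \<in> gplus l P e H a \<Longrightarrow> meval id z p = 0"
      using projective_nullstellensatz[OF gideal_gplus[OF P H(1)]] by metis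
    have "proj_pt z \<in> pts"
      by (rule scheme_pointsI[OF z(1,2)]) (auto simp: P_def intro!: z(3) gplus_mono)
    then show False using H(3)[OF _ proj_pt_self] z(3)[OF gplus_gen[OF P]] by blast
  qed
  then obtain m0 where m0: "hpolys l m0 \<subseteq> gplus l P e H m0" by (auto simp: relevant_def)
  obtain D :: nat where D: "\<forall>a. spanned l P D a"
    by (rule gideal_bounded[OF P H(1,2) m0])
  \<comment> \<open>\<open>G\<close> has degree \<open>a\<close> and \<open>H\<close> has degree
    \<open>e\<close>; the weights in the exponents bring all the products to one degree.\<close>
  have GH: "G ^ (e * i) * H ^ (a * j) \<in> hpolys l (a * e * (i + j))" for i j
    using hpolys_mult[OF hpolys_power[OF G(1), of "e * i"] hpolys_power[OF H(1), of "a * j"]]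
    by (simp add: algebra_simps)
  obtain g where g: "\<forall>p\<in>hpolys l (a * e * D). \<exists>c. p - (\<Sum>i<D. mconst (c i) * g i) \<in> P (a * e * D)"
    using D by blast
  have u: "G ^ (e * j) * H ^ (a * (D - j)) \<in> hpolys l (a * e * D)" if "j \<le> D" for j
    using GH[of j "D - j"] that by simp
  obtain c where c: "\<exists>j\<le>D. c j \<noteq> 0" "(\<Sum>j\<le>D. mconst (c j) * (G ^ (e * j) * H ^ (a * (D - j)))) \<in> P (a * e * D)"
    by (rule gideal_dependence[OF P g, where u = "\<lambda>j. G ^ (e * j) * H ^ (a * (D - j))"]) (rule u)
  define k where "k = (LEAST j. c j \<noteq> 0)"
  have k: "c k \<noteq> 0" "k \<le> D" "\<And>j. j < k \<Longrightarrow> c j = 0"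
  proof -
    show "c k \<noteq> 0" using c(1) unfolding k_def by (metis (mono_tags, lifting) LeastI)
    show "k \<le> D" using c(1) Least_le[of "\<lambda>j. c j \<noteq> 0"] unfolding k_def by (meson le_trans)
    show "c j = 0" if "j < k" for j using not_less_Least[of j "\<lambda>j. c j \<noteq> 0"] that unfolding k_def by blast
  qed
  define w where "w = (\<Sum>j\<in>{k..D}. mconst (c j) * (G ^ (e * (j - k)) * H ^ (a * (D - j))))"
  have w: "w \<in> hpolys l (a * e * (D - k))"
    unfolding w_def
  proof (rule hpolys_sum)
    fix j assume "j \<in> {k..D}"
    then have "j - k + (D - j) = D - k" by auto
    with GH[of "j - k" "D - j"] show "mconst (c j) * (G ^ (e * (j - k)) * H ^ (a * (D - j))) \<in> hpolys l (a * e * (D - k))"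
      by (intro hpolys_mconst_mult) simp
  qed
  have wG: "w * G ^ (e * k) \<in> J"
  proof -
    have "(\<Sum>j\<le>D. mconst (c j) * (G ^ (e * j) * H ^ (a * (D - j)))) =
        (\<Sum>j\<in>{k..D}. mconst (c j) * (G ^ (e * j) * H ^ (a * (D - j))))"
      using k(3) by (intro sum.mono_neutral_right) force+
    also have "\<dots> = w * G ^ (e * k)"
      unfolding w_def sum_distrib_right
    proof (rule sum.cong)
      fix j assume "j \<in> {k..D}"
      then have "e * j = e * (j - k) + e * k" by (simp add: algebra_simps)
      then have "G ^ (e * j) = G ^ (e * (j - k)) * G ^ (e * k)" by (simp only: power_add)
      then show "mconst (c j) * (G ^ (e * j) * H ^ (a * (D - j))) =
          mconst (c j) * (G ^ (e * (j - k)) * H ^ (a * (D - j))) * G ^ (e * k)" by simp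
    qed simp
    finally show ?thesis using c(2) by (simp add: P_def)
  qed
  have w_nz: "meval id z w \<noteq> 0" if "Z \<in> pts" "z \<in> Z" for Z z
  proof -
    have "meval id z w = (\<Sum>j\<in>{k..D}. c j * (meval id z G ^ (e * (j - k)) * meval id z H ^ (a * (D - j))))"
      by (simp add: w_def id.meval_sum id.meval_mult id.meval_power)
    \<comment> \<open>Here \<open>G\<close> vanishes and \<open>e > 0\<close>, so only the term with
      exponent zero, \<open>j = k\<close>, survives.\<close>
    also have "\<dots> = (\<Sum>j\<in>{k..D}. if j = k then c k * meval id z H ^ (a * (D - k)) else 0)"
      using G(2)[OF that] H(2) by (intro sum.cong) auto
    also have "\<dots> \<noteq> 0" using k H(3)[OF that] by (simp add: sum.delta)
    finally show ?thesis .
  qed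
  have local_zero: "\<exists>w\<in>homog_polys l. \<not> vanishes w Z \<and> w * G \<in> J" if Z: "Z \<in> pts" for Z
  proof -
    obtain z where z: "z \<in> Z" using scheme_points_nonempty[OF Z] by blast
    obtain i where i: "i \<le> l" "z i \<noteq> 0" using scheme_pointsD(2)[OF Z z] by blast
    \<comment> \<open>This power is a denominator of degree \<open>a\<close> that does not vanish at
      the point, as \<open>reduced_at\<close> asks for.\<close>
    have "mvar i ^ a \<in> hpolys l a" using hpolys_power[of "mvar i" l 1 a] i(1) by simp
    moreover have "\<not> vanishes (mvar i ^ a) Z"
      using z i(2) by (auto simp: vanishes_def id.meval_power intro!: bexI[of _ z])
    moreover have "frac_zero l J Z (G ^ (e * k))"
      unfolding frac_zero_def using w wG w_nz[OF Z z] z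
      by (auto simp: vanishes_def intro!: bexI[of _ w] hpolys_homog)
    ultimately have "frac_zero l J Z G"
      using reduced Z G(1) unfolding reduced_scheme_def reduced_at_def
      by (metis (no_types, lifting) hpolys_homog hpolys_def mem_Collect_eq)
    then show ?thesis by (simp add: frac_zero_def)
  qed
  \<comment> \<open>The colon ideal of \<open>J\<close> by \<open>G\<close>. It contains the forms
    of \<open>J\<close>, so its zeros are points of the scheme; at each of them some element of it
    is nonzero, hence it has no zeros and is irrelevant.\<close>
  define Q where "Q b = {w \<in> hpolys l b. w * G \<in> J}" for b
  have Q: "gideal l Q"
    unfolding gideal_def Q_def using poly_ideal_0[OF ideal_J] poly_ideal_add[OF ideal_J] poly_ideal_mult[OF ideal_J]
    by (auto simp: distrib_right mult.assoc intro!: hpolys_add hpolys_mult) (auto simp: hpolys_def)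
  have "\<not> relevant l Q"
  proof
    assume "relevant l Q"
    then obtain z where z: "\<exists>i\<le>l. z i \<noteq> 0" "\<And>i. i > l \<Longrightarrow> z i = 0"
      "\<And>a p. p \<in> Q a \<Longrightarrow> meval id z p = 0"
      using projective_nullstellensatz[OF Q] by metis
    have "proj_pt z \<in> pts"
    proof (rule scheme_pointsI[OF z(1,2)])
      fix a p assume "p \<in> J" "p \<in> hpolys l a"
      then show "meval id z p = 0"
        using G(1) poly_ideal_mult[OF ideal_J, of p G]
        by (intro z(3)[of p a]) (auto simp: Q_def hpolys_def mult.commute)
    qed
    from local_zero[OF this] obtain v where v: "v \<in> homog_polys l" "\<not> vanishes v (proj_pt z)" "v * G \<in> J" by blast
    from v(1) obtain b where b: "v \<in> hpolys l b" by (rule homog_polysE)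
    with v z(3)[of v b] show False by (simp add: Q_def vanishes_proj_pt[OF b])
  qed
  then obtain m where "hpolys l m \<subseteq> Q m" by (auto simp: relevant_def)
  then show ?thesis by (intro that[of m]) (auto simp: Q_def)
qed

lemma coord_deg_nonneg: "d \<ge> 0 \<Longrightarrow> Rdeg d = cl ` hpolys l (nat d)"
  by (auto simp: coord_deg_def hpolys_def)

text \<open>The degree \<open>m\<close> that saturates \<open>G\<close> over the closure works for
  its image over \<open>K\<close>, because the functional commutes with multiplication by forms over
  \<open>K\<close>. Regularity in degree \<open>a\<close> then turns saturation into membership in
  \<open>I\<close>.\<close>

lemma kmap_vanishing_mem:
  fixes G H :: "'k alg_closure mpoly"
  assumes reduced: "reduced_scheme l \<phi> I"
    and H: "H \<in> hpolys l e" "e > 0" "\<And>Z z. Z \<in> pts \<Longrightarrow> z \<in> Z \<Longrightarrow> meval id z H \<noteq> 0"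
    and G: "G \<in> hpolys l a" "\<And>Z z. Z \<in> pts \<Longrightarrow> z \<in> Z \<Longrightarrow> meval id z G = 0"
    and reg: "int a \<in> Reg n l \<phi> \<delta> I" and f: "klinear f"
  shows "cl (cmap f G) \<in> I"
proof -
  let ?g = "cmap f G"
  obtain m where m: "\<And>w. w \<in> hpolys l m \<Longrightarrow> w * G \<in> J"
    by (rule vanishing_imp_saturated[OF reduced H(1,2) _ G(1)]) (use H(3) G(2) in blast)+
  have g: "?g \<in> hpolys l a" using G(1) klinear_0[OF f] by (simp add: hpolys_map)
  then have mv: "mvars ?g \<subseteq> {0..l}" by (simp add: hpolys_def)
  have "cl w \<otimes>\<^bsub>R\<^esub> cl ?g \<in> I" if w: "w \<in> hpolys l m" for w
  proof -
    have "acmap w * G \<in> J" using w by (intro m) (simp add: hpolys_map)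
    then have "cmap f (acmap w * G) \<in> \<Union>I" by (rule kmap_scheme_ideal[OF ideal_I f])
    then have "cl (w * ?g) \<in> I" unfolding kmap_mult[OF f] UI_iff by blast
    then show ?thesis using w mv by (simp add: cl_mult hpolys_def)
  qed
  then have "cl ?g \<in> saturation n l \<phi> I"
    unfolding saturation_def using cl_carrier[OF mv] by (auto simp: coord_deg_nonneg intro!: exI[of _ m])
  moreover have "cl ?g \<in> Rdeg (int a)" using g by (simp add: coord_deg_nonneg)
  ultimately show ?thesis using reg by (auto simp: Reg_def)
qed

end

section \<open>The Khovanskii basis\<close>

lemma alg_gen_prod_list: "(\<And>x. x \<in> set xs \<Longrightarrow> f x \<in> alg_gen A) \<Longrightarrow> (\<Prod>x\<leftarrow>xs. f x) \<in> alg_gen A"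
  using alg_gen.const[of 1 A] by (induction xs) (auto intro: alg_gen.mult)

lemma alg_gen_power: "f \<in> alg_gen A \<Longrightarrow> f ^ k \<in> alg_gen A"
  using alg_gen.const[of 1 A] by (induction k) (auto intro: alg_gen.mult)

lemma alg_gen_prod: "(\<And>x. x \<in> B \<Longrightarrow> f x \<in> alg_gen A) \<Longrightarrow> (\<Prod>x\<in>B. f x) \<in> alg_gen A"
  using alg_gen.const[of 1 A] by (induction B rule: infinite_finite_induct) (auto intro: alg_gen.mult)

section \<open>Leading exponents\<close>

locale monomial_ordered =
  fixes n :: nat and r :: "(expo \<times> expo) set"
  assumes order: "monomial_order n r"
begin

abbreviation "E \<equiv> {m :: expo. keys m \<subseteq> {0..n}}"

lemma r_well_order: "well_order_on E r"
  using order by (simp add: monomial_order_def)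

lemma r_refl: "a \<in> E \<Longrightarrow> (a, a) \<in> r"
  and r_trans: "(a, b) \<in> r \<Longrightarrow> (b, c) \<in> r \<Longrightarrow> (a, c) \<in> r"
  and r_antisym: "(a, b) \<in> r \<Longrightarrow> (b, a) \<in> r \<Longrightarrow> a = b"
  and r_total: "a \<in> E \<Longrightarrow> b \<in> E \<Longrightarrow> (a, b) \<in> r \<or> (b, a) \<in> r"
  and r_wf: "wf (r - Id)"
  using r_well_order unfolding well_order_on_def linear_order_on_def partial_order_on_def preorder_on_def
  by (auto dest: refl_onD transD antisymD simp: total_on_def) (metis refl_onD mem_Collect_eq)

lemma r_add: "(a, b) \<in> r \<Longrightarrow> keys c \<subseteq> {0..n} \<Longrightarrow> (a + c, b + c) \<in> r"
  using order by (simp add: monomial_order_def)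

lemma finite_has_max:
  assumes "finite A" "A \<noteq> {}" "A \<subseteq> E"
  shows "\<exists>m\<in>A. \<forall>m'\<in>A. (m', m) \<in> r"
  using assms
proof (induction A rule: finite_ne_induct)
  case (singleton x)
  then show ?case using r_refl by auto
next
  case (insert x A)
  then obtain m where m: "m \<in> A" "\<forall>m'\<in>A. (m', m) \<in> r" by auto
  with insert.prems have "(x, m) \<in> r \<or> (m, x) \<in> r" "(x, x) \<in> r" using r_total r_refl by blast+
  with m show ?case using r_trans by blast
qed

definition is_lead :: "expo \<Rightarrow> 'k::field mpoly \<Rightarrow> bool" where
  "is_lead m p \<longleftrightarrow> m \<in> keys p \<and> (\<forall>m'\<in>keys p. (m', m) \<in> r)"

lemma is_lead_unique: "is_lead m p \<Longrightarrow> is_lead m' p \<Longrightarrow> m = m'"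
  by (auto simp: is_lead_def intro: r_antisym)

lemma lead_expo_eq: "is_lead m p \<Longrightarrow> lead_expo r p = m"
  unfolding lead_expo_def is_lead_def[symmetric] using is_lead_unique by blast

lemma is_lead_exists:
  assumes "p \<noteq> 0" "mvars p \<subseteq> {0..n}"
  obtains m where "is_lead m p"
  using finite_has_max[of "keys p"] assms that by (auto simp: is_lead_def mvars_subset_iff)

lemma is_lead_1: "is_lead 0 (1 :: 'k::field mpoly)"
  using r_refl[of 0] by (simp add: is_lead_def)

text \<open>The order is invariant under translation, so \<open>a + b\<close> is the greatest
  possible exponent of the product and arises from the pair \<open>(a, b)\<close> alone. Its
  coefficient is the product of two nonzero elements of a field.\<close>

lemma is_lead_mult:
  fixes p q :: "'k::field mpoly"
  assumes a: "is_lead a p" and b: "is_lead b q" and p: "mvars p \<subseteq> {0..n}" and q: "mvars q \<subseteq> {0..n}"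
  shows "is_lead (a + b) (p * q)"
proof -
  have le: "(x + y, a + b) \<in> r" and eq: "x + y = a + b \<Longrightarrow> x = a \<and> y = b"
    if "x \<in> keys p" "y \<in> keys q" for x y
  proof -
    have "(x, a) \<in> r" "(y, b) \<in> r" "keys y \<subseteq> {0..n}" "keys a \<subseteq> {0..n}"
      using that a b p q by (auto simp: is_lead_def mvars_subset_iff)
    then have *: "(x + y, a + y) \<in> r" "(a + y, a + b) \<in> r"
      using r_add[of x a y] r_add[of y b a] by (simp_all add: add.commute)
    then show "(x + y, a + b) \<in> r" by (rule r_trans)
    assume xy: "x + y = a + b"
    with * have "a + y = a + b" using r_antisym by metis
    with xy show "x = a \<and> y = b" by simp
  qed
  define p' q' where "p' = p - single a (lookup p a)" and "q' = q - single b (lookup q b)"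
  have p': "p = single a (lookup p a) + p'" and q': "q = single b (lookup q b) + q'"
    by (simp_all add: p'_def q'_def)
  have keys': "keys p' \<subseteq> keys p - {a}" "keys q' \<subseteq> keys q - {b}"
    by (auto simp: p'_def q'_def in_keys_iff lookup_minus lookup_single when_def split: if_splits)
  have "p * q = single a (lookup p a) * single b (lookup q b) + (single a (lookup p a) * q' + p' * q)"
    by (subst (1) p', subst (1) q') (simp add: algebra_simps q'_def)
  then have "lookup (p * q) (a + b) = lookup p a * lookup q b +
      lookup (single a (lookup p a) * q') (a + b) + lookup (p' * q) (a + b)"
    by (simp add: lookup_add mult_single)
  moreover have "a + b \<notin> keys (single a (lookup p a) * q')"
  proof
    assume "a + b \<in> keys (single a (lookup p a) * q')"
    then obtain x y where "a + b = x + y" "x \<in> keys (single a (lookup p a))" "y \<in> keys q'"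
      using keys_mult[of "single a (lookup p a)" q'] by blast
    then have "y = b" "y \<in> keys q'" by (auto split: if_splits)
    with keys'(2) show False by blast
  qed
  moreover have "a + b \<notin> keys (p' * q)"
    using keys_mult[of p' q] keys'(1) eq by fastforce
  ultimately have "lookup (p * q) (a + b) = lookup p a * lookup q b" by (simp add: in_keys_iff)
  then have "a + b \<in> keys (p * q)" using a b by (simp add: is_lead_def in_keys_iff)
  moreover have "(m, a + b) \<in> r" if "m \<in> keys (p * q)" for m
    using keys_mult[of p q] that le by blast
  ultimately show ?thesis by (simp add: is_lead_def)
qed

end

locale khovanskii = parametrisation n l \<phi> + monomial_ordered n r
  for n l and \<phi> :: "nat \<Rightarrow> 'k::field mpoly" and r +
  fixes idx :: "int \<Rightarrow> expo \<Rightarrow> nat list"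
  assumes khovanskii: "khovanskii_basis r (gen_family l \<phi>)"
    and idx: "index_choice r l \<phi> idx"
begin

abbreviation "\<psi> i \<equiv> mvar 0 * \<phi> i"
abbreviation "\<alpha> i \<equiv> lead_expo r (\<psi> i)"
abbreviation "\<D> \<equiv> dA r l \<phi>"
abbreviation "KF \<equiv> alg_gen (gen_family l \<phi>)"
abbreviation "coo \<equiv> coords n l \<phi> r idx"

lemma psi_mvars: "i \<le> l \<Longrightarrow> mvars (\<psi> i) \<subseteq> {0..n}"
  using phi by (intro mvars_mult) force+

lemma psi_lead: "i \<le> l \<Longrightarrow> is_lead (\<alpha> i) (\<psi> i)"
proof -
  assume i: "i \<le> l"
  have "lookup (mvar 0 :: 'k mpoly) (single 0 1) = 1" by (simp add: mvar_def)
  then have "(mvar 0 :: 'k mpoly) \<noteq> 0" by force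
  then have "\<psi> i \<noteq> 0" using phi i by simp
  then obtain m where "is_lead m (\<psi> i)" using is_lead_exists psi_mvars[OF i] by blast
  then show ?thesis using lead_expo_eq by metis
qed

lemma alpha_0: "i \<le> l \<Longrightarrow> lookup (\<alpha> i) 0 = 1"
  using psi_lead tdeg_gen by (auto simp: is_lead_def tdeg_def)

lemma prod_psi_mvars: "set js \<subseteq> {0..l} \<Longrightarrow> mvars (\<Prod>i\<leftarrow>js. \<psi> i) \<subseteq> {0..n}"
  by (rule mvars_prod_list) (use psi_mvars in force)

lemma prod_psi_lead: "set js \<subseteq> {0..l} \<Longrightarrow> is_lead (\<Sum>i\<leftarrow>js. \<alpha> i) (\<Prod>i\<leftarrow>js. \<psi> i)"
proof (induction js)
  case (Cons i js)
  then show ?case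
    using is_lead_mult[OF psi_lead[of i] Cons.IH psi_mvars[of i] prod_psi_mvars[of js]] by simp
qed (simp add: is_lead_1)

lemma prod_psi_tdeg: "set js \<subseteq> {0..l} \<Longrightarrow> tdeg (length js) (\<Prod>i\<leftarrow>js. \<psi> i)"
proof (induction js)
  case Nil
  then show ?case using tdeg_mconst[of 1] by simp
next
  case (Cons i js)
  then show ?case using tdeg_mult[OF tdeg_gen[of i] Cons.IH] by simp
qed

lemma sum_alpha_0: "set js \<subseteq> {0..l} \<Longrightarrow> lookup (\<Sum>i\<leftarrow>js. \<alpha> i) 0 = length js"
  by (induction js) (simp_all add: lookup_add alpha_0)

lemma idx_D:
  assumes "\<beta> \<in> \<D> d"
  shows "length (idx d \<beta>) = nat d" "set (idx d \<beta>) \<subseteq> {0..l}" "(\<Sum>i\<leftarrow>idx d \<beta>. \<alpha> i) = \<beta>"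
  using idx assms by (auto simp: index_choice_def)

lemma finite_dA: "finite (\<D> d)"
proof -
  have "\<D> d \<subseteq> (\<lambda>js. \<Sum>i\<leftarrow>js. \<alpha> i) ` {js. set js \<subseteq> {0..l} \<and> length js = nat d}"
    by (auto simp: dA_def split: if_splits)
  then show ?thesis by (rule finite_subset) (intro finite_imageI finite_lists_length_eq; simp)
qed

text \<open>On \<open>dA\<close> this is \<open>basis_poly\<close> with the power of the variable
  \<open>0\<close> distributed over the factors; as a product of generators it has the sum of their
  leading exponents as its own.\<close>

definition bas :: "int \<Rightarrow> expo \<Rightarrow> 'k mpoly" where
  "bas d \<beta> = (\<Prod>i\<leftarrow>idx d \<beta>. \<psi> i)"

abbreviation "bsum d c \<equiv> (\<Sum>\<beta>\<in>\<D> d. mconst (c \<beta>) * bas d \<beta>)"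

lemma basis_mono_hpolys:
  assumes "\<beta> \<in> \<D> d"
  shows "(basis_mono idx d \<beta> :: 'k mpoly) \<in> hpolys l (nat d)"
proof -
  have "mhomog (length (idx d \<beta>)) (\<Prod>i\<leftarrow>idx d \<beta>. mvar i :: 'k mpoly)" by (rule mhomog_prod_list) simp
  moreover have "inS (\<Prod>i\<leftarrow>idx d \<beta>. mvar i :: 'k mpoly)"
    using idx_D(2)[OF assms] by (intro mvars_prod_list) auto
  ultimately show ?thesis using idx_D(1)[OF assms] by (simp add: basis_mono_def hpolys_def)
qed

lemma param_map_basis_mono: "pmap (basis_mono idx d \<beta>) = bas d \<beta>"
  unfolding basis_mono_def bas_def param_map_def by (simp add: mconst.meval_prod_list)

lemma basis_poly_eq: "\<beta> \<in> \<D> d \<Longrightarrow> basis_poly \<phi> idx d \<beta> = bas d \<beta>"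
proof -
  have "(\<Prod>i\<leftarrow>js. \<psi> i) = mvar 0 ^ length js * (\<Prod>i\<leftarrow>js. \<phi> i)" for js
    by (induction js) (simp_all add: mult_ac)
  then show "\<beta> \<in> \<D> d \<Longrightarrow> basis_poly \<phi> idx d \<beta> = bas d \<beta>"
    using idx_D(1)[of \<beta> d] by (simp add: basis_poly_def bas_def)
qed

lemma bas_lead: "\<beta> \<in> \<D> d \<Longrightarrow> is_lead \<beta> (bas d \<beta>)"
  using prod_psi_lead[OF idx_D(2)] idx_D(3) by (simp add: bas_def)

lemma bas_tdeg: "\<beta> \<in> \<D> d \<Longrightarrow> tdeg (nat d) (bas d \<beta>)"
  using prod_psi_tdeg[OF idx_D(2)] idx_D(1) by (simp add: bas_def)

lemma psi_alg_gen: "i \<le> l \<Longrightarrow> \<psi> i \<in> KF"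
  unfolding gen_family_def by (intro alg_gen.gen imageI) simp

lemma bas_alg_gen: "\<beta> \<in> \<D> d \<Longrightarrow> bas d \<beta> \<in> KF"
  unfolding bas_def using idx_D(2) psi_alg_gen by (intro alg_gen_prod_list) force

lemma alg_gen_mvars: "f \<in> KF \<Longrightarrow> mvars f \<subseteq> {0..n}"
proof (induction rule: alg_gen.induct)
  case (gen p)
  then show ?case using psi_mvars by (force simp: gen_family_def)
qed (simp_all add: mvars_add mvars_mult)

lemma lead_alg_gen_keys:
  "f \<in> alg_gen (lead_term r ` gen_family l \<phi>) \<Longrightarrow> m \<in> keys f \<Longrightarrow>
    \<exists>js. set js \<subseteq> {0..l} \<and> m = (\<Sum>i\<leftarrow>js. \<alpha> i)"
proof (induction arbitrary: m rule: alg_gen.induct)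
  case (gen p)
  then obtain i where "i \<le> l" "p = lead_term r (\<psi> i)" by (auto simp: gen_family_def)
  with gen show ?case by (intro exI[of _ "[i]"]) (auto simp: lead_term_def split: if_splits)
next
  case (const c)
  then show ?case by (intro exI[of _ "[]"]) (auto simp: mconst_def split: if_splits)
next
  case (add p q)
  then show ?case using keys_add[of p q] by blast
next
  case (mult p q)
  then obtain a b where ab: "m = a + b" "a \<in> keys p" "b \<in> keys q" using keys_mult[of p q] by blast
  with mult.IH obtain js ks where "set js \<subseteq> {0..l}" "a = (\<Sum>i\<leftarrow>js. \<alpha> i)" "set ks \<subseteq> {0..l}" "b = (\<Sum>i\<leftarrow>ks. \<alpha> i)"
    by metis
  with ab show ?case by (intro exI[of _ "js @ ks"]) simp
qed

text \<open>By the Khovanskii property the leading exponent is a sum of leading exponents \<alpha>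
  i. Each of them has entry 1 at index \<open>0\<close>, so the degree in that variable counts the
  summands.\<close>

lemma lead_mem_dA:
  assumes f: "f \<in> KF" and d: "d \<ge> 0" "tdeg (nat d) f" and m: "is_lead m f"
  shows "m \<in> \<D> d"
proof -
  have "f \<noteq> 0" using m by (auto simp: is_lead_def)
  then have "lead_term r f \<in> alg_gen (lead_term r ` gen_family l \<phi>)"
    using khovanskii f by (auto simp: khovanskii_basis_def intro: alg_gen.gen)
  moreover have "m \<in> keys (lead_term r f)"
    using m by (simp add: lead_term_def lead_expo_eq[OF m] is_lead_def in_keys_iff)
  ultimately obtain js where js: "set js \<subseteq> {0..l}" "m = (\<Sum>i\<leftarrow>js. \<alpha> i)"
    using lead_alg_gen_keys by blast
  have "length js = nat d" using sum_alpha_0[OF js(1)] js(2) m d(2) by (simp add: is_lead_def tdeg_def)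
  with js d(1) show ?thesis by (auto simp: dA_def)
qed

text \<open>Some basis element has the same leading exponent as \<open>f\<close>. Subtracting a
  multiple of it lowers the leading exponent, and this stops because a monomial order is
  well-founded.\<close>

lemma subduction:
  assumes d: "d \<ge> 0"
  shows "f \<in> KF \<Longrightarrow> tdeg (nat d) f \<Longrightarrow> is_lead m f \<Longrightarrow>
    \<exists>c. f = bsum d c"
proof (induction m arbitrary: f rule: wf_induct_rule[OF r_wf])
  case (1 m)
  have m: "m \<in> \<D> d" using lead_mem_dA[OF "1.prems"(1) d "1.prems"(2,3)] .
  note lead = bas_lead[OF m]
  \<comment> \<open>A quotient, because the leading coefficients of the \<phi> i are not
    normalised.\<close>
  define k where "k = lookup f m / lookup (bas d m) m"
  define g where "g = f + mconst (- k) * bas d m"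
  have lookup_g: "lookup g x = lookup f x - k * lookup (bas d m) x" for x
    by (simp add: g_def lookup_add lookup_mconst_mult)
  have g_m: "lookup g m = 0"
    using lead by (simp add: lookup_g k_def is_lead_def in_keys_iff)
  have g: "g \<in> KF"
    unfolding g_def using "1.prems"(1) bas_alg_gen[OF m] by (intro alg_gen.add alg_gen.mult alg_gen.const)
  have td: "tdeg (nat d) g"
    unfolding g_def using tdeg_mult[OF tdeg_mconst bas_tdeg[OF m], of "- k"] "1.prems"(2) by (simp add: tdeg_add)
  have "\<exists>c. g = bsum d c"
  proof (cases "g = 0")
    case True
    then show ?thesis by (intro exI[of _ "\<lambda>_. 0"]) simp
  next
    case False
    then obtain m' where m': "is_lead m' g" using is_lead_exists alg_gen_mvars[OF g] by blast
    then have "m' \<noteq> m" using g_m by (auto simp: is_lead_def in_keys_iff)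
    moreover have "m' \<in> keys f \<or> m' \<in> keys (bas d m)"
      using m' lookup_g[of m'] by (auto simp: is_lead_def in_keys_iff)
    then have "(m', m) \<in> r" using "1.prems"(3) lead by (auto simp: is_lead_def)
    ultimately have "(m', m) \<in> r - Id" by simp
    from "1.IH"[OF this g td m'] show ?thesis .
  qed
  then obtain c where c: "g = bsum d c" by blast
  have "f = g + mconst k * bas d m" by (simp add: g_def mconst_minus)
  also have "mconst k * bas d m = (\<Sum>\<beta>\<in>\<D> d. if \<beta> = m then mconst k * bas d \<beta> else 0)"
    using m finite_dA by (simp add: sum.delta)
  also have "g + \<dots> = (\<Sum>\<beta>\<in>\<D> d. mconst (c \<beta> + (if \<beta> = m then k else 0)) * bas d \<beta>)"
    unfolding c sum.distrib[symmetric] by (intro sum.cong) (auto simp: mconst_add algebra_simps)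
  finally show ?case by (intro exI[of _ "\<lambda>\<beta>. c \<beta> + (if \<beta> = m then k else 0)"])
qed

text \<open>The leading exponents are pairwise distinct: the greatest index with a nonzero
  coefficient occurs in no other basis element of the relation.\<close>

lemma bas_independent:
  assumes "bsum d c = 0" "\<beta> \<in> \<D> d"
  shows "c \<beta> = 0"
proof (rule ccontr)
  assume "c \<beta> \<noteq> 0"
  define C where "C = {\<beta> \<in> \<D> d. c \<beta> \<noteq> 0}"
  have "\<D> d \<subseteq> E"
  proof
    fix \<beta> assume "\<beta> \<in> \<D> d"
    then have "\<beta> \<in> keys (bas d \<beta>)" "mvars (bas d \<beta>) \<subseteq> {0..n}"
      using bas_lead[of \<beta> d] alg_gen_mvars[OF bas_alg_gen] by (simp_all add: is_lead_def)
    then show "\<beta> \<in> E" unfolding mvars_subset_iff by blast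
  qed
  then have "finite C" "C \<noteq> {}" "C \<subseteq> E" using finite_dA \<open>c \<beta> \<noteq> 0\<close> assms(2) by (auto simp: C_def)
  then obtain m where m: "m \<in> C" "\<forall>m'\<in>C. (m', m) \<in> r" using finite_has_max by blast
  have "lookup (mconst (c \<beta>') * bas d \<beta>') m = (if \<beta>' = m then c m * lookup (bas d m) m else 0)" if "\<beta>' \<in> \<D> d" for \<beta>'
  proof (cases "\<beta>' = m \<or> c \<beta>' = 0")
    case False
    then have "m \<notin> keys (bas d \<beta>')"
      using m(2) bas_lead[OF that] that r_antisym by (auto simp: is_lead_def C_def)
    with False show ?thesis by (simp add: lookup_mconst_mult in_keys_iff)
  qed (auto simp: lookup_mconst_mult)
  then have "lookup (bsum d c) m = c m * lookup (bas d m) m"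
    using m(1) finite_dA by (simp add: lookup_sum sum.delta C_def)
  with assms(1) m(1) bas_lead[of m d] show False by (simp add: is_lead_def C_def in_keys_iff)
qed

section \<open>Coordinates in the graded pieces of the coordinate ring\<close>

definition comb :: "int \<Rightarrow> (expo \<Rightarrow> 'k) \<Rightarrow> 'k mpoly" where
  "comb d c = (\<Sum>\<beta>\<in>\<D> d. mconst (c \<beta>) * basis_mono idx d \<beta>)"

lemma comb_hpolys: "comb d c \<in> hpolys l (nat d)"
  unfolding comb_def by (intro hpolys_sum hpolys_mconst_mult basis_mono_hpolys)

lemma comb_mvars: "inS (comb d c)"
  using comb_hpolys by (simp add: hpolys_def)

lemma param_map_comb: "pmap (comb d c) = bsum d c"
  by (simp add: comb_def param_map_sum param_map_mult param_map_basis_mono)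

lemma comb_add: "comb d (\<lambda>\<beta>. c \<beta> + c' \<beta>) = comb d c + comb d c'"
  by (simp add: comb_def mconst_add distrib_right sum.distrib)

lemma comb_diff: "comb d (\<lambda>\<beta>. c \<beta> - c' \<beta>) = comb d c - comb d c'"
  by (simp add: comb_def mconst_diff left_diff_distrib sum_subtractf)

lemma comb_scale: "comb d (\<lambda>\<beta>. k * c \<beta>) = mconst k * comb d c"
  by (simp add: comb_def mconst_mult sum_distrib_left mult.assoc)

lemma param_map_alg_gen:
  assumes "inS p"
  shows "pmap p \<in> KF"
proof (induction p rule: poly_mapping_sum_induct)
  case zero
  then show ?case using alg_gen.const[of 0] by simp
next
  case (single m)
  have "mon \<psi> m \<in> KF"
    unfolding mon_def using single assms
    by (intro alg_gen_prod alg_gen_power psi_alg_gen) (auto simp: mvars_def)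
  then show ?case
    by (auto simp: param_map_def mconst.meval_single intro: alg_gen.mult alg_gen.const)
qed (simp add: param_map_add alg_gen.add)

lemma cl_comb_exists:
  assumes d: "d \<ge> 0" and p: "p \<in> hpolys l (nat d)"
  obtains c where "\<forall>\<beta>. \<beta> \<notin> \<D> d \<longrightarrow> c \<beta> = 0" "cl p = cl (comb d c)"
proof -
  have mv: "inS p" using p by (simp add: hpolys_def)
  have "\<exists>c. pmap p = bsum d c"
  proof (cases "pmap p = 0")
    case True
    then show ?thesis by (intro exI[of _ "\<lambda>_. 0"]) simp
  next
    case False
    have gen: "pmap p \<in> KF" by (rule param_map_alg_gen[OF mv])
    from False obtain m where "is_lead m (pmap p)" using is_lead_exists alg_gen_mvars[OF gen] by blast
    then show ?thesis by (rule subduction[OF d gen tdeg_param_map[OF p]])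
  qed
  then obtain c where c: "pmap p = bsum d c" by blast
  define c' where "c' \<beta> = (if \<beta> \<in> \<D> d then c \<beta> else 0)" for \<beta>
  have "pmap p = pmap (comb d c')"
    unfolding c param_map_comb by (rule sum.cong) (simp_all add: c'_def)
  then have "p - comb d c' \<in> IX" by (simp add: IX_iff param_map_diff mvars_diff mv comb_mvars)
  then have "cl p = cl (comb d c')" using cl_eq_iff[OF mv comb_mvars] by blast
  then show ?thesis by (intro that[of c']) (simp_all add: c'_def)
qed

lemma cl_comb_inj:
  assumes "cl (comb d c) = cl (comb d c')" "\<And>\<beta>. \<beta> \<notin> \<D> d \<Longrightarrow> c \<beta> = 0" "\<And>\<beta>. \<beta> \<notin> \<D> d \<Longrightarrow> c' \<beta> = 0"
  shows "c = c'"
proof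
  fix \<beta>
  have "comb d c - comb d c' \<in> IX" using assms(1) cl_eq_iff[OF comb_mvars comb_mvars] by blast
  then have "(\<Sum>\<beta>\<in>\<D> d. mconst (c \<beta> - c' \<beta>) * bas d \<beta>) = 0"
    unfolding comb_diff[symmetric] by (simp add: IX_iff param_map_comb)
  from bas_independent[OF this] show "c \<beta> = c' \<beta>" using assms(2,3) by (cases "\<beta> \<in> \<D> d") auto
qed

lemma coords_cl_comb:
  assumes "\<And>\<beta>. \<beta> \<notin> \<D> d \<Longrightarrow> c \<beta> = 0"
  shows "coo d (cl (comb d c)) = c"
  unfolding coords_def comb_def[symmetric]
  by (rule the_equality) (use assms cl_comb_inj[of d] in blast)+

lemma coord_degE:
  assumes "g \<in> Rdeg d"
  obtains c where "\<forall>\<beta>. \<beta> \<notin> \<D> d \<longrightarrow> c \<beta> = 0" "g = cl (comb d c)" "coo d g = c"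
proof -
  have "\<exists>c. (\<forall>\<beta>. \<beta> \<notin> \<D> d \<longrightarrow> c \<beta> = 0) \<and> g = cl (comb d c)"
  proof (cases "d < 0")
    case True
    then have "\<D> d = {}" by (simp add: dA_def)
    then have "comb d (\<lambda>_. 0) = 0" by (simp add: comb_def)
    with True assms show ?thesis by (intro exI[of _ "\<lambda>_. 0"]) (simp add: coord_deg_def cl_0)
  next
    case False
    then obtain p where "p \<in> hpolys l (nat d)" "g = cl p"
      using assms by (auto simp: coord_deg_def hpolys_def)
    with False show ?thesis using cl_comb_exists[of d p] by (metis not_less)
  qed
  then show ?thesis using that coords_cl_comb by metis
qed

lemma coords_add:
  assumes "g \<in> Rdeg d" "g' \<in> Rdeg d"
  shows "coo d (g \<oplus>\<^bsub>R\<^esub> g') \<beta> = coo d g \<beta> + coo d g' \<beta>"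
proof -
  from assms(1) obtain c where c: "\<forall>\<beta>. \<beta> \<notin> \<D> d \<longrightarrow> c \<beta> = 0" "g = cl (comb d c)" "coo d g = c"
    by (rule coord_degE)
  from assms(2) obtain c' where c': "\<forall>\<beta>. \<beta> \<notin> \<D> d \<longrightarrow> c' \<beta> = 0" "g' = cl (comb d c')" "coo d g' = c'"
    by (rule coord_degE)
  have "g \<oplus>\<^bsub>R\<^esub> g' = cl (comb d (\<lambda>\<beta>. c \<beta> + c' \<beta>))"
    unfolding c c' comb_add by (rule cl_add[OF comb_mvars comb_mvars, symmetric])
  then show ?thesis using coords_cl_comb[of d "\<lambda>\<beta>. c \<beta> + c' \<beta>"] c c' by simp
qed

lemma coords_scale:
  assumes "g \<in> Rdeg d"
  shows "coo d (coord_const n l \<phi> k \<otimes>\<^bsub>R\<^esub> g) \<beta> = k * coo d g \<beta>"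
proof -
  from assms obtain c where c: "\<forall>\<beta>. \<beta> \<notin> \<D> d \<longrightarrow> c \<beta> = 0" "g = cl (comb d c)" "coo d g = c"
    by (rule coord_degE)
  have "coord_const n l \<phi> k \<otimes>\<^bsub>R\<^esub> g = cl (comb d (\<lambda>\<beta>. k * c \<beta>))"
    unfolding c comb_scale coord_const_def by (rule cl_mult[symmetric]) (simp_all add: comb_mvars)
  then show ?thesis using coords_cl_comb[of d "\<lambda>\<beta>. k * c \<beta>"] c by simp
qed

end

section \<open>The kernel of the Khovanskii-Macaulay matrix\<close>

locale khovanskii_equations = khovanskii n l \<phi> r idx + equations n l \<phi> s ds F I
  for n l and \<phi> :: "nat \<Rightarrow> 'k::field mpoly" and r idx s ds F I
begin

abbreviation "mrows \<equiv> macaulay_rows r l \<phi> s ds"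

text \<open>The matrix is defined by identities among polynomials in the parameters; the injection
  induced by \<open>param_map\<close> carries them back to the coordinate ring, where a row is the
  coordinate vector of a monomial multiple of some \<open>F i\<close>.\<close>

lemma macaulay_row_mem:
  assumes M: "macaulay_matrix l \<phi> r idx s ds F d M" and \<rho>: "\<rho> \<in> mrows d"
  shows "cl (comb d (M \<rho>)) \<in> I"
proof -
  obtain i \<gamma> where i: "\<rho> = (i, \<gamma>)" "i \<in> {1..s}" "\<gamma> \<in> \<D> (d - int (ds i))"
    using \<rho> by (auto simp: macaulay_rows_def)
  let ?b = "basis_mono idx (d - int (ds i)) \<gamma> :: 'k mpoly"
  have b: "mvars ?b \<subseteq> {0..l}" using basis_mono_hpolys[OF i(3)] by (simp add: hpolys_def)
  \<comment> \<open>Homogeneity of \<open>F i\<close> pulls the variable \<open>0\<close> out of the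
    substitution.\<close>
  have "pmap (F i) = mvar 0 ^ ds i * meval mconst \<phi> (F i)"
    unfolding param_map_def using F i(2) by (intro mconst.meval_scale) (auto simp: hpolys_def)
  then have "pmap (?b * F i) =
      basis_poly \<phi> idx (d - int (ds i)) \<gamma> * (mvar 0 ^ ds i * meval mconst \<phi> (F i))"
    by (simp add: param_map_mult param_map_basis_mono basis_poly_eq[OF i(3)])
  also have "\<dots> = (\<Sum>\<beta>\<in>\<D> d. mconst (M \<rho> \<beta>) * basis_poly \<phi> idx d \<beta>)"
    using M \<rho> i(1) by (auto simp: macaulay_matrix_def)
  also have "\<dots> = pmap (comb d (M \<rho>))"
    unfolding param_map_comb by (rule sum.cong) (simp_all add: basis_poly_eq)
  finally have "comb d (M \<rho>) - ?b * F i \<in> IX"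
    using b F_mvars[OF i(2)] by (simp add: IX_iff param_map_diff mvars_diff mvars_mult comb_mvars)
  then have "cl (comb d (M \<rho>)) = cl (?b * F i)"
    using cl_eq_iff[OF comb_mvars mvars_mult[OF b F_mvars[OF i(2)]]] by blast
  also have "\<dots> = cl ?b \<otimes>\<^bsub>R\<^esub> cl (F i)" by (rule cl_mult[OF b F_mvars[OF i(2)]])
  also have "\<dots> \<in> I" using ideal.I_l_closed[OF ideal_I cl_F[OF i(2)] cl_carrier[OF b]] .
  finally show ?thesis .
qed

text \<open>A vector annihilated by the right kernel of a matrix lies in its row space.\<close>

lemma kernel_map_zero_mem:
  assumes M: "macaulay_matrix l \<phi> r idx s ds F d M"
    and N: "rows_basis \<delta> N (right_kernel (mrows d) (\<D> d) M)"
    and g: "g \<in> Rdeg d" and zero: "kernel_map n l \<phi> r idx \<delta> d N g = 0\<^sub>v \<delta>"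
  shows "g \<in> I"
proof -
  obtain c where c: "\<forall>\<beta>. \<beta> \<notin> \<D> d \<longrightarrow> c \<beta> = 0" "g = cl (comb d c)" "coo d g = c"
    using g by (rule coord_degE)
  interpret vector_space "\<lambda>a (p :: 'k mpoly). mconst a * p"
    by unfold_locales (auto simp: algebra_simps mconst_add mconst_mult)
  \<comment> \<open>Coordinate vectors are coded as polynomials to have a vector space at hand; the
    exponents serve as mere index set.\<close>
  define vecp where "vecp c = (\<Sum>\<beta>\<in>\<D> d. single \<beta> (c \<beta>))" for c :: "expo \<Rightarrow> 'k"
  have lookup_vecp: "lookup (vecp c) \<beta> = (if \<beta> \<in> \<D> d then c \<beta> else 0)" for c \<beta>
    using finite_dA by (simp add: vecp_def lookup_sum lookup_single when_def sum.delta)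
  let ?rows = "(\<lambda>\<rho>. vecp (M \<rho>)) ` mrows d"
  have "vecp c \<in> span ?rows"
  proof (rule ccontr)
    assume "vecp c \<notin> span ?rows"
    then obtain f where f: "Vector_Spaces.linear (\<lambda>a (p :: 'k mpoly). mconst a * p) (*) f"
      "\<And>x. x \<in> ?rows \<Longrightarrow> f x = 0" "f (vecp c) = 1" by (rule separating_functional) blast
    interpret f: Vector_Spaces.linear "\<lambda>a (p :: 'k mpoly). mconst a * p" "(*)" f by (rule f(1))
    \<comment> \<open>The values of the functional on the unit vectors. Vanishing on the rows puts
      \<open>v\<close> into the right kernel, hence into the span of the rows of \<open>N\<close>,
      all of which annihilate \<open>c\<close>; this contradicts the value 1 at
      \<open>c\<close>.\<close>
    define v where "v \<beta> = (if \<beta> \<in> \<D> d then f (single \<beta> 1) else 0)" for \<beta>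
    have f_vecp: "f (vecp c) = (\<Sum>\<beta>\<in>\<D> d. c \<beta> * v \<beta>)" for c
      unfolding vecp_def f.sum
      by (intro sum.cong refl) (simp add: v_def single_eq_mconst[of _ "c _"] f.scale del: mult_cancel_left)
    have "(\<Sum>\<beta>\<in>\<D> d. M \<rho> \<beta> * v \<beta>) = 0" if "\<rho> \<in> mrows d" for \<rho>
      using f(2) that by (simp add: f_vecp[symmetric])
    then have "v \<in> right_kernel (mrows d) (\<D> d) M"
      by (simp add: right_kernel_def v_def)
    then obtain a where a: "v = (\<lambda>\<beta>. \<Sum>j<\<delta>. a j * N j \<beta>)" using N unfolding rows_basis_def by blast
    have N0: "(\<Sum>\<beta>\<in>\<D> d. N j \<beta> * c \<beta>) = 0" if "j < \<delta>" for j
    proof -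
      have "kernel_map n l \<phi> r idx \<delta> d N g $ j = 0" using zero that by simp
      then show ?thesis using that by (simp add: kernel_map_def c(3))
    qed
    have "f (vecp c) = (\<Sum>\<beta>\<in>\<D> d. \<Sum>j<\<delta>. a j * (N j \<beta> * c \<beta>))"
      unfolding f_vecp
    proof (rule sum.cong)
      fix \<beta> assume "\<beta> \<in> \<D> d"
      show "c \<beta> * v \<beta> = (\<Sum>j<\<delta>. a j * (N j \<beta> * c \<beta>))"
        unfolding fun_cong[OF a, of \<beta>] sum_distrib_left by (rule sum.cong) (simp_all only: mult_ac)
    qed simp
    also have "\<dots> = (\<Sum>j<\<delta>. a j * (\<Sum>\<beta>\<in>\<D> d. N j \<beta> * c \<beta>))"
      unfolding sum_distrib_left by (rule sum.swap)
    also have "\<dots> = 0" using N0 by simp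
    finally show False using f(3) by simp
  qed
  \<comment> \<open>Being in \<open>I\<close> is a linear condition on coordinate vectors, so it
    passes from the rows to their span.\<close>
  then have "cl (comb d (lookup (vecp c))) \<in> I"
  proof (induction rule: span_induct)
    case (step x)
    then show ?case
    proof
      fix \<rho> assume \<rho>: "x = vecp (M \<rho>)" "\<rho> \<in> mrows d"
      have "comb d (lookup x) = comb d (M \<rho>)"
        unfolding comb_def \<rho>(1) by (rule sum.cong) (simp_all add: lookup_vecp)
      then show ?thesis using macaulay_row_mem[OF M \<rho>(2)] by simp
    qed
  next
    case base
    interpret I: ideal I R by (rule ideal_I)
    have "comb d (lookup 0) = 0" by (simp add: comb_def)
    moreover have "comb d (lookup (x + y)) = comb d (lookup x) + comb d (lookup y)" for x y
      using comb_add[of d "lookup x" "lookup y"] by (simp add: comb_def lookup_add)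
    moreover have "comb d (lookup (mconst k * x)) = mconst k * comb d (lookup x)" for k x
      using comb_scale[of d k "lookup x"] by (simp add: comb_def lookup_mconst_mult)
    moreover have "\<zero>\<^bsub>R\<^esub> \<in> I" "\<And>x y. x \<in> I \<Longrightarrow> y \<in> I \<Longrightarrow> x \<oplus>\<^bsub>R\<^esub> y \<in> I"
      "\<And>x y. x \<in> I \<Longrightarrow> y \<in> carrier R \<Longrightarrow> y \<otimes>\<^bsub>R\<^esub> x \<in> I"
      by (auto intro: I.I_l_closed I.a_closed I.zero_closed)
    ultimately show ?case
      by (auto simp: subspace_def cl_0 cl_add comb_mvars cl_mult cl_carrier)
  qed
  moreover have "lookup (vecp c) = c" using c(1) by (auto simp: lookup_vecp)
  ultimately show ?thesis using c(2) by simp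
qed

lemma kernel_map_add:
  assumes "g \<in> Rdeg d" "g' \<in> Rdeg d"
  shows "kernel_map n l \<phi> r idx \<delta> d N (g \<oplus>\<^bsub>R\<^esub> g') =
    kernel_map n l \<phi> r idx \<delta> d N g + kernel_map n l \<phi> r idx \<delta> d N g'"
  by (rule eq_vecI) (simp_all add: kernel_map_def coords_add[OF assms] distrib_left sum.distrib)

lemma kernel_map_scale:
  assumes "g \<in> Rdeg d"
  shows "kernel_map n l \<phi> r idx \<delta> d N (coord_const n l \<phi> k \<otimes>\<^bsub>R\<^esub> g) =
    k \<cdot>\<^sub>v kernel_map n l \<phi> r idx \<delta> d N g"
  by (rule eq_vecI) (simp_all add: kernel_map_def coords_scale[OF assms] sum_distrib_left mult_ac)

end

section \<open>Linear combinations in the coordinate ring\<close>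

definition lincomb :: "nat \<Rightarrow> (nat \<Rightarrow> 'a::comm_ring_1 mpoly) \<Rightarrow> (nat \<Rightarrow> 'a) \<Rightarrow> 'a mpoly" where
  "lincomb m w c = (\<Sum>i<m. mconst (c i) * w i)"

lemma lincomb_Suc: "lincomb (Suc m) w c = lincomb m w c + mconst (c m) * w m"
  by (simp add: lincomb_def)

lemma lincomb_cong: "(\<And>i. i < m \<Longrightarrow> w i = w' i) \<Longrightarrow> (\<And>i. i < m \<Longrightarrow> c i = c' i) \<Longrightarrow> lincomb m w c = lincomb m w' c'"
  by (simp add: lincomb_def)

lemma lincomb_unit: "i < m \<Longrightarrow> lincomb m w (\<lambda>j. if j = i then 1 else 0) = w i"
proof -
  assume i: "i < m"
  have "lincomb m w (\<lambda>j. if j = i then 1 else 0) = (\<Sum>j<m. if j = i then w j else 0)"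
    unfolding lincomb_def by (rule sum.cong) auto
  with i show ?thesis by simp
qed

lemma lincomb_mvars: "(\<And>i. i < m \<Longrightarrow> mvars (w i) \<subseteq> V) \<Longrightarrow> mvars (lincomb m w c) \<subseteq> V"
  unfolding lincomb_def by (intro mvars_sum mvars_mult) auto

lemma lincomb_scale: "mconst a * lincomb m w c = lincomb m w (\<lambda>i. a * c i)"
  by (simp add: lincomb_def sum_distrib_left mconst_mult mult.assoc)

lemma lincomb_add: "lincomb m w c + lincomb m w c' = lincomb m w (\<lambda>i. c i + c' i)"
  by (simp add: lincomb_def sum.distrib mconst_add distrib_right)

lemma lincomb_uminus: "lincomb m w (\<lambda>i. - c i) = - lincomb m w c"
  by (simp add: lincomb_def mconst_minus sum_negf)

context equations
begin

abbreviation "\<kappa> \<equiv> coord_const n l \<phi>"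

text \<open>Negative degrees need their own case, since \<open>nat d\<close> would be 0 there and
  would let in the constants.\<close>

definition reps :: "int \<Rightarrow> 'k mpoly set" where
  "reps d = (if d < 0 then {0} else hpolys l (nat d))"

lemma coord_deg_eq: "Rdeg d = cl ` reps d"
  by (auto simp: coord_deg_def reps_def hpolys_def cl_0)

lemma reps_hpolys: "w \<in> reps d \<Longrightarrow> w \<in> hpolys l (nat d)"
  by (auto simp: reps_def split: if_splits)

lemma reps_mvars: "w \<in> reps d \<Longrightarrow> inS w"
  using reps_hpolys by (auto simp: hpolys_def)

lemma reps_0: "0 \<in> reps d"
  by (simp add: reps_def)

lemma reps_lincomb: "(\<And>i. i < m \<Longrightarrow> w i \<in> reps d) \<Longrightarrow> lincomb m w c \<in> reps d"
  unfolding lincomb_def reps_def by (auto intro!: hpolys_sum hpolys_mconst_mult)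

lemma reps_mult: "w \<in> reps d \<Longrightarrow> q \<in> reps e \<Longrightarrow> e \<ge> 0 \<Longrightarrow> w * q \<in> reps (d + e)"
  using hpolys_mult[of w l "nat d" q "nat e"] by (auto simp: reps_def nat_add_distrib split: if_splits)

lemma coord_deg_mult:
  assumes "g \<in> Rdeg d" "p \<in> Rdeg e" "e \<ge> 0"
  shows "g \<otimes>\<^bsub>R\<^esub> p \<in> Rdeg (d + e)"
proof -
  obtain w q where w: "w \<in> reps d" "g = cl w" and q: "q \<in> reps e" "p = cl q"
    using assms by (auto simp: coord_deg_eq)
  then have "g \<otimes>\<^bsub>R\<^esub> p = cl (w * q)" using cl_mult reps_mvars by blast
  with reps_mult[OF w(1) q(1) assms(3)] show ?thesis by (auto simp: coord_deg_eq)
qed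

lemma one_neq_zero_R: "\<one>\<^bsub>R\<^esub> \<noteq> \<zero>\<^bsub>R\<^esub>"
  using cl_eq_iff[of 1 0] by (simp add: cl_1[symmetric] cl_0[symmetric] IX_iff)

lemma subfield_kappa: "subfield (range \<kappa>) R"
proof -
  interpret R: cring R by (rule cring_R)
  interpret K: field "ring_of_type_algebra :: 'k ring" by (rule field_from_type_algebra)
  have "\<kappa> \<in> Ring.ring_hom (ring_of_type_algebra :: 'k ring) R"
    by (rule ring_hom_memI)
      (simp_all add: ring_of_type_algebra_def coord_const_def cl_carrier cl_1 cl_add cl_mult mconst_add mconst_mult)
  then have "ring_hom_ring (ring_of_type_algebra :: 'k ring) R \<kappa>"
    by (intro ring_hom_ringI2 K.ring_axioms R.ring_axioms)
  from ring_hom_ring.img_is_subfield(2)[OF this K.carrier_is_subfield one_neq_zero_R]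
  show ?thesis by (simp add: ring_of_type_algebra_def)
qed

lemma combine_cl:
  assumes "length cs = length us" "\<And>u. u \<in> set us \<Longrightarrow> inS u"
  shows "ring.combine R (map \<kappa> cs) (map cl us) = cl (lincomb (length us) (\<lambda>i. us ! i) (\<lambda>i. cs ! i))"
  using assms
proof (induction cs us rule: list_induct2)
  interpret R: cring R by (rule cring_R)
  case Nil
  then show ?case by (simp add: lincomb_def cl_0)
next
  interpret R: cring R by (rule cring_R)
  case (Cons c cs u us)
  have "lincomb (length (u # us)) (\<lambda>i. (u # us) ! i) (\<lambda>i. (c # cs) ! i) =
      mconst c * u + lincomb (length us) (\<lambda>i. us ! i) (\<lambda>i. cs ! i)"
    by (simp only: lincomb_def length_Cons sum.lessThan_Suc_shift) simp
  moreover have "inS (lincomb (length us) (\<lambda>i. us ! i) (\<lambda>i. cs ! i))"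
    using Cons.prems by (intro lincomb_mvars) simp
  ultimately show ?case using Cons by (simp add: coord_const_def cl_add cl_mult mvars_mult)
qed

section \<open>Independence modulo \<open>I\<close> and lifting of bases\<close>

definition ql :: "'k mpoly \<Rightarrow> 'k mpoly set set" where
  "ql p = I +>\<^bsub>R\<^esub> cl p"

lemma
  assumes p: "inS p" and q: "inS q"
  shows ql_add: "ql (p + q) = ql p \<oplus>\<^bsub>R Quot I\<^esub> ql q"
    and ql_mult: "ql (p * q) = ql p \<otimes>\<^bsub>R Quot I\<^esub> ql q"
    and ql_eq_iff: "ql p = ql q \<longleftrightarrow> p - q \<in> \<Union>I"
proof -
  interpret R: cring R by (rule cring_R)
  note hom = ideal.rcos_ring_hom[OF ideal_I]
  show "ql (p + q) = ql p \<oplus>\<^bsub>R Quot I\<^esub> ql q" "ql (p * q) = ql p \<otimes>\<^bsub>R Quot I\<^esub> ql q"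
    using ring_hom_add[OF hom cl_carrier[OF p] cl_carrier[OF q]]
      ring_hom_mult[OF hom cl_carrier[OF p] cl_carrier[OF q]]
    by (simp_all add: ql_def cl_add[OF p q] cl_mult[OF p q])
  have pq: "inS (p - q)" using p q by (rule mvars_diff)
  have "cl p = cl (p - q) \<oplus>\<^bsub>R\<^esub> cl q" using cl_add[OF pq q] by simp
  then have "cl p \<ominus>\<^bsub>R\<^esub> cl q = cl (p - q)"
    using cl_carrier[OF pq] cl_carrier[OF q] by (simp add: R.minus_eq R.a_assoc R.r_neg)
  then show "ql p = ql q \<longleftrightarrow> p - q \<in> \<Union>I"
    using R.quotient_eq_iff_same_a_r_cos[OF ideal_I cl_carrier[OF p] cl_carrier[OF q]]
      UI_iff[of "p - q"] pq by (simp add: ql_def del: Union_iff)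
qed

lemma ql_zero: "ql 0 = \<zero>\<^bsub>R Quot I\<^esub>"
proof -
  interpret R: cring R by (rule cring_R)
  show ?thesis
    using R.a_rcos_zero[OF ideal_I additive_subgroup.zero_closed[OF ideal.axioms(1)[OF ideal_I]]]
    by (simp add: ql_def cl_0 FactRing_def)
qed

lemma Union_I_lincomb: "(\<And>i. i < m \<Longrightarrow> w i \<in> \<Union>I) \<Longrightarrow> lincomb m w c \<in> \<Union>I"
proof (induction m)
  case 0
  then show ?case using UI_0 by (simp add: lincomb_def del: Union_iff)
next
  case (Suc m)
  then show ?case
    unfolding lincomb_Suc
    by (intro UI_add UI_mult) simp_all
qed

definition indep :: "nat \<Rightarrow> (nat \<Rightarrow> 'k mpoly) \<Rightarrow> bool" where
  "indep m w \<longleftrightarrow> (\<forall>c. lincomb m w c \<in> \<Union>I \<longrightarrow> (\<forall>i<m. c i = 0))"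

text \<open>\<open>dimension\<close> builds a space by successive line extensions; choosing a
  representative of each new vector gives a basis made of polynomials.\<close>

lemma dimension_lift:
  assumes "ring.dimension (R Quot I) k ((\<lambda>c. I +>\<^bsub>R\<^esub> \<kappa> c) ` UNIV) E"
  shows "\<exists>u. (\<forall>i<k. inS (u i)) \<and> E = {ql (lincomb k u c) | c. True} \<and> indep k u"
proof -
  interpret Q: ring "R Quot I" by (rule ideal.quotient_is_ring[OF ideal_I])
  have kappa: "(\<lambda>c. I +>\<^bsub>R\<^esub> \<kappa> c) ` UNIV = (\<lambda>c. ql (mconst c)) ` UNIV"
    by (simp add: ql_def coord_const_def)
  from assms[unfolded kappa] show ?thesis
  proof (induction k K \<equiv> "(\<lambda>c. ql (mconst c)) ` (UNIV :: 'k set)" E rule: Q.dimension.induct)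
    case zero_dim
    then show ?case by (simp add: lincomb_def ql_zero indep_def)
  next
    case (Suc_dim v E k)
    then obtain u where u: "\<forall>i<k. inS (u i)" "E = {ql (lincomb k u c) | c. True}"
      "indep k u" by blast
    obtain g where g: "g \<in> carrier R" "v = I +>\<^bsub>R\<^esub> g"
      using Suc_dim.hyps(1) by (auto simp: FactRing_def A_RCOSETS_def')
    from g(1) obtain x where x: "inS x" "v = ql x"
      by (rule carrier_R_E) (use g(2) that in \<open>auto simp: ql_def\<close>)
    define u' where "u' = u(k := x)"
    have lc: "lincomb (Suc k) u' c = lincomb k u c + mconst (c k) * x" for c
      unfolding lincomb_Suc u'_def by (simp cong: lincomb_cong)
    have lc_mv: "inS (lincomb k u c)" for c by (rule lincomb_mvars) (use u(1) in auto)
    have x_mv: "inS (mconst a * x)" for a using x(1) by (intro mvars_mult) auto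
    have ql_lc: "ql (lincomb (Suc k) u' c) = ql (mconst (c k)) \<otimes>\<^bsub>R Quot I\<^esub> v \<oplus>\<^bsub>R Quot I\<^esub> ql (lincomb k u c)" for c
      unfolding lc by (subst add.commute) (simp add: ql_add ql_mult x lc_mv x_mv)
    have "Q.line_extension ((\<lambda>c. ql (mconst c)) ` UNIV) v E = {ql (lincomb (Suc k) u' c) | c. True}"
    proof (rule Set.set_eqI, rule iffI)
      fix y assume "y \<in> Q.line_extension ((\<lambda>c. ql (mconst c)) ` UNIV) v E"
      then obtain a c where "y = ql (mconst a) \<otimes>\<^bsub>R Quot I\<^esub> v \<oplus>\<^bsub>R Quot I\<^esub> ql (lincomb k u c)"
        by (auto simp: Q.line_extension_mem_iff u(2))
      moreover have "lincomb k u (c(k := a)) = lincomb k u c" by (rule lincomb_cong) auto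
      ultimately have "y = ql (lincomb (Suc k) u' (c(k := a)))" unfolding ql_lc by simp
      then show "y \<in> {ql (lincomb (Suc k) u' c) | c. True}" by blast
    next
      fix y assume "y \<in> {ql (lincomb (Suc k) u' c) | c. True}"
      then show "y \<in> Q.line_extension ((\<lambda>c. ql (mconst c)) ` UNIV) v E"
        unfolding Q.line_extension_mem_iff ql_lc u(2) by blast
    qed
    moreover have "indep (Suc k) u'"
      unfolding indep_def
    proof (intro allI impI)
      fix c i assume c: "lincomb (Suc k) u' c \<in> \<Union>I" and i: "i < Suc k"
      \<comment> \<open>With a nonzero last coefficient the new vector could be solved for, and
        would lie in the space that it extends.\<close>
      have ck: "c k = 0"
      proof (rule ccontr)
        assume nz: "c k \<noteq> 0"
        have "mconst (inverse (c k)) * (lincomb k u c + mconst (c k) * x) \<in> \<Union>I"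
          using UI_mult[OF c, of "mconst (inverse (c k))"] by (simp add: lc del: Union_iff)
        also have "mconst (inverse (c k)) * (lincomb k u c + mconst (c k) * x) =
            x - lincomb k u (\<lambda>i. - inverse (c k) * c i)"
          using nz by (simp add: distrib_left mult.assoc[symmetric] mconst_mult[symmetric] lincomb_uminus)
            (simp add: lincomb_scale)
        finally have "ql x = ql (lincomb k u (\<lambda>i. - inverse (c k) * c i))"
          by (simp add: ql_eq_iff x(1) lc_mv del: Union_iff)
        with Suc_dim.hyps(2) x(2) u(2) show False by blast
      qed
      then have "lincomb k u c \<in> \<Union>I" using c by (simp add: lc del: Union_iff)
      with u(3) ck i show "c i = 0" by (auto simp: indep_def less_Suc_eq simp del: Union_iff)
    qed
    moreover have "\<forall>i<Suc k. inS (u' i)" using u(1) x(1) by (auto simp: u'_def less_Suc_eq)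
    ultimately show ?case by blast
  qed
qed

text \<open>The lifted polynomials need not be homogeneous. Each has the class modulo
  \<open>I\<close> of some representative of degree \<open>d\<close>, and the exchange keeps
  independence.\<close>

lemma basis_mod:
  assumes "quot_HF_eq n l \<phi> I d k"
  obtains w where "\<And>i. i < k \<Longrightarrow> w i \<in> reps d" "indep k w"
proof -
  obtain u where u: "\<forall>i<k. inS (u i)"
    "(\<lambda>g. I +>\<^bsub>R\<^esub> g) ` Rdeg d = {ql (lincomb k u c) | c. True}" "indep k u"
    using dimension_lift[OF assms[unfolded quot_HF_eq_def]] by (elim exE conjE) (rule that)
  have "\<exists>w. w \<in> reps d \<and> u i - w \<in> \<Union>I" if i: "i < k" for i
  proof -
    have "ql (u i) \<in> (\<lambda>g. I +>\<^bsub>R\<^esub> g) ` Rdeg d"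
      unfolding u(2) using lincomb_unit[OF i, of u]
      by (intro CollectI exI[of _ "\<lambda>j. if j = i then 1 else 0"]) simp
    then obtain w where "w \<in> reps d" "ql (u i) = ql w" by (auto simp: coord_deg_eq ql_def)
    then show ?thesis using ql_eq_iff[of "u i" w] u(1) i reps_mvars by blast
  qed
  then obtain w where w: "w i \<in> reps d" "u i - w i \<in> \<Union>I" if "i < k" for i by metis
  have "indep k w"
    unfolding indep_def
  proof (intro allI impI)
    fix c i assume c: "lincomb k w c \<in> \<Union>I" and i: "i < k"
    have "lincomb k (\<lambda>i. u i - w i) c \<in> \<Union>I" by (rule Union_I_lincomb) (rule w(2))
    moreover have "lincomb k u c = lincomb k w c + lincomb k (\<lambda>i. u i - w i) c"
      by (simp add: lincomb_def algebra_simps sum_subtractf)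
    ultimately have "lincomb k u c \<in> \<Union>I"
      using UI_add[OF c] by simp
    with u(3) i show "c i = 0" by (auto simp: indep_def simp del: Union_iff)
  qed
  with w(1) show ?thesis by (rule that)
qed

end

section \<open>The eigenvalue theorem\<close>

lemma bij_betw_mult_mat_vec:
  fixes A :: "'a::field mat"
  assumes A: "A \<in> carrier_mat m m"
    and inj: "\<And>c. c \<in> carrier_vec m \<Longrightarrow> A *\<^sub>v c = 0\<^sub>v m \<Longrightarrow> c = 0\<^sub>v m"
  shows "bij_betw (\<lambda>c. A *\<^sub>v c) (carrier_vec m) (carrier_vec m)"
proof (rule bij_betwI)
  have det: "det A \<noteq> 0" using inj det_0_iff_vec_prod_zero_field[OF A] by blast
  define A' where "A' = inverse (det A) \<cdot>\<^sub>m adj_mat A"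
  have A': "A' \<in> carrier_mat m m" using adj_mat(1)[OF A] by (simp add: A'_def)
  have "A * A' = inverse (det A) \<cdot>\<^sub>m (A * adj_mat A)" "A' * A = inverse (det A) \<cdot>\<^sub>m (adj_mat A * A)"
    unfolding A'_def using A adj_mat(1)[OF A] by auto
  then have inv: "A * A' = 1\<^sub>m m" "A' * A = 1\<^sub>m m"
    using det by (auto simp: adj_mat(2,3)[OF A] intro!: eq_matI)
  show "(\<lambda>c. A *\<^sub>v c) \<in> carrier_vec m \<rightarrow> carrier_vec m" "(\<lambda>c. A' *\<^sub>v c) \<in> carrier_vec m \<rightarrow> carrier_vec m"
    using A A' by auto
  show "A' *\<^sub>v (A *\<^sub>v c) = c" "A *\<^sub>v (A' *\<^sub>v c) = c" if "c \<in> carrier_vec m" for c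
    using assoc_mult_mat_vec[OF A' A that] assoc_mult_mat_vec[OF A A' that] inv that by auto
qed

locale khovanskii_eigen = khovanskii_equations n l \<phi> r idx s ds F I
  for n l and \<phi> :: "nat \<Rightarrow> 'k::field mpoly" and r idx s ds F I +
  fixes \<delta> :: nat and d e :: int and h :: "'k mpoly set"
    and M :: "nat \<times> expo \<Rightarrow> expo \<Rightarrow> 'k" and N :: "nat \<Rightarrow> expo \<Rightarrow> 'k"
  assumes reduced: "reduced_scheme l \<phi> I"
    and points: "finite pts" "card pts = \<delta>"
    and e: "e > 0"
    and reg: "d \<in> Reg n l \<phi> \<delta> I"
    and h: "h \<in> Rdeg e" "\<forall>Z\<in>pts. \<forall>z\<in>Z. coord_val h z \<noteq> 0"
    and M: "macaulay_matrix l \<phi> r idx s ds F (d + e) M"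
    and N: "rows_basis \<delta> N (right_kernel (mrows (d + e)) (\<D> (d + e)) M)"
begin

text \<open>The coefficients are from the closure, the \<open>w i\<close> from \<open>K\<close>. A
  representative of \<open>h\<close> provides the form without zeros on the scheme, and one
  coordinate vector per point suffices because the combination is a form.\<close>

lemma vanishing_lincomb:
  fixes c :: "nat \<Rightarrow> 'k alg_closure"
  assumes w: "\<And>i. i < m \<Longrightarrow> w i \<in> reps d" and f: "klinear f"
    and van: "\<And>Z. Z \<in> pts \<Longrightarrow> \<exists>z\<in>Z. (\<Sum>i<m. c i * meval to_ac z (w i)) = 0"
  shows "lincomb m w (\<lambda>i. f (c i)) \<in> \<Union>I"
proof (cases "d < 0")
  case True
  then have "w i = 0" if "i < m" for i using w[OF that] by (simp add: reps_def)
  then have "lincomb m w (\<lambda>i. f (c i)) = 0" by (simp add: lincomb_def)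
  then show ?thesis using UI_0 by simp
next
  case False
  define G where "G = (\<Sum>i<m. mconst (c i) * acmap (w i))"
  have G: "G \<in> hpolys l (nat d)"
    unfolding G_def using w reps_hpolys by (intro hpolys_sum hpolys_mconst_mult hpolys_map) auto
  have G_eval: "meval id z G = (\<Sum>i<m. c i * meval to_ac z (w i))" for z
    by (simp add: G_def id.meval_sum id.meval_mult meval_acmap)
  have G_van: "meval id z G = 0" if Z: "Z \<in> pts" "z \<in> Z" for Z z
  proof -
    obtain z0 where z0: "z0 \<in> Z" "meval id z0 G = 0" using van[OF Z(1)] by (auto simp: G_eval)
    then have "vanishes G (proj_pt z0)" by (simp only: vanishes_proj_pt[OF G])
    then show ?thesis using Z(2) scheme_pointsD(1)[OF Z(1) z0(1)] by (simp add: vanishes_def)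
  qed
  obtain H where H: "H \<in> hpolys l (nat e)" "h = cl H" using h(1) e by (auto simp: coord_deg_nonneg)
  then have H_mv: "inS H" by (simp add: hpolys_def)
  have H_nz: "meval id z (acmap H) \<noteq> 0" if "Z \<in> pts" "z \<in> Z" for Z z
    using h(2) that coord_val_cl[OF H_mv that] H(2) by (auto simp: meval_acmap)
  have acH: "acmap H \<in> hpolys l (nat e)" using H(1) by (simp add: hpolys_map)
  have ne: "nat e > 0" using e by simp
  have reg': "int (nat d) \<in> Reg n l \<phi> \<delta> I" using reg False by simp
  have "cl (cmap f G) \<in> I"
    by (rule kmap_vanishing_mem[OF reduced acH ne _ G _ reg' f]) (rule H_nz G_van; assumption)+
  moreover have "cmap f (\<Sum>i\<in>A. mconst (c i) * acmap (w i)) = (\<Sum>i\<in>A. mconst (f (c i)) * w i)" for A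
  proof (induction A rule: infinite_finite_induct)
    case (insert i A)
    have "cmap f (mconst (c i) * acmap (w i)) = mconst (f (c i)) * w i"
      unfolding kmap_scale[OF f] kmap_acmap[OF klinear_mult[OF f]] by simp
    with insert show ?case by (simp add: kmap_add[OF f])
  qed (simp_all add: kmap_0[OF f])
  ultimately have "cl (lincomb m w (\<lambda>i. f (c i))) \<in> I" by (simp add: G_def lincomb_def)
  moreover have "mvars (lincomb m w (\<lambda>i. f (c i))) \<subseteq> {0..l}" using w reps_mvars by (intro lincomb_mvars) blast
  ultimately show ?thesis using UI_iff by blast
qed

text \<open>Independence modulo \<open>I\<close> over \<open>K\<close> survives for the values at
  the points over the closure: a functional that is nonzero at a coefficient would turn a relation
  among values into a nontrivial one modulo \<open>I\<close>.\<close>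

lemma evaluation_injective:
  fixes c :: "nat \<Rightarrow> 'k alg_closure"
  assumes "\<And>i. i < m \<Longrightarrow> w i \<in> reps d" "indep m w"
    and "\<And>Z. Z \<in> pts \<Longrightarrow> \<exists>z\<in>Z. (\<Sum>i<m. c i * meval to_ac z (w i)) = 0"
    and i: "i < m"
  shows "c i = 0"
proof (rule ccontr)
  assume "c i \<noteq> 0"
  then obtain f where f: "klinear f" "f (c i) \<noteq> 0" by (rule klinear_separating)
  have "lincomb m w (\<lambda>i. f (c i)) \<in> \<Union>I" by (rule vanishing_lincomb[OF assms(1) f(1) assms(3)])
  with assms(2) i f(2) show False unfolding indep_def by blast
qed

lemma vanishing_mem:
  assumes w: "w \<in> reps d" and van: "\<And>Z z. Z \<in> pts \<Longrightarrow> z \<in> Z \<Longrightarrow> meval to_ac z w = 0"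
  shows "w \<in> \<Union>I"
proof -
  \<comment> \<open>Up to the nonzero scalar \<open>f 1\<close>, such a functional recovers
    \<open>w\<close> from its extension to the closure.\<close>
  obtain f :: "'k alg_closure \<Rightarrow> 'k" where f: "klinear f" "f 1 \<noteq> 0" using klinear_separating[of 1] by auto
  have "lincomb 1 (\<lambda>_. w) (\<lambda>_. f 1) \<in> \<Union>I"
    by (rule vanishing_lincomb[OF _ f(1)]) (use w van scheme_points_nonempty in auto)
  from UI_mult[OF this, of "mconst (inverse (f 1))"] f(2)
  show ?thesis by (simp add: lincomb_def mult.assoc[symmetric] mconst_mult[symmetric] del: Union_iff)
qed

section \<open>Linearity of \<open>N\<close> and the complement on which \<open>N_h\<close> is
  invertible\<close>

abbreviation "NX \<equiv> kernel_map n l \<phi> r idx \<delta> (d + e) N"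

abbreviation Nm :: "'k mpoly set \<Rightarrow> 'k mpoly set \<Rightarrow> 'k vec" where
  "Nm p g \<equiv> NX (g \<otimes>\<^bsub>R\<^esub> p)"

lemma Nm_carrier: "Nm p g \<in> carrier_vec \<delta>"
  by (simp add: kernel_map_def)

lemma
  assumes p: "p \<in> Rdeg e" and g: "g \<in> Rdeg d"
  shows Nm_add: "g' \<in> Rdeg d \<Longrightarrow> Nm p (g \<oplus>\<^bsub>R\<^esub> g') = Nm p g + Nm p g'"
    and Nm_scale: "Nm p (\<kappa> a \<otimes>\<^bsub>R\<^esub> g) = a \<cdot>\<^sub>v Nm p g"
proof -
  interpret R: cring R by (rule cring_R)
  have carr: "x \<in> carrier R" if "x \<in> Rdeg b" for x b
    using that cl_carrier reps_mvars by (auto simp: coord_deg_eq)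
  have e': "e \<ge> 0" using e by simp
  show "Nm p (g \<oplus>\<^bsub>R\<^esub> g') = Nm p g + Nm p g'" if g': "g' \<in> Rdeg d"
    using kernel_map_add[OF coord_deg_mult[OF g p e'] coord_deg_mult[OF g' p e']]
    by (simp add: R.l_distr carr[OF p] carr[OF g] carr[OF g'])
  have "\<kappa> a \<in> carrier R" by (simp add: coord_const_def cl_carrier)
  then show "Nm p (\<kappa> a \<otimes>\<^bsub>R\<^esub> g) = a \<cdot>\<^sub>v Nm p g"
    using kernel_map_scale[OF coord_deg_mult[OF g p e']] by (simp add: R.m_assoc carr[OF p] carr[OF g])
qed

lemma Nm_lincomb:
  assumes p: "p \<in> Rdeg e" and w: "\<And>i. i < m \<Longrightarrow> w i \<in> reps d"
  shows "Nm p (cl (lincomb m w c)) = vec \<delta> (\<lambda>j. \<Sum>i<m. c i * Nm p (cl (w i)) $ j)"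
  using w
proof (induction m)
  interpret R: cring R by (rule cring_R)
  case 0
  have "cl 0 = \<kappa> 0 \<otimes>\<^bsub>R\<^esub> cl 0" by (simp add: coord_const_def cl_0)
  moreover have "cl 0 \<in> Rdeg d" using reps_0 by (simp add: coord_deg_eq)
  ultimately have "Nm p (cl 0) = 0 \<cdot>\<^sub>v Nm p (cl 0)" using Nm_scale[OF p, of "cl 0" 0] by simp
  also have "\<dots> = 0\<^sub>v \<delta>" by (intro eq_vecI) (auto simp: kernel_map_def)
  finally show ?case by (auto simp: lincomb_def intro!: eq_vecI)
next
  case (Suc m)
  have wm: "w m \<in> reps d" and lc: "lincomb m w c \<in> reps d" using Suc.prems by (auto intro: reps_lincomb)
  have mv: "inS (mconst (c m) * w m)" using reps_mvars[OF wm] by (intro mvars_mult) auto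
  have sc: "cl (mconst (c m) * w m) = \<kappa> (c m) \<otimes>\<^bsub>R\<^esub> cl (w m)"
    unfolding coord_const_def by (rule cl_mult) (simp_all add: reps_mvars[OF wm])
  have "mconst (c m) * w m = lincomb 1 (\<lambda>_. w m) (\<lambda>_. c m)" by (simp add: lincomb_def)
  then have scW: "cl (mconst (c m) * w m) \<in> Rdeg d"
    using reps_lincomb[of 1 "\<lambda>_. w m" d "\<lambda>_. c m"] wm by (simp add: coord_deg_eq)
  have deg: "cl (w m) \<in> Rdeg d" "cl (lincomb m w c) \<in> Rdeg d"
    using wm lc by (auto simp: coord_deg_eq)
  have "Nm p (cl (lincomb (Suc m) w c)) = Nm p (cl (lincomb m w c)) + c m \<cdot>\<^sub>v Nm p (cl (w m))"
    unfolding lincomb_Suc cl_add[OF reps_mvars[OF lc] mv] Nm_add[OF p deg(2) scW]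
    unfolding sc Nm_scale[OF p deg(1)] ..
  also have "\<dots> = vec \<delta> (\<lambda>j. \<Sum>i<Suc m. c i * Nm p (cl (w i)) $ j)"
    using Suc Nm_carrier[of "cl (w m)" p] by (intro eq_vecI) auto
  finally show ?case .
qed

lemma Nm_h_zero_mem:
  assumes w: "w \<in> reps d" and "Nm h (cl w) = 0\<^sub>v \<delta>"
  shows "w \<in> \<Union>I"
proof (rule vanishing_mem[OF w])
  fix Z z assume Z: "Z \<in> pts" "z \<in> Z"
  have deg: "cl w \<in> Rdeg d" using w by (simp add: coord_deg_eq)
  obtain H where H: "H \<in> reps e" "h = cl H" using h(1) by (auto simp: coord_deg_eq)
  have "cl w \<otimes>\<^bsub>R\<^esub> h \<in> I"
    by (rule kernel_map_zero_mem[OF M N coord_deg_mult[OF deg h(1)] assms(2)]) (use e in simp)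
  then have "w * H \<in> \<Union>I"
    using UI_iff[of "w * H"] reps_mvars[OF w] reps_mvars[OF H(1)]
    by (simp add: H(2) cl_mult mvars_mult del: Union_iff)
  then have "meval to_ac z w * meval to_ac z H = 0"
    using scheme_pointsD(3)[OF Z acmap_J, of "w * H"]
    by (simp add: meval_acmap to_ac.meval_mult del: Union_iff mult_eq_0_iff)
  moreover have "meval to_ac z H \<noteq> 0"
    using h(2) Z coord_val_cl[OF reps_mvars[OF H(1)] Z] H(2) by auto
  ultimately show "meval to_ac z w = 0" by simp
qed

lemma complement_exists:
  obtains w where "\<And>i. i < \<delta> \<Longrightarrow> w i \<in> reps d" "indep \<delta> w"
    "bij_betw (\<lambda>c. Nm h (cl (lincomb \<delta> w (\<lambda>i. c $ i)))) (carrier_vec \<delta>) (carrier_vec \<delta>)"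
proof -
  from reg have "quot_HF_eq n l \<phi> I d \<delta>" by (simp add: Reg_def)
  then obtain w where w: "\<And>i. i < \<delta> \<Longrightarrow> w i \<in> reps d" "indep \<delta> w" by (rule basis_mod) blast
  \<comment> \<open>The matrix of \<open>N_h\<close> on the complement is square, because the
    Hilbert function at \<open>d\<close> equals the number of rows of \<open>N\<close>; injectivity
    is then enough.\<close>
  define A where "A = mat \<delta> \<delta> (\<lambda>(j, i). Nm h (cl (w i)) $ j)"
  have A: "A \<in> carrier_mat \<delta> \<delta>" by (simp add: A_def)
  have lc: "Nm h (cl (lincomb \<delta> w c)) = vec \<delta> (\<lambda>j. \<Sum>i<\<delta>. c i * Nm h (cl (w i)) $ j)" for c
    by (rule Nm_lincomb[OF h(1)]) (rule w(1))
  have Ac: "A *\<^sub>v c = Nm h (cl (lincomb \<delta> w (\<lambda>i. c $ i)))" if "c \<in> carrier_vec \<delta>" for c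
    unfolding lc using that
    by (intro eq_vecI) (auto simp: A_def scalar_prod_def atLeast0LessThan mult.commute)
  have "bij_betw (\<lambda>c. A *\<^sub>v c) (carrier_vec \<delta>) (carrier_vec \<delta>)"
  proof (rule bij_betw_mult_mat_vec[OF A])
    fix c assume c: "c \<in> carrier_vec \<delta>" "A *\<^sub>v c = 0\<^sub>v \<delta>"
    have "lincomb \<delta> w (\<lambda>i. c $ i) \<in> \<Union>I"
      using c by (intro Nm_h_zero_mem reps_lincomb w(1)) (simp_all add: Ac)
    with w(2) have "\<forall>i<\<delta>. c $ i = 0" unfolding indep_def by blast
    with c(1) show "c = 0\<^sub>v \<delta>" by (intro eq_vecI) auto
  qed
  then have "bij_betw (\<lambda>c. Nm h (cl (lincomb \<delta> w (\<lambda>i. c $ i)))) (carrier_vec \<delta>) (carrier_vec \<delta>)"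
    by (simp add: Ac cong: bij_betw_cong)
  with w show ?thesis by (rule that)
qed

text \<open>\<open>N\<^sub>h\<close> is onto already on a complement of \<open>I\<^sub>d\<close> and its kernel lies in \<open>I\<close>: if \<open>x \<in> I\<^sub>d\<close> has the same
  image as \<open>y\<close> in the complement, then \<open>y \<in> I\<close>, so \<open>y = 0\<close>.\<close>

lemma Nm_h_mem_zero:
  assumes x: "x \<in> reps d" "x \<in> \<Union>I"
  shows "Nm h (cl x) = 0\<^sub>v \<delta>"
proof -
  obtain w where w: "\<And>i. i < \<delta> \<Longrightarrow> w i \<in> reps d" "indep \<delta> w"
    and bij: "bij_betw (\<lambda>c. Nm h (cl (lincomb \<delta> w (\<lambda>i. c $ i)))) (carrier_vec \<delta>) (carrier_vec \<delta>)"
    by (rule complement_exists) blast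
  have "Nm h (cl x) \<in> (\<lambda>c. Nm h (cl (lincomb \<delta> w (\<lambda>i. c $ i)))) ` carrier_vec \<delta>"
    using bij_betw_imp_surj_on[OF bij] Nm_carrier by blast
  then obtain c :: "'k vec" where c: "c \<in> carrier_vec \<delta>" "Nm h (cl x) = Nm h (cl (lincomb \<delta> w (\<lambda>i. c $ i)))" by blast
  let ?y = "lincomb \<delta> w (\<lambda>i. c $ i)"
  have y: "?y \<in> reps d" by (intro reps_lincomb w(1))
  \<comment> \<open>The difference \<open>x - y\<close> is written as a combination of two terms, so
    that the facts on \<open>lincomb\<close> apply to it.\<close>
  define w2 :: "nat \<Rightarrow> 'k mpoly" where "w2 i = (if i = 0 then x else ?y)" for i
  define c2 :: "nat \<Rightarrow> 'k" where "c2 i = (if i = 0 then 1 else - 1)" for i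
  have w2: "w2 i \<in> reps d" for i using x(1) y by (simp add: w2_def)
  have lc2: "lincomb 2 w2 c2 = x - ?y"
    by (simp add: lincomb_def numeral_2_eq_2 w2_def c2_def mconst_minus)
  have "Nm h (cl (lincomb 2 w2 c2)) = vec \<delta> (\<lambda>j. \<Sum>i<2. c2 i * Nm h (cl (w2 i)) $ j)"
    by (rule Nm_lincomb[OF h(1)]) (rule w2)
  also have "\<dots> = 0\<^sub>v \<delta>"
    using c(2) by (intro eq_vecI) (simp_all add: numeral_2_eq_2 w2_def c2_def)
  finally have "lincomb 2 w2 c2 \<in> \<Union>I" by (intro Nm_h_zero_mem reps_lincomb w2)
  then have "x - ?y \<in> \<Union>I" unfolding lc2 .
  from UI_add[OF UI_mult[OF this, of "mconst (- 1)"] x(2)]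
  have "?y \<in> \<Union>I" by (simp add: mconst_minus del: Union_iff)
  with w(2) have "\<forall>i<\<delta>. c $ i = 0" unfolding indep_def by blast
  moreover have "Nm h (cl ?y) = vec \<delta> (\<lambda>j. \<Sum>i<\<delta>. c $ i * Nm h (cl (w i)) $ j)"
    by (rule Nm_lincomb[OF h(1)]) (rule w(1))
  ultimately show ?thesis unfolding c(2) by (intro eq_vecI) simp_all
qed

theorem exists_invertible_on: "\<exists>B. invertible_on n l \<phi> \<delta> d (Nm h) B"
proof -
  interpret R: cring R by (rule cring_R)
  obtain w where w: "\<And>i. i < \<delta> \<Longrightarrow> w i \<in> reps d" "indep \<delta> w"
    and bij: "bij_betw (\<lambda>c. Nm h (cl (lincomb \<delta> w (\<lambda>i. c $ i)))) (carrier_vec \<delta>) (carrier_vec \<delta>)"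
    by (rule complement_exists) blast
  define \<Phi> where "\<Phi> c = cl (lincomb \<delta> w (\<lambda>i. c $ i))" for c :: "'k vec"
  define B where "B = \<Phi> ` carrier_vec \<delta>"
  have \<Phi>_vec: "cl (lincomb \<delta> w c) = \<Phi> (vec \<delta> c)" for c
    unfolding \<Phi>_def by (rule arg_cong[of _ _ cl], rule lincomb_cong) auto
  have B_iff: "x \<in> B \<longleftrightarrow> (\<exists>c. x = cl (lincomb \<delta> w c))" for x
  proof
    assume "x \<in> B"
    then show "\<exists>c. x = cl (lincomb \<delta> w c)" by (auto simp: B_def \<Phi>_def)
  next
    assume "\<exists>c. x = cl (lincomb \<delta> w c)"
    then show "x \<in> B" unfolding B_def \<Phi>_vec by auto
  qed
  have mv: "inS (lincomb \<delta> w c)" for c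
    by (rule reps_mvars[of _ d], rule reps_lincomb, rule w(1))
  have kB: "\<kappa> a \<otimes>\<^bsub>R\<^esub> x \<in> B" if x: "x \<in> B" for a x
  proof -
    obtain c where "x = cl (lincomb \<delta> w c)" using x B_iff by blast
    then have "\<kappa> a \<otimes>\<^bsub>R\<^esub> x = cl (lincomb \<delta> w (\<lambda>i. a * c i))"
      by (simp add: coord_const_def cl_mult[symmetric] mv lincomb_scale)
    then show ?thesis using B_iff by blast
  qed
  have Bc: "B \<subseteq> carrier R" using B_iff cl_carrier[OF mv] by auto
  have "subalgebra (range \<kappa>) B R"
  proof (intro subalgebra.intro subalgebra_axioms.intro)
    show "subgroup B (add_monoid R)"
    proof (rule R.add.subgroupI)
      show "B \<subseteq> carrier R" by (rule Bc)
      show "B \<noteq> {}" using B_iff by blast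
      show "\<ominus>\<^bsub>R\<^esub> x \<in> B" if x: "x \<in> B" for x
      proof -
        have "\<kappa> (- 1) \<oplus>\<^bsub>R\<^esub> \<kappa> 1 = \<zero>\<^bsub>R\<^esub>"
          by (simp add: coord_const_def cl_add[symmetric] mconst_minus cl_0)
        then have "\<ominus>\<^bsub>R\<^esub> \<one>\<^bsub>R\<^esub> = \<kappa> (- 1)"
          by (intro R.minus_equality) (simp_all add: coord_const_def cl_carrier cl_1)
        then have "\<ominus>\<^bsub>R\<^esub> x = \<kappa> (- 1) \<otimes>\<^bsub>R\<^esub> x" using x Bc R.l_minus[of "\<one>\<^bsub>R\<^esub>" x] by auto
        then show ?thesis using kB[OF x] by simp
      qed
      show "x \<oplus>\<^bsub>R\<^esub> y \<in> B" if "x \<in> B" "y \<in> B" for x y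
      proof -
        from that(1) obtain c where "x = cl (lincomb \<delta> w c)" unfolding B_iff ..
        moreover from that(2) obtain c' where "y = cl (lincomb \<delta> w c')" unfolding B_iff ..
        ultimately have "x \<oplus>\<^bsub>R\<^esub> y = cl (lincomb \<delta> w (\<lambda>i. c i + c' i))"
          by (simp add: cl_add[symmetric] mv lincomb_add)
        then show ?thesis using B_iff by blast
      qed
    qed
  qed (use kB in auto)
  moreover have "B \<subseteq> Rdeg d"
  proof
    fix x assume "x \<in> B"
    then obtain c where "x = cl (lincomb \<delta> w c)" unfolding B_iff ..
    moreover have "lincomb \<delta> w c \<in> reps d" by (rule reps_lincomb) (rule w(1))
    ultimately show "x \<in> Rdeg d" by (simp add: coord_deg_eq)
  qed
  moreover have "bij_betw (Nm h) B (carrier_vec \<delta>)"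
  proof -
    from bij have "inj_on (Nm h \<circ> \<Phi>) (carrier_vec \<delta>)" "(Nm h \<circ> \<Phi>) ` carrier_vec \<delta> = carrier_vec \<delta>"
      by (simp_all add: bij_betw_def \<Phi>_def comp_def)
    then show ?thesis by (auto simp: bij_betw_def B_def image_comp intro: inj_on_imageI)
  qed
  ultimately show ?thesis unfolding invertible_on_def by blast
qed

lemma kernel_map_eq_mem:
  assumes x: "x \<in> reps (d + e)" and y: "y \<in> reps (d + e)"
    and eq: "NX (cl x) = NX (cl y)"
  shows "x - y \<in> \<Union>I"
proof -
  have deg: "cl u \<in> Rdeg (d + e)" if "u \<in> reps (d + e)" for u using that by (simp add: coord_deg_eq)
  have ny: "mconst (- 1) * y \<in> reps (d + e)"
    using reps_lincomb[of 1 "\<lambda>_. y" "d + e" "\<lambda>_. - 1"] y by (simp add: lincomb_def)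
  have sc: "cl (mconst (- 1) * y) = \<kappa> (- 1) \<otimes>\<^bsub>R\<^esub> cl y"
    unfolding coord_const_def by (rule cl_mult) (simp_all add: reps_mvars[OF y])
  have "cl (x + mconst (- 1) * y) = cl x \<oplus>\<^bsub>R\<^esub> cl (mconst (- 1) * y)"
    by (rule cl_add[OF reps_mvars[OF x] reps_mvars[OF ny]])
  then have "NX (cl (x + mconst (- 1) * y)) =
      NX (cl x) + (- 1) \<cdot>\<^sub>v NX (cl y)"
    using kernel_map_add[OF deg[OF x] deg[OF ny]] kernel_map_scale[OF deg[OF y]] by (simp add: sc)
  also have "\<dots> = 0\<^sub>v \<delta>" unfolding eq by (intro eq_vecI) (simp_all add: kernel_map_def)
  finally have "NX (cl (x - y)) = 0\<^sub>v \<delta>" by (simp add: mconst_minus)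
  moreover have xy: "x - y \<in> reps (d + e)"
    using reps_lincomb[of 2 "\<lambda>i. if i = 0 then x else y" "d + e" "\<lambda>i. if i = 0 then 1 else - 1"] x y
    by (simp add: lincomb_def numeral_2_eq_2 mconst_minus)
  ultimately have "cl (x - y) \<in> I" using kernel_map_zero_mem[OF M N deg[OF xy]] by blast
  then show ?thesis using UI_iff reps_mvars[OF xy] by blast
qed

lemma kappa_eq_0: "\<kappa> a = \<zero>\<^bsub>R\<^esub> \<Longrightarrow> a = 0"
proof -
  assume "\<kappa> a = \<zero>\<^bsub>R\<^esub>"
  then have "mconst a \<in> IX" using cl_eq_iff[of "mconst a" 0] by (simp add: coord_const_def cl_0)
  then have "mconst a = 0" by (simp add: IX_iff)
  then have "lookup (mconst a) 0 = 0" by simp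
  then show "a = 0" by (simp add: mconst_def)
qed

lemma combine_lincomb:
  assumes "length cs = m" "\<And>i. i < m \<Longrightarrow> inS (w i)"
  shows "ring.combine R (map \<kappa> cs) (map (\<lambda>i. cl (w i)) [0..<m]) = cl (lincomb m w (\<lambda>i. cs ! i))"
proof -
  have "ring.combine R (map \<kappa> cs) (map cl (map w [0..<m])) =
      cl (lincomb (length (map w [0..<m])) (\<lambda>i. map w [0..<m] ! i) (\<lambda>i. cs ! i))"
  proof (rule combine_cl)
    fix u assume "u \<in> set (map w [0..<m])"
    then obtain i where "i < m" "u = w i" by auto
    with assms(2) show "inS u" by simp
  qed (simp add: assms(1))
  also have "lincomb (length (map w [0..<m])) (\<lambda>i. map w [0..<m] ! i) (\<lambda>i. cs ! i) = lincomb m w (\<lambda>i. cs ! i)"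
    by simp (rule lincomb_cong; simp)
  finally show ?thesis by (simp add: comp_def)
qed

lemma meval_lincomb: "meval to_ac z (lincomb m w c) = (\<Sum>i<m. to_ac (c i) * meval to_ac z (w i))"
  by (simp add: lincomb_def to_ac.meval_sum to_ac.meval_mult)

section \<open>The endomorphism of an arbitrary admissible \<open>B\<close>\<close>

context
  fixes B :: "'k mpoly set set" and p :: "'k mpoly set"
  assumes B: "invertible_on n l \<phi> \<delta> d (Nm h) B" and p: "p \<in> Rdeg e"
begin

abbreviation "T \<equiv> \<lambda>g. inv_into B (Nm h) (Nm p g)"

lemma B_subset: "B \<subseteq> Rdeg d"
  and B_bij: "bij_betw (Nm h) B (carrier_vec \<delta>)"
  and B_subalgebra: "subalgebra (range \<kappa>) B R"
  using B by (simp_all add: invertible_on_def)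

lemma cl_mem_B:
  assumes "x \<in> B"
  obtains w where "w \<in> reps d" "x = cl w"
  using assms B_subset by (auto simp: coord_deg_eq)

lemma T_mem: "T g \<in> B" and Nm_T: "Nm h (T g) = Nm p g"
proof -
  have "Nm p g \<in> Nm h ` B" using bij_betw_imp_surj_on[OF B_bij] Nm_carrier by blast
  then show "T g \<in> B" "Nm h (T g) = Nm p g" by (rule inv_into_into, rule f_inv_into_f)
qed

lemma T_eqI: "x \<in> B \<Longrightarrow> Nm h x = Nm p g \<Longrightarrow> T g = x"
  by (rule inv_into_f_eq[OF bij_betw_imp_inj_on[OF B_bij]])

lemma T_val:
  assumes g: "g \<in> B" and Z: "Z \<in> pts" "z \<in> Z"
  shows "coord_val (T g) z * coord_val h z = coord_val g z * coord_val p z"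
proof -
  obtain u where u: "u \<in> reps d" "T g = cl u" using T_mem by (rule cl_mem_B)
  obtain w where w: "w \<in> reps d" "g = cl w" using g by (rule cl_mem_B)
  obtain H where H: "H \<in> reps e" "h = cl H" using h(1) by (auto simp: coord_deg_eq)
  obtain q where q: "q \<in> reps e" "p = cl q" using p by (auto simp: coord_deg_eq)
  have e': "e \<ge> 0" using e by simp
  have "NX (cl (u * H)) = NX (cl (w * q))"
    using Nm_T[of g] u w H q by (simp add: cl_mult reps_mvars)
  then have "u * H - w * q \<in> \<Union>I"
    by (rule kernel_map_eq_mem[OF reps_mult[OF u(1) H(1) e'] reps_mult[OF w(1) q(1) e']])
  from scheme_pointsD(3)[OF Z acmap_J[OF this]] have "meval to_ac z (u * H - w * q) = 0"
    by (simp only: meval_acmap)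
  then have "meval to_ac z u * meval to_ac z H = meval to_ac z w * meval to_ac z q"
    using to_ac.meval_add[of z "u * H - w * q" "w * q"] by (simp add: to_ac.meval_mult)
  then show ?thesis
    using coord_val_cl[OF _ Z] u w H q reps_mvars by simp
qed

lemma lincomb_mem_B:
  assumes "\<And>i. i < m \<Longrightarrow> w i \<in> reps d \<and> cl (w i) \<in> B"
  shows "cl (lincomb m w c) \<in> B"
  using assms
proof (induction m)
  case 0
  interpret B: subalgebra "range \<kappa>" B R by (rule B_subalgebra)
  show ?case using B.one_closed by (simp add: lincomb_def cl_0)
next
  case (Suc m)
  interpret B: subalgebra "range \<kappa>" B R by (rule B_subalgebra)
  have mv: "inS (w i)" if "i < Suc m" for i using Suc.prems[OF that] reps_mvars by blast
  have "cl (lincomb (Suc m) w c) = cl (lincomb m w c) \<oplus>\<^bsub>R\<^esub> (\<kappa> (c m) \<otimes>\<^bsub>R\<^esub> cl (w m))"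
    unfolding lincomb_Suc coord_const_def using mv
    by (subst cl_add) (simp_all add: cl_mult mvars_mult lincomb_mvars)
  also have "\<dots> \<in> B"
    using Suc B.m_closed[of "cl (lincomb m w c)"] B.smult_closed[of "\<kappa> (c m)" "cl (w m)"] by simp
  finally show ?case .
qed

text \<open>An element of \<open>B\<close> that lies in \<open>I\<close> is killed by
  \<open>N_h\<close>, which is injective on \<open>B\<close>. So independence in \<open>B\<close> is
  already independence modulo \<open>I\<close>.\<close>

lemma indep_if_mem_B:
  assumes w: "\<And>i. i < m \<Longrightarrow> w i \<in> reps d \<and> cl (w i) \<in> B"
    and indep: "\<And>c i. cl (lincomb m w c) = \<zero>\<^bsub>R\<^esub> \<Longrightarrow> i < m \<Longrightarrow> c i = 0"
  shows "indep m w"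
  unfolding indep_def
proof (intro allI impI)
  fix c i assume c: "lincomb m w c \<in> \<Union>I" and i: "i < m"
  have "lincomb m w c \<in> reps d" using w by (intro reps_lincomb) blast
  then have "Nm h (cl (lincomb m w c)) = 0\<^sub>v \<delta>" using c by (rule Nm_h_mem_zero)
  moreover have "Nm h (cl 0) = 0\<^sub>v \<delta>"
    by (rule Nm_h_mem_zero[OF reps_0 UI_0])
  moreover have "cl 0 \<in> B" using lincomb_mem_B[of 0 w c] by (simp add: lincomb_def)
  moreover have "cl (lincomb m w c) \<in> B" by (rule lincomb_mem_B) (rule w)
  ultimately have "cl (lincomb m w c) = cl 0"
    using inj_onD[OF bij_betw_imp_inj_on[OF B_bij], of "cl (lincomb m w c)" "cl 0"] by simp
  then show "c i = 0" using indep i by (simp add: cl_0)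
qed

text \<open>An eigenvector over the closure is the coefficient vector of a form that cannot vanish
  at all the points. At a point where it does not vanish, pairing it with the evaluation forces the
  eigenvalue; so coinciding values at different points need no separate treatment.\<close>

lemma eigenvalue_imp_value:
  assumes "ac_eigenvalue R \<kappa> B T \<mu>"
  shows "\<exists>Z\<in>pts. \<exists>z\<in>Z. \<mu> = coord_val p z / coord_val h z"
proof -
  interpret R: cring R by (rule cring_R)
  obtain Us A where Us: "R.independent (range \<kappa>) Us" "R.Span (range \<kappa>) Us = B"
    and A: "A \<in> carrier_mat (length Us) (length Us)"
    and T: "\<And>j. j < length Us \<Longrightarrow> T (Us ! j) = R.combine (map \<kappa> (list_of_vec (col A j))) Us"
    and ev: "eigenvalue (map_mat to_ac A) \<mu>"
    using assms unfolding ac_eigenvalue_def by blast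
  define m where "m = length Us"
  have A': "A \<in> carrier_mat m m" using A by (simp add: m_def)
  have carr: "set Us \<subseteq> carrier R" by (rule R.independent_in_carrier[OF Us(1)])
  have UB: "Us ! i \<in> B" if "i < m" for i
    using R.Span_base_incl[OF subfield_kappa carr] Us(2) that by (auto simp: m_def)
  have "\<exists>w. i < m \<longrightarrow> w \<in> reps d \<and> Us ! i = cl w" for i using cl_mem_B[OF UB] by metis
  then obtain w where w: "\<And>i. i < m \<Longrightarrow> w i \<in> reps d" "\<And>i. i < m \<Longrightarrow> Us ! i = cl (w i)" by metis
  have Us_eq: "Us = map (\<lambda>i. cl (w i)) [0..<m]" by (rule nth_equalityI) (simp_all add: m_def w)
  have mv: "inS (w i)" if "i < m" for i using reps_mvars[OF w(1)[OF that]] .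
  have "indep m w"
  proof (rule indep_if_mem_B)
    show "w i \<in> reps d \<and> cl (w i) \<in> B" if "i < m" for i using w[OF that] UB[OF that] by simp
    show "c i = 0" if c: "cl (lincomb m w c) = \<zero>\<^bsub>R\<^esub>" and i: "i < m" for c i
    proof -
      let ?cs = "map c [0..<m]"
      have "R.combine (map \<kappa> ?cs) Us = cl (lincomb m w (\<lambda>i. ?cs ! i))"
        unfolding Us_eq by (rule combine_lincomb) (simp_all add: mv)
      also have "lincomb m w (\<lambda>i. ?cs ! i) = lincomb m w c" by (rule lincomb_cong) simp_all
      finally have "R.combine (map \<kappa> ?cs) Us = \<zero>\<^bsub>R\<^esub>" using c by simp
      from R.independent_imp_trivial_combine[OF subfield_kappa Us(1) _ this]
      have "set (map \<kappa> ?cs) \<subseteq> {\<zero>\<^bsub>R\<^esub>}" by (auto simp: m_def)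
      then have "\<kappa> (c i) = \<zero>\<^bsub>R\<^esub>" using i by (auto simp: image_subset_iff)
      then show ?thesis by (rule kappa_eq_0)
    qed
  qed
  note inj = evaluation_injective[OF w(1) this]
  obtain v where v: "v \<in> carrier_vec m" "v \<noteq> 0\<^sub>v m" "map_mat to_ac A *\<^sub>v v = \<mu> \<cdot>\<^sub>v v"
    using ev A' by (auto simp: eigenvalue_def eigenvector_def)
  have "\<exists>Z\<in>pts. \<forall>z\<in>Z. (\<Sum>i<m. v $ i * meval to_ac z (w i)) \<noteq> 0"
  proof (rule ccontr)
    assume "\<not> ?thesis"
    then have "v $ i = 0" if "i < m" for i using inj[of "\<lambda>i. v $ i" i] that by blast
    then have "v = 0\<^sub>v m" using v(1) by (intro eq_vecI) auto
    with v(2) show False by simp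
  qed
  then obtain Z where Z: "Z \<in> pts" "\<forall>z\<in>Z. (\<Sum>i<m. v $ i * meval to_ac z (w i)) \<noteq> 0" by blast
  obtain z where z: "z \<in> Z" using scheme_points_nonempty[OF Z(1)] by blast
  define y where "y i = meval to_ac z (w i)" for i
  define S where "S = (\<Sum>i<m. v $ i * y i)"
  have S: "S \<noteq> 0" using Z(2) z by (simp add: S_def y_def)
  have hz: "coord_val h z \<noteq> 0" using h(2) Z(1) z by blast
  have col: "(\<Sum>i<m. to_ac (A $$ (i, j)) * y i) * coord_val h z = y j * coord_val p z" if j: "j < m" for j
  proof -
    have "T (Us ! j) = cl (lincomb m w (\<lambda>i. list_of_vec (col A j) ! i))"
      unfolding T[OF j[unfolded m_def]] unfolding Us_eq by (rule combine_lincomb) (use A' mv in auto)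
    also have "lincomb m w (\<lambda>i. list_of_vec (col A j) ! i) = lincomb m w (\<lambda>i. A $$ (i, j))"
      by (rule lincomb_cong) (use A' j in auto)
    finally have Tj: "T (Us ! j) = cl (lincomb m w (\<lambda>i. A $$ (i, j)))" .
    have "coord_val (T (Us ! j)) z = (\<Sum>i<m. to_ac (A $$ (i, j)) * y i)"
      unfolding Tj using mv by (subst coord_val_cl[OF _ Z(1) z]) (auto simp: meval_lincomb y_def intro!: lincomb_mvars)
    moreover have "coord_val (Us ! j) z = y j"
      unfolding w(2)[OF j] y_def by (rule coord_val_cl[OF mv[OF j] Z(1) z])
    ultimately show ?thesis using T_val[OF UB[OF j] Z(1) z] by simp
  qed
  have row: "(\<Sum>j<m. to_ac (A $$ (i, j)) * v $ j) = \<mu> * v $ i" if i: "i < m" for i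
  proof -
    have "(map_mat to_ac A *\<^sub>v v) $ i = (\<Sum>j<m. to_ac (A $$ (i, j)) * v $ j)"
      using i A' v(1) by (simp add: scalar_prod_def atLeast0LessThan)
    then show ?thesis using v(1,3) i by simp
  qed
  \<comment> \<open>The double sum of \<open>y i * A i j * v j\<close> is computed by rows, where
    \<open>v\<close> is an eigenvector, and by columns, where evaluation is a left
    eigenvector.\<close>
  have "\<mu> * S * coord_val h z = (\<Sum>i<m. (\<mu> * v $ i) * y i) * coord_val h z"
    by (simp add: S_def sum_distrib_left mult.assoc)
  also have "\<dots> = (\<Sum>i<m. \<Sum>j<m. to_ac (A $$ (i, j)) * v $ j * y i) * coord_val h z"
    by (simp add: row[symmetric] sum_distrib_right)
  also have "\<dots> = (\<Sum>j<m. \<Sum>i<m. to_ac (A $$ (i, j)) * v $ j * y i) * coord_val h z"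
    by (subst sum.swap) simp
  also have "\<dots> = (\<Sum>j<m. v $ j * ((\<Sum>i<m. to_ac (A $$ (i, j)) * y i) * coord_val h z))"
    by (simp add: sum_distrib_left sum_distrib_right mult_ac)
  also have "\<dots> = S * coord_val p z"
  proof -
    have "(\<Sum>j<m. v $ j * ((\<Sum>i<m. to_ac (A $$ (i, j)) * y i) * coord_val h z)) =
        (\<Sum>j<m. v $ j * (y j * coord_val p z))"
      by (rule sum.cong) (use col in auto)
    then show ?thesis by (simp add: S_def sum_distrib_right mult.assoc)
  qed
  finally have "\<mu> = coord_val p z / coord_val h z" using S hz by (simp add: field_simps)
  with Z(1) z show ?thesis by blast
qed

lemma value_imp_eigenvalue:
  assumes Z: "Z \<in> pts" "z \<in> Z"
  shows "ac_eigenvalue R \<kappa> B T (coord_val p z / coord_val h z)"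
proof -
  interpret R: cring R by (rule cring_R)
  \<comment> \<open>The basis of \<open>B\<close> consists of the preimages of the unit vectors
    under \<open>N_h\<close>, so that \<open>N_h\<close> itself is the coordinate map.\<close>
  have "\<exists>w. j < \<delta> \<longrightarrow> w \<in> reps d \<and> cl w \<in> B \<and> Nm h (cl w) = unit_vec \<delta> j" for j
  proof (cases "j < \<delta>")
    case True
    then have "unit_vec \<delta> j \<in> Nm h ` B" using bij_betw_imp_surj_on[OF B_bij] by simp
    then obtain x where x: "x \<in> B" "Nm h x = unit_vec \<delta> j" by force
    obtain w where "w \<in> reps d" "x = cl w" using x(1) by (rule cl_mem_B)
    with x show ?thesis by blast
  qed simp
  then obtain w where w: "\<And>j. j < \<delta> \<Longrightarrow> w j \<in> reps d" "\<And>j. j < \<delta> \<Longrightarrow> cl (w j) \<in> B"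
    "\<And>j. j < \<delta> \<Longrightarrow> Nm h (cl (w j)) = unit_vec \<delta> j" by metis
  have mv: "inS (w i)" if "i < \<delta>" for i using reps_mvars[OF w(1)[OF that]] .
  define Us where "Us = map (\<lambda>j. cl (w j)) [0..<\<delta>]"
  have len: "length Us = \<delta>" by (simp add: Us_def)
  have lcB: "cl (lincomb \<delta> w c) \<in> B" for c by (rule lincomb_mem_B) (simp add: w)
  have Nm_lc: "Nm h (cl (lincomb \<delta> w c)) = vec \<delta> c" for c
  proof -
    have "Nm h (cl (lincomb \<delta> w c)) = vec \<delta> (\<lambda>j. \<Sum>i<\<delta>. c i * Nm h (cl (w i)) $ j)"
      by (rule Nm_lincomb[OF h(1)]) (rule w(1))
    also have "\<dots> = vec \<delta> c"
    proof (rule eq_vecI)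
      fix j assume "j < dim_vec (vec \<delta> c)"
      then have j: "j < \<delta>" by simp
      have "(\<Sum>i<\<delta>. c i * Nm h (cl (w i)) $ j) = (\<Sum>i<\<delta>. if i = j then c j else 0)"
        using j by (intro sum.cong) (auto simp: w(3) unit_vec_def)
      with j show "vec \<delta> (\<lambda>j. \<Sum>i<\<delta>. c i * Nm h (cl (w i)) $ j) $ j = vec \<delta> c $ j" by simp
    qed simp
    finally show ?thesis .
  qed
  have lc_zero: "c i = 0" if c: "cl (lincomb \<delta> w c) = \<zero>\<^bsub>R\<^esub>" and i: "i < \<delta>" for c i
  proof -
    have "Nm h (cl (lincomb \<delta> w (\<lambda>_. 0))) = Nm h (cl (lincomb \<delta> w c))"
      unfolding c by (simp add: lincomb_def cl_0)
    then have "vec \<delta> (\<lambda>_. 0) $ i = vec \<delta> c $ i" unfolding Nm_lc by simp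
    with i show ?thesis by simp
  qed
  have carr: "set Us \<subseteq> carrier R" using cl_carrier[OF mv] by (auto simp: Us_def)
  have combine: "R.combine (map \<kappa> cs) Us = cl (lincomb \<delta> w (\<lambda>i. cs ! i))" if "length cs = \<delta>" for cs
    unfolding Us_def by (rule combine_lincomb[OF that]) (rule mv)
  have kappa_list: "\<exists>cs. Ks = map \<kappa> cs" if "set Ks \<subseteq> range \<kappa>" for Ks
    using that ex_map_conv[of Ks \<kappa>] by blast
  have "R.independent (range \<kappa>) Us"
  proof (rule R.trivial_combine_imp_independent[OF subfield_kappa carr])
    fix Ks assume Ks: "set Ks \<subseteq> range \<kappa>" "R.combine Ks Us = \<zero>\<^bsub>R\<^esub>"
    have kc: "range \<kappa> \<subseteq> carrier R" by (auto simp: coord_const_def intro: cl_carrier)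
    \<comment> \<open>The coefficient list may have any length; it is first brought to the length of
      \<open>Us\<close>.\<close>
    obtain Ks' where Ks': "set (take (length Us) Ks) \<subseteq> set Ks'"
      "set Ks' \<subseteq> set (take (length Us) Ks) \<union> {\<zero>\<^bsub>R\<^esub>}" "length Ks' = length Us" "R.combine Ks' Us = \<zero>\<^bsub>R\<^esub>"
      using R.combine_normalize[OF subset_trans[OF Ks(1) kc] carr Ks(2)] by metis
    have k0: "\<kappa> 0 = \<zero>\<^bsub>R\<^esub>" by (simp add: coord_const_def cl_0)
    have "set Ks' \<subseteq> range \<kappa>"
    proof
      fix x assume "x \<in> set Ks'"
      then have "x \<in> set Ks \<or> x = \<kappa> 0" using Ks'(2) set_take_subset[of "length Us" Ks] k0 by blast
      then show "x \<in> range \<kappa>" using Ks(1) by blast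
    qed
    then obtain cs where cs: "Ks' = map \<kappa> cs" using kappa_list by blast
    have "length cs = \<delta>" using Ks'(3) cs len by simp
    then have "cs ! i = 0" if "i < \<delta>" for i
      using lc_zero[of "\<lambda>i. cs ! i" i] combine Ks'(4) cs that by simp
    then have "set Ks' \<subseteq> {\<zero>\<^bsub>R\<^esub>}"
      using \<open>length cs = \<delta>\<close> by (auto simp: cs in_set_conv_nth k0)
    with Ks'(1) show "set (take (length Us) Ks) \<subseteq> {\<zero>\<^bsub>R\<^esub>}" by blast
  qed
  moreover have "R.Span (range \<kappa>) Us = B"
  proof (intro subset_antisym subsetI)
    fix x assume "x \<in> R.Span (range \<kappa>) Us"
    then obtain Ks where Ks: "set Ks \<subseteq> range \<kappa>" "length Ks = length Us" "x = R.combine Ks Us"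
      using R.Span_mem_iff_length_version[OF subfield_kappa carr] by blast
    then obtain cs where "Ks = map \<kappa> cs" using kappa_list by blast
    with Ks len combine lcB show "x \<in> B" by simp
  next
    fix x assume x: "x \<in> B"
    define cs where "cs = list_of_vec (Nm h x)"
    have lcs: "length cs = \<delta>" using Nm_carrier[of x h] by (simp add: cs_def)
    have "vec \<delta> (\<lambda>i. cs ! i) = Nm h x"
      using Nm_carrier[of x h] by (intro eq_vecI) (auto simp: cs_def)
    then have "x = cl (lincomb \<delta> w (\<lambda>i. cs ! i))"
      by (intro inj_onD[OF bij_betw_imp_inj_on[OF B_bij] _ x lcB]) (simp add: Nm_lc)
    then have "x = R.combine (map \<kappa> cs) Us" using combine[OF lcs] by simp
    then show "x \<in> R.Span (range \<kappa>) Us"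
      using R.Span_mem_iff_length_version[OF subfield_kappa carr, of x] lcs len
      by (auto intro!: exI[of _ "map \<kappa> cs"])
  qed
  \<comment> \<open>In the chosen basis the matrix of \<open>T\<close> is that of
    \<open>N_p\<close>.\<close>
  moreover define A where "A = mat \<delta> \<delta> (\<lambda>(i, j). Nm p (cl (w j)) $ i)"
  have A: "A \<in> carrier_mat \<delta> \<delta>" by (simp add: A_def)
  have T_lc: "T (cl (w j)) = cl (lincomb \<delta> w (\<lambda>i. A $$ (i, j)))" if j: "j < \<delta>" for j
  proof (rule T_eqI[OF lcB])
    show "Nm h (cl (lincomb \<delta> w (\<lambda>i. A $$ (i, j)))) = Nm p (cl (w j))"
      unfolding Nm_lc using j Nm_carrier[of "cl (w j)" p] by (intro eq_vecI) (auto simp: A_def)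
  qed
  moreover have "T (Us ! j) = R.combine (map \<kappa> (list_of_vec (col A j))) Us" if j: "j < length Us" for j
  proof -
    have jd: "j < \<delta>" using j len by simp
    have "R.combine (map \<kappa> (list_of_vec (col A j))) Us = cl (lincomb \<delta> w (\<lambda>i. list_of_vec (col A j) ! i))"
      by (rule combine) (use A in simp)
    also have "lincomb \<delta> w (\<lambda>i. list_of_vec (col A j) ! i) = lincomb \<delta> w (\<lambda>i. A $$ (i, j))"
      by (rule lincomb_cong) (use A jd in auto)
    also have "cl \<dots> = T (Us ! j)" using T_lc[OF jd] jd by (simp add: Us_def)
    finally show ?thesis ..
  qed
  moreover have "eigenvalue (map_mat to_ac A) (coord_val p z / coord_val h z)"
  proof -
    let ?\<mu> = "coord_val p z / coord_val h z" and ?A = "map_mat to_ac A"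
    define y where "y = vec \<delta> (\<lambda>i. meval to_ac z (w i))"
    have hz: "coord_val h z \<noteq> 0" using h(2) Z by blast
    have A': "?A \<in> carrier_mat \<delta> \<delta>" using A by simp
    have "transpose_mat ?A *\<^sub>v y = ?\<mu> \<cdot>\<^sub>v y"
    proof (rule eq_vecI)
      fix j assume "j < dim_vec (?\<mu> \<cdot>\<^sub>v y)"
      then have j: "j < \<delta>" by (simp add: y_def)
      have "(transpose_mat ?A *\<^sub>v y) $ j = (\<Sum>i<\<delta>. to_ac (A $$ (i, j)) * meval to_ac z (w i))"
        using j A by (simp add: y_def scalar_prod_def atLeast0LessThan)
      also have "\<dots> = coord_val (T (cl (w j))) z"
        unfolding T_lc[OF j] by (subst coord_val_cl[OF _ Z]) (auto simp: meval_lincomb intro!: lincomb_mvars mv[THEN subsetD])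
      also have "\<dots> = ?\<mu> * meval to_ac z (w j)"
        using T_val[OF w(2)[OF j] Z] hz coord_val_cl[OF mv[OF j] Z] by (simp add: field_simps)
      finally show "(transpose_mat ?A *\<^sub>v y) $ j = (?\<mu> \<cdot>\<^sub>v y) $ j" using j by (simp add: y_def)
    qed (use A in \<open>simp add: y_def\<close>)
    \<comment> \<open>If evaluation at \<open>z\<close> were zero on \<open>B\<close>, only the
      other \<delta> - 1 points would impose conditions on \<delta> coefficients. Some nonzero
      combination would then vanish at every point, against
      \<open>evaluation_injective\<close>.\<close>
    moreover have "y \<noteq> 0\<^sub>v \<delta>"
    proof
      assume y0: "y = 0\<^sub>v \<delta>"
      have yz: "meval to_ac z (w i) = 0" if "i < \<delta>" for i
        using arg_cong[OF y0, of "\<lambda>v :: 'k alg_closure vec. v $ i"] that by (simp add: y_def)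
      have "\<delta> > 0" using points Z(1) by (metis card_gt_0_iff empty_iff)
      then obtain D where D: "\<delta> = Suc D" by (cases \<delta>) auto
      have fin: "finite (pts - {Z})" and card: "card (pts - {Z}) = D" using points Z(1) D by auto
      obtain b where b: "bij_betw b {..<D} (pts - {Z})"
        using ex_bij_betw_nat_finite[OF fin] card by (auto simp: atLeast0LessThan)
      define \<rho> where "\<rho> Z' = (SOME z. z \<in> Z')" for Z' :: "'k pt"
      have \<rho>: "\<rho> Z' \<in> Z'" if "Z' \<in> pts" for Z'
        unfolding \<rho>_def using scheme_points_nonempty[OF that] by (rule someI_ex)
      obtain c where c: "\<exists>j\<le>D. c j \<noteq> 0" "\<forall>i<D. (\<Sum>j\<le>D. meval to_ac (\<rho> (b i)) (w j) * c j) = 0"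
        using exists_kernel_vector[of D "\<lambda>i j. meval to_ac (\<rho> (b i)) (w j)"] by auto
      have "indep \<delta> w"
        by (rule indep_if_mem_B) (use w lc_zero in auto)
      moreover have "\<exists>z\<in>Z'. (\<Sum>i<\<delta>. c i * meval to_ac z (w i)) = 0" if Z': "Z' \<in> pts" for Z'
      proof (cases "Z' = Z")
        case True
        then show ?thesis using Z(2) yz by (intro bexI[of _ z]) auto
      next
        case False
        then have "Z' \<in> b ` {..<D}" using Z' bij_betw_imp_surj_on[OF b] by simp
        then obtain i where "i < D" "Z' = b i" by auto
        with c(2) have "(\<Sum>j<\<delta>. c j * meval to_ac (\<rho> Z') (w j)) = 0"
          by (simp add: D lessThan_Suc_atMost mult.commute)
        then show ?thesis using \<rho>[OF Z'] by blast
      qed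
      ultimately have "c i = 0" if "i < \<delta>" for i
        using evaluation_injective[of \<delta> w c i] w(1) that by blast
      with c(1) show False by (auto simp: D less_Suc_eq_le)
    qed
    \<comment> \<open>Evaluation is an eigenvector of the transpose, which has the same
      characteristic polynomial as the matrix.\<close>
    ultimately have "eigenvalue (transpose_mat ?A) ?\<mu>"
      unfolding eigenvalue_def eigenvector_def using A by (intro exI[of _ y]) (simp add: y_def)
    then show ?thesis
      using eigenvalue_root_char_poly[OF A'] eigenvalue_root_char_poly[of "transpose_mat ?A" \<delta>]
        char_poly_transpose_mat[OF A'] A' by simp
  qed
  ultimately show ?thesis
    unfolding ac_eigenvalue_def using A len by (intro exI[of _ Us] exI[of _ A]) simp
qed

end

end

theorem theorem4p5:
  fixes n l s \<delta> :: nat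
    and \<phi> F :: "nat \<Rightarrow> 'k::field mpoly"
    and r :: "(expo \<times> expo) set"
    and idx :: "int \<Rightarrow> expo \<Rightarrow> nat list"
    and ds :: "nat \<Rightarrow> nat"
    and I :: "'k mpoly set set"
    and d e :: int
    and h :: "'k mpoly set"
    and M :: "nat \<times> expo \<Rightarrow> expo \<Rightarrow> 'k"
    and N :: "nat \<Rightarrow> expo \<Rightarrow> 'k"
    and Nmul :: "'k mpoly set \<Rightarrow> 'k mpoly set \<Rightarrow> 'k vec"
  assumes phi: "\<forall>i\<le>l. \<phi> i \<noteq> 0 \<and> mvars (\<phi> i) \<subseteq> {1..n}"
    and order: "monomial_order n r"
    and khovanskii: "khovanskii_basis r (gen_family l \<phi>)"
    and idx: "index_choice r l \<phi> idx"
    and F: "\<forall>i\<in>{1..s}. ds i > 0 \<and> F i \<in> carrier (poly_ring_upto l) \<and> mhomog (ds i) (F i)"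
    and I: "I = Idl\<^bsub>coord_ring n l \<phi>\<^esub> ((\<lambda>i. cls n l \<phi> (F i)) ` {1..s})"
    and reduced: "reduced_scheme l \<phi> I"
    and points: "finite (scheme_points l \<phi> I)" "card (scheme_points l \<phi> I) = \<delta>"
    and e: "e > 0"
    and reg: "d \<in> Reg n l \<phi> \<delta> I" "d + e \<in> Reg n l \<phi> \<delta> I"
    and h: "h \<in> coord_deg n l \<phi> e" "\<forall>Z\<in>scheme_points l \<phi> I. \<forall>z\<in>Z. coord_val h z \<noteq> 0"
    and M: "macaulay_matrix l \<phi> r idx s ds F (d + e) M"
    and N: "rows_basis \<delta> N (right_kernel (macaulay_rows r l \<phi> s ds (d + e)) (dA r l \<phi> (d + e)) M)"
    and Nmul: "Nmul = (\<lambda>p g. kernel_map n l \<phi> r idx \<delta> (d + e) N (g \<otimes>\<^bsub>coord_ring n l \<phi>\<^esub> p))"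
  shows "(\<exists>B. invertible_on n l \<phi> \<delta> d (Nmul h) B) \<and>
    (\<forall>B. invertible_on n l \<phi> \<delta> d (Nmul h) B \<longrightarrow>
      (\<forall>p\<in>coord_deg n l \<phi> e.
        {\<mu>. ac_eigenvalue (coord_ring n l \<phi>) (coord_const n l \<phi>) B
              (\<lambda>g. inv_into B (Nmul h) (Nmul p g)) \<mu>} =
        {coord_val p z / coord_val h z | z Z. Z \<in> scheme_points l \<phi> I \<and> z \<in> Z}))"
proof -
  interpret khovanskii_eigen n l \<phi> r idx s ds F I \<delta> d e h M N
    by unfold_locales (use assms in \<open>auto simp: hpolys_def\<close>)
  show ?thesis
    unfolding Nmul
  proof (intro conjI allI impI ballI)
    show "\<exists>B. invertible_on n l \<phi> \<delta> d (Nm h) B" by (rule exists_invertible_on)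
    fix B p assume "invertible_on n l \<phi> \<delta> d (Nm h) B" "p \<in> coord_deg n l \<phi> e"
    from eigenvalue_imp_value[OF this] value_imp_eigenvalue[OF this]
    show "{\<mu>. ac_eigenvalue R \<kappa> B (\<lambda>g. inv_into B (Nm h) (Nm p g)) \<mu>} =
        {coord_val p z / coord_val h z | z Z. Z \<in> pts \<and> z \<in> Z}"
      by blast
  qed
qed

end
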